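(* Let $\Sigma$ be a compact oriented surface without boundary, $M$ a conformal manifold and $x\colon\Sigma\to M$ an immersion, with induced complex structure $J_x$ on $\Sigma$. Let $\sigma\in\Gamma(\mathrm{Hom}(T\Sigma,T^*\Sigma))$ be non-zero and represent a cotangent vector to Teichmüller space at $[J_x]$, and define the first order linear differential operator $$\mathrm{D}_x\colon\Gamma(x^*TM)\to\Omega^2_\Sigma,\qquad \mathrm{D}_x(V)=\langle\sigma\wedge(L_{V^\top}J_x+2A_0^{V^\perp}J_x)\rangle.$$ Set $Q=J_x^t\sigma$ and $q=Q^{2,0}$. Then: 1. $\mathrm{D}_x(V)=d(\beta_x(V))+E_x(V)$ for all $V\in\Gamma(x^*TM)$, where $\beta_x(V)=-2\langle Q,V^\top\rangle$ and $E_x(V)=-2\langle Q\wedge A_0^{V^\perp}\rangle$ are $C^\infty(\Sigma,\mathbb{R})$-linear in $V$; 2. $E_x=0$ if and only if $(x,q)$ is globally isothermic; 3. if $Y$ is a conformal vector field on $M$, then $\mathrm{D}_x(Y\circ x)=0$; moreover, if $E_x=0$, then the Noether current $\beta_x(Y\circ x)=-2\langle Q,Y^\top\rangle=-2\eta_Y$ is closed. Thus, up to the factor $-\tfrac12$, the retraction form $\eta_x^q$ is the Noether current.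
   Context: $J_x$ is anticlockwise rotation by $\pi/2$ for the conformal structure induced by $x$ and the orientation of $\Sigma$. The cotangent space to Teichmüller space at $[J_x]$ is $$\{\sigma\in\Gamma(\mathrm{Hom}(T\Sigma,T^*\Sigma))\mid J_x^t\sigma=\sigma J_x,\ d^\nabla\sigma=0\},$$ with $\nabla$ any torsion-free connection with $\nabla J_x=0$; $\sigma$ is also interpreted as a trace-free symmetric bilinear form on $T\Sigma$, and $q\mapsto 2\operatorname{Re}q$ is an isomorphism from holomorphic quadratic differentials onto this space. Homomorphisms $T\Sigma\to T^*\Sigma$ and endomorphisms of $T\Sigma$ are viewed as $T^*\Sigma$-valued and $T\Sigma$-valued $1$-forms; $\langle\,,\,\rangle$ is the evaluation pairing $T^*\Sigma\times T\Sigma\to\mathbb{R}$, and $\langle\sigma\wedge B\rangle(U,W)=\langle\sigma(U),BW\rangle-\langle\sigma(W),BU\rangle$. Here $(J_x^t\sigma)(U)=\sigma(U)\circ J_x$, and $\langle Q,X\rangle$ is the $1$-form $U\mapsto\langle Q(U),X\rangle=Q(U,X)$. For $V\in\Gamma(x^*TM)$, write $V=dx(V^\top)+V^\perp$ with $V^\perp$ normal to $x$ (for a vector field $Y$ on $M$, $Y^\top$ means $(Y\circ x)^\top$). For a metric in the conformal class of $M$ with induced metric $\mathrm{I}$ and second fundamental form $\mathrm{II}$ of $x$, the shape operator $A^\nu$ of a normal field $\nu$ is given by $\mathrm{I}(A^\nu U,W)=(\mathrm{II}(U,W),\nu)$, and $A_0^\nu$ is its trace-free part, which does not depend on the choice of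 metric in the conformal class. $L$ is the Lie derivative. For a holomorphic quadratic differential $q$ on $(\Sigma,J_x)$, $(x,q)$ is globally isothermic if, with $Q=2\operatorname{Re}q$, $Q(A^\nu U,W)=Q(U,A^\nu W)$ for all $U,W\in T\Sigma$ and all normal vectors $\nu$. The retraction form $\eta_x^q$ assigns to each conformal vector field $Y$ on $M$ the $1$-form $\eta_Y(U)=2\operatorname{Re}q(Y^\top,U)$ on $\Sigma$. *)

theory Defs
  imports "HOL-Analysis.Analysis"
begin

section \<open>Smooth maps between open subsets of normed spaces\<close>

text \<open>For open \<open>S\<close> in a finite-dimensional space this is the usual \<open>C\<^sup>k\<close>, resp. \<open>C\<^sup>\<infinity>\<close>.\<close>

primrec Ck_on :: "nat \<Rightarrow> 'a::real_normed_vector set \<Rightarrow> ('a \<Rightarrow> 'b::real_normed_vector) \<Rightarrow> bool" where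
  "Ck_on 0 S f \<longleftrightarrow> continuous_on S f"
| "Ck_on (Suc k) S f \<longleftrightarrow>
     (\<forall>z\<in>S. f differentiable (at z)) \<and> (\<forall>v. Ck_on k S (\<lambda>z. frechet_derivative f (at z) v))"

definition smooth_on :: "'a::real_normed_vector set \<Rightarrow> ('a \<Rightarrow> 'b::real_normed_vector) \<Rightarrow> bool" where
  "smooth_on S f \<longleftrightarrow> (\<forall>k. Ck_on k S f)"

section \<open>Smooth manifolds\<close>

text \<open>A manifold is a (Hausdorff, second countable) topological type together with a smooth
  atlas, which need not be maximal.\<close>

type_synonym ('a, 'e) chart = "'a set \<times> ('a \<Rightarrow> 'e)"

abbreviation cdom :: "('a, 'e) chart \<Rightarrow> 'a set" where "cdom c \<equiv> fst c"
abbreviation cmap :: "('a, 'e) chart \<Rightarrow> 'a \<Rightarrow> 'e" where "cmap c \<equiv> snd c"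
abbreviation cimg :: "('a, 'e) chart \<Rightarrow> 'e set" where "cimg c \<equiv> snd c ` fst c"
abbreviation cinv :: "('a, 'e) chart \<Rightarrow> 'e \<Rightarrow> 'a" where "cinv c \<equiv> inv_into (fst c) (snd c)"

definition is_chart :: "('a::topological_space, 'e::euclidean_space) chart \<Rightarrow> bool" where
  "is_chart c \<longleftrightarrow> open (cdom c) \<and> open (cimg c) \<and> homeomorphism (cdom c) (cimg c) (cmap c) (cinv c)"

definition atlas ::
  "('a::{t2_space,second_countable_topology}, 'e::euclidean_space) chart set \<Rightarrow> bool" where
  "atlas A \<longleftrightarrow> (\<forall>c\<in>A. is_chart c) \<and> (\<Union>c\<in>A. cdom c) = UNIV \<and>
     (\<forall>c\<in>A. \<forall>c'\<in>A. smooth_on (cmap c ` (cdom c \<inter> cdom c')) (cmap c' \<circ> cinv c))"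

definition oriented_atlas ::
  "('a::{t2_space,second_countable_topology}, real^2) chart set \<Rightarrow> bool" where
  "oriented_atlas A \<longleftrightarrow> atlas A \<and>
     (\<forall>c\<in>A. \<forall>c'\<in>A. \<forall>z\<in>cmap c ` (cdom c \<inter> cdom c').
        0 < det (matrix (frechet_derivative (cmap c' \<circ> cinv c) (at z))))"

definition chart_at :: "('a, 'e) chart set \<Rightarrow> 'a \<Rightarrow> ('a, 'e) chart" where
  "chart_at A p = (SOME c. c \<in> A \<and> p \<in> cdom c)"

text \<open>The tangent space at \<open>p\<close> is modelled by the vector space \<open>'e\<close>: a tangent vector is
  represented by its components in the preferred chart \<open>chart_at A p\<close>. Consequently vector fields
  are functions \<open>'a \<Rightarrow> 'e\<close>, sections of \<open>x\<^sup>*TM\<close> are functions from the source of \<open>x\<close> into the model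
  space of \<open>M\<close>, and tensors at a point are (multi)linear maps on \<open>'e\<close>. The preferred charts carry
  no continuity in \<open>p\<close>; the maps \<open>to_chart A c p\<close> and \<open>from_chart A c p\<close>
  translate between these components and those in an arbitrary chart \<open>c\<close> around \<open>p\<close>, and
  smoothness always refers to the components in a fixed chart. The chart \<open>c\<close> of
  \<open>to_chart\<close> may have values in another vector space, such as \<open>\<complex>\<close>; then
  \<open>to_chart A c p\<close> is the differential of \<open>c\<close> at \<open>p\<close>.\<close>

definition to_chart ::
  "('a, 'e::euclidean_space) chart set \<Rightarrow> ('a, 'f::euclidean_space) chart \<Rightarrow> 'a \<Rightarrow> 'e \<Rightarrow> 'f" where
  "to_chart A c p =
     frechet_derivative (cmap c \<circ> cinv (chart_at A p)) (at (cmap (chart_at A p) p))"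

definition from_chart ::
  "('a, 'e::euclidean_space) chart set \<Rightarrow> ('a, 'f::euclidean_space) chart \<Rightarrow> 'a \<Rightarrow> 'f \<Rightarrow> 'e" where
  "from_chart A c p = frechet_derivative (cmap (chart_at A p) \<circ> cinv c) (at (cmap c p))"

definition smooth_fun :: "('a, 'e::euclidean_space) chart set \<Rightarrow> ('a \<Rightarrow> real) \<Rightarrow> bool" where
  "smooth_fun A f \<longleftrightarrow> (\<forall>c\<in>A. smooth_on (cimg c) (f \<circ> cinv c))"

definition smooth_map ::
  "('a::topological_space, 'e::euclidean_space) chart set \<Rightarrow>
   ('b::topological_space, 'f::euclidean_space) chart set \<Rightarrow> ('a \<Rightarrow> 'b) \<Rightarrow> bool" where
  "smooth_map A B x \<longleftrightarrow> continuous_on UNIV x \<and>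
     (\<forall>c\<in>A. \<forall>d\<in>B. smooth_on (cmap c ` (cdom c \<inter> x -` cdom d)) (cmap d \<circ> x \<circ> cinv c))"

definition differential ::
  "('a, 'e::euclidean_space) chart set \<Rightarrow> ('b, 'f::euclidean_space) chart set \<Rightarrow>
   ('a \<Rightarrow> 'b) \<Rightarrow> 'a \<Rightarrow> 'e \<Rightarrow> 'f" where
  "differential A B x p =
     frechet_derivative (cmap (chart_at B (x p)) \<circ> x \<circ> cinv (chart_at A p))
       (at (cmap (chart_at A p) p))"

definition immersion ::
  "('a::topological_space, 'e::euclidean_space) chart set \<Rightarrow>
   ('b::topological_space, 'f::euclidean_space) chart set \<Rightarrow> ('a \<Rightarrow> 'b) \<Rightarrow> bool" where
  "immersion A B x \<longleftrightarrow> smooth_map A B x \<and> (\<forall>p. inj (differential A B x p))"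

text \<open>Smooth sections of \<open>x\<^sup>*TM\<close>; for \<open>x\<close> the identity these are the vector fields.\<close>

definition sections ::
  "('a, 'e::euclidean_space) chart set \<Rightarrow> ('b, 'f::euclidean_space) chart set \<Rightarrow>
   ('a \<Rightarrow> 'b) \<Rightarrow> ('a \<Rightarrow> 'f) set" where
  "sections A B x = {V. \<forall>c\<in>A. \<forall>d\<in>B.
     smooth_on (cmap c ` (cdom c \<inter> x -` cdom d))
       (\<lambda>z. to_chart B d (x (cinv c z)) (V (cinv c z)))}"

abbreviation vector_fields :: "('a, 'e::euclidean_space) chart set \<Rightarrow> ('a \<Rightarrow> 'e) set" where
  "vector_fields A \<equiv> sections A A (\<lambda>p. p)"

subsection \<open>Components of tensor fields in a chart, as functions of the coordinates\<close>

definition vec_in ::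
  "('a, 'e::euclidean_space) chart set \<Rightarrow> ('a, 'e) chart \<Rightarrow> ('a \<Rightarrow> 'e) \<Rightarrow> 'e \<Rightarrow> 'e" where
  "vec_in A c X z = to_chart A c (cinv c z) (X (cinv c z))"

definition endo_in ::
  "('a, 'e::euclidean_space) chart set \<Rightarrow> ('a, 'e) chart \<Rightarrow> ('a \<Rightarrow> 'e \<Rightarrow> 'e) \<Rightarrow> 'e \<Rightarrow> 'e \<Rightarrow> 'e" where
  "endo_in A c J z u = to_chart A c (cinv c z) (J (cinv c z) (from_chart A c (cinv c z) u))"

definition form_in ::
  "('a, 'e::euclidean_space) chart set \<Rightarrow> ('a, 'e) chart \<Rightarrow> ('a \<Rightarrow> 'e \<Rightarrow> real) \<Rightarrow> 'e \<Rightarrow> 'e \<Rightarrow> real" where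
  "form_in A c \<alpha> z u = \<alpha> (cinv c z) (from_chart A c (cinv c z) u)"

definition bil_in ::
  "('a, 'e::euclidean_space) chart set \<Rightarrow> ('a, 'e) chart \<Rightarrow>
   ('a \<Rightarrow> 'e \<Rightarrow> 'e \<Rightarrow> real) \<Rightarrow> 'e \<Rightarrow> 'e \<Rightarrow> 'e \<Rightarrow> real" where
  "bil_in A c \<sigma> z u w =
     \<sigma> (cinv c z) (from_chart A c (cinv c z) u) (from_chart A c (cinv c z) w)"

definition one_forms :: "('a, 'e::euclidean_space) chart set \<Rightarrow> ('a \<Rightarrow> 'e \<Rightarrow> real) set" where
  "one_forms A = {\<alpha>. (\<forall>p. linear (\<alpha> p)) \<and>
     (\<forall>c\<in>A. \<forall>u. smooth_on (cimg c) (\<lambda>z. form_in A c \<alpha> z u))}"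

text \<open>Covariant 2-tensors; a section \<open>\<sigma>\<close> of \<open>Hom(T\<Sigma>, T\<^sup>*\<Sigma>)\<close> is written
  \<open>\<sigma> p u w = \<langle>\<sigma>(u), w\<rangle>\<close>.\<close>

definition two_tensors :: "('a, 'e::euclidean_space) chart set \<Rightarrow> ('a \<Rightarrow> 'e \<Rightarrow> 'e \<Rightarrow> real) set" where
  "two_tensors A = {\<sigma>. (\<forall>p. bilinear (\<sigma> p)) \<and>
     (\<forall>c\<in>A. \<forall>u w. smooth_on (cimg c) (\<lambda>z. bil_in A c \<sigma> z u w))}"

definition two_forms :: "('a, 'e::euclidean_space) chart set \<Rightarrow> ('a \<Rightarrow> 'e \<Rightarrow> 'e \<Rightarrow> real) set" where
  "two_forms A = {\<omega> \<in> two_tensors A. \<forall>p u. \<omega> p u u = 0}"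

text \<open>The exterior derivative and the Lie derivatives below are evaluated at \<open>p\<close> in the preferred
  chart at \<open>p\<close>, applied to vector fields with constant components in that chart:
  \<open>d\<alpha>(U,W) = U(\<alpha>(W)) - W(\<alpha>(U)) - \<alpha>([U,W])\<close>,
  \<open>(L\<^sub>X J)(U) = [X, J U] - J [X, U]\<close> and
  \<open>(L\<^sub>Y g)(U,W) = Y(g(U,W)) - g([Y,U],W) - g(U,[Y,W])\<close>.\<close>

definition ext_deriv ::
  "('a, 'e::euclidean_space) chart set \<Rightarrow> ('a \<Rightarrow> 'e \<Rightarrow> real) \<Rightarrow> 'a \<Rightarrow> 'e \<Rightarrow> 'e \<Rightarrow> real" where
  "ext_deriv A \<alpha> p u w = (let c = chart_at A p; z = cmap c p in
     frechet_derivative (\<lambda>z. form_in A c \<alpha> z w) (at z) u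
     - frechet_derivative (\<lambda>z. form_in A c \<alpha> z u) (at z) w)"

definition lie_endo ::
  "('a, 'e::euclidean_space) chart set \<Rightarrow> ('a \<Rightarrow> 'e) \<Rightarrow> ('a \<Rightarrow> 'e \<Rightarrow> 'e) \<Rightarrow> 'a \<Rightarrow> 'e \<Rightarrow> 'e" where
  "lie_endo A X J p u = (let c = chart_at A p; z = cmap c p in
     frechet_derivative (\<lambda>z. endo_in A c J z u) (at z) (X p)
     - frechet_derivative (vec_in A c X) (at z) (J p u)
     + J p (frechet_derivative (vec_in A c X) (at z) u))"

definition lie_metric ::
  "('b, 'f::euclidean_space) chart set \<Rightarrow> ('b \<Rightarrow> 'f) \<Rightarrow> ('b \<Rightarrow> 'f \<Rightarrow> 'f \<Rightarrow> real) \<Rightarrow>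
   'b \<Rightarrow> 'f \<Rightarrow> 'f \<Rightarrow> real" where
  "lie_metric B Y g y u w = (let d = chart_at B y; z = cmap d y in
     frechet_derivative (\<lambda>z. bil_in B d g z u w) (at z) (Y y)
     + g y (frechet_derivative (vec_in B d Y) (at z) u) w
     + g y u (frechet_derivative (vec_in B d Y) (at z) w))"

section \<open>Conformal manifolds\<close>

definition riemannian_metric ::
  "('b, 'f::euclidean_space) chart set \<Rightarrow> ('b \<Rightarrow> 'f \<Rightarrow> 'f \<Rightarrow> real) \<Rightarrow> bool" where
  "riemannian_metric B g \<longleftrightarrow> g \<in> two_tensors B \<and> (\<forall>y u w. g y u w = g y w u) \<and>
     (\<forall>y u. u \<noteq> 0 \<longrightarrow> 0 < g y u u)"

definition conformal_structure ::
  "('b, 'f::euclidean_space) chart set \<Rightarrow> ('b \<Rightarrow> 'f \<Rightarrow> 'f \<Rightarrow> real) set \<Rightarrow> bool" where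
  "conformal_structure B C \<longleftrightarrow> (\<exists>g. riemannian_metric B g \<and>
     C = {h. riemannian_metric B h \<and>
            (\<exists>f. smooth_fun B f \<and> (\<forall>y. 0 < f y) \<and> (\<forall>y u w. h y u w = f y * g y u w))})"

text \<open>If the following holds for one metric of the conformal class, it holds for all of them.\<close>

definition conformal_vector_field ::
  "('b, 'f::euclidean_space) chart set \<Rightarrow> ('b \<Rightarrow> 'f \<Rightarrow> 'f \<Rightarrow> real) set \<Rightarrow> ('b \<Rightarrow> 'f) \<Rightarrow> bool" where
  "conformal_vector_field B C Y \<longleftrightarrow> Y \<in> vector_fields B \<and>
     (\<exists>g\<in>C. \<exists>k. \<forall>y u w. lie_metric B Y g y u w = k y * g y u w)"

text \<open>Christoffel symbols of the Levi-Civita connection of \<open>g\<close> at \<open>y\<close> in the preferred chart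
  at \<open>y\<close>, by the Koszul formula.\<close>

definition christoffel ::
  "('b, 'f::euclidean_space) chart set \<Rightarrow> ('b \<Rightarrow> 'f \<Rightarrow> 'f \<Rightarrow> real) \<Rightarrow> 'b \<Rightarrow> 'f \<Rightarrow> 'f \<Rightarrow> 'f" where
  "christoffel B g y a b = (let d = chart_at B y; z = cmap d y;
       dg = (\<lambda>a b c. frechet_derivative (\<lambda>z. bil_in B d g z b c) (at z) a)
     in THE v. \<forall>c. g y v c = (dg a b c + dg b a c - dg c a b) / 2)"

section \<open>Immersed surfaces\<close>

text \<open>In this section \<open>g\<close> is a metric in the conformal class of \<open>M\<close>.\<close>

definition induced_metric ::
  "('a, 'e::euclidean_space) chart set \<Rightarrow> ('b, 'f::euclidean_space) chart set \<Rightarrow>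
   ('b \<Rightarrow> 'f \<Rightarrow> 'f \<Rightarrow> real) \<Rightarrow> ('a \<Rightarrow> 'b) \<Rightarrow> 'a \<Rightarrow> 'e \<Rightarrow> 'e \<Rightarrow> real" where
  "induced_metric A B g x p u w = g (x p) (differential A B x p u) (differential A B x p w)"

definition is_rotation :: "(real^2 \<Rightarrow> real^2 \<Rightarrow> real) \<Rightarrow> (real^2 \<Rightarrow> real^2) \<Rightarrow> bool" where
  "is_rotation b J \<longleftrightarrow> linear J \<and> (\<forall>u. b u (J u) = 0 \<and> b (J u) (J u) = b u u) \<and>
     (\<forall>u. u \<noteq> 0 \<longrightarrow> 0 < det (vector [u, J u] :: real^2^2))"

definition complex_structure ::
  "('a, real^2) chart set \<Rightarrow> ('b, 'f::euclidean_space) chart set \<Rightarrow>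
   ('b \<Rightarrow> 'f \<Rightarrow> 'f \<Rightarrow> real) \<Rightarrow> ('a \<Rightarrow> 'b) \<Rightarrow> 'a \<Rightarrow> real^2 \<Rightarrow> real^2" where
  "complex_structure A B g x p = (THE J. is_rotation (induced_metric A B g x p) J)"

definition normal_vector ::
  "('a, 'e::euclidean_space) chart set \<Rightarrow> ('b, 'f::euclidean_space) chart set \<Rightarrow>
   ('b \<Rightarrow> 'f \<Rightarrow> 'f \<Rightarrow> real) \<Rightarrow> ('a \<Rightarrow> 'b) \<Rightarrow> 'a \<Rightarrow> 'f \<Rightarrow> bool" where
  "normal_vector A B g x p \<nu> \<longleftrightarrow> (\<forall>u. g (x p) \<nu> (differential A B x p u) = 0)"

definition tan_part ::
  "('a, 'e::euclidean_space) chart set \<Rightarrow> ('b, 'f::euclidean_space) chart set \<Rightarrow>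
   ('b \<Rightarrow> 'f \<Rightarrow> 'f \<Rightarrow> real) \<Rightarrow> ('a \<Rightarrow> 'b) \<Rightarrow> ('a \<Rightarrow> 'f) \<Rightarrow> 'a \<Rightarrow> 'e" where
  "tan_part A B g x V p = (THE u. normal_vector A B g x p (V p - differential A B x p u))"

definition nor_part ::
  "('a, 'e::euclidean_space) chart set \<Rightarrow> ('b, 'f::euclidean_space) chart set \<Rightarrow>
   ('b \<Rightarrow> 'f \<Rightarrow> 'f \<Rightarrow> real) \<Rightarrow> ('a \<Rightarrow> 'b) \<Rightarrow> ('a \<Rightarrow> 'f) \<Rightarrow> 'a \<Rightarrow> 'f" where
  "nor_part A B g x V p = V p - differential A B x p (tan_part A B g x V p)"

text \<open>\<open>\<nabla>\<^sub>U (dx W)\<close> for the Levi-Civita connection of \<open>g\<close>, with \<open>W\<close> extended to have constant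
  components in the preferred chart at \<open>p\<close>; its normal part is \<open>II(U,W)\<close>.\<close>

definition nabla_dx ::
  "('a, 'e::euclidean_space) chart set \<Rightarrow> ('b, 'f::euclidean_space) chart set \<Rightarrow>
   ('b \<Rightarrow> 'f \<Rightarrow> 'f \<Rightarrow> real) \<Rightarrow> ('a \<Rightarrow> 'b) \<Rightarrow> 'a \<Rightarrow> 'e \<Rightarrow> 'e \<Rightarrow> 'f" where
  "nabla_dx A B g x p u w =
     (let c = chart_at A p; d = chart_at B (x p); x' = cmap d \<circ> x \<circ> cinv c in
       frechet_derivative (\<lambda>z. frechet_derivative x' (at z) w) (at (cmap c p)) u
       + christoffel B g (x p) (differential A B x p u) (differential A B x p w))"

definition second_fundamental_form ::
  "('a, 'e::euclidean_space) chart set \<Rightarrow> ('b, 'f::euclidean_space) chart set \<Rightarrow>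
   ('b \<Rightarrow> 'f \<Rightarrow> 'f \<Rightarrow> real) \<Rightarrow> ('a \<Rightarrow> 'b) \<Rightarrow> 'a \<Rightarrow> 'e \<Rightarrow> 'e \<Rightarrow> 'f" where
  "second_fundamental_form A B g x p u w =
     nor_part A B g x (\<lambda>p. nabla_dx A B g x p u w) p"

definition shape_operator ::
  "('a, 'e::euclidean_space) chart set \<Rightarrow> ('b, 'f::euclidean_space) chart set \<Rightarrow>
   ('b \<Rightarrow> 'f \<Rightarrow> 'f \<Rightarrow> real) \<Rightarrow> ('a \<Rightarrow> 'b) \<Rightarrow> 'a \<Rightarrow> 'f \<Rightarrow> 'e \<Rightarrow> 'e" where
  "shape_operator A B g x p \<nu> = (THE S. \<forall>u w.
     induced_metric A B g x p (S u) w = g (x p) (second_fundamental_form A B g x p u w) \<nu>)"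

definition shape_operator0 ::
  "('a, real^2) chart set \<Rightarrow> ('b, 'f::euclidean_space) chart set \<Rightarrow>
   ('b \<Rightarrow> 'f \<Rightarrow> 'f \<Rightarrow> real) \<Rightarrow> ('a \<Rightarrow> 'b) \<Rightarrow> 'a \<Rightarrow> 'f \<Rightarrow> real^2 \<Rightarrow> real^2" where
  "shape_operator0 A B g x p \<nu> u = shape_operator A B g x p \<nu> u
     - (trace (matrix (shape_operator A B g x p \<nu>)) / 2) *\<^sub>R u"

section \<open>Cotangent vectors to Teichmueller space\<close>

text \<open>A linear connection on \<open>TS\<close> is given by its Christoffel symbols \<open>\<Gamma> c z\<close> in each chart \<open>c\<close>
  of the atlas, so that \<open>\<nabla>\<^sub>U W = DW(U) + \<Gamma>(U,W)\<close> in that chart.\<close>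

definition connection ::
  "('a, 'e::euclidean_space) chart set \<Rightarrow> (('a, 'e) chart \<Rightarrow> 'e \<Rightarrow> 'e \<Rightarrow> 'e \<Rightarrow> 'e) \<Rightarrow> bool" where
  "connection A \<Gamma> \<longleftrightarrow>
     (\<forall>c\<in>A. (\<forall>z\<in>cimg c. bilinear (\<Gamma> c z)) \<and> (\<forall>u w. smooth_on (cimg c) (\<lambda>z. \<Gamma> c z u w))) \<and>
     (\<forall>c\<in>A. \<forall>c'\<in>A. \<forall>z\<in>cmap c ` (cdom c \<inter> cdom c'). \<forall>u w.
        (let t = cmap c' \<circ> cinv c; Dt = frechet_derivative t (at z) in
          \<Gamma> c' (t z) (Dt u) (Dt w) = Dt (\<Gamma> c z u w)
            - frechet_derivative (\<lambda>z. frechet_derivative t (at z) w) (at z) u))"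

definition torsion_free ::
  "('a, 'e::euclidean_space) chart set \<Rightarrow> (('a, 'e) chart \<Rightarrow> 'e \<Rightarrow> 'e \<Rightarrow> 'e \<Rightarrow> 'e) \<Rightarrow> bool" where
  "torsion_free A \<Gamma> \<longleftrightarrow> (\<forall>c\<in>A. \<forall>z\<in>cimg c. \<forall>u w. \<Gamma> c z u w = \<Gamma> c z w u)"

definition parallel_endo ::
  "('a, 'e::euclidean_space) chart set \<Rightarrow> (('a, 'e) chart \<Rightarrow> 'e \<Rightarrow> 'e \<Rightarrow> 'e \<Rightarrow> 'e) \<Rightarrow>
   ('a \<Rightarrow> 'e \<Rightarrow> 'e) \<Rightarrow> bool" where
  "parallel_endo A \<Gamma> J \<longleftrightarrow> (\<forall>c\<in>A. \<forall>z\<in>cimg c. \<forall>u w.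
     frechet_derivative (\<lambda>z. endo_in A c J z w) (at z) u
     + \<Gamma> c z u (endo_in A c J z w) - endo_in A c J z (\<Gamma> c z u w) = 0)"

text \<open>Covariant exterior derivative of a \<open>T\<^sup>*\<close>-valued 1-form in the chart \<open>c\<close>:
  \<open>\<langle>d\<^sup>\<nabla>\<sigma>(U,W), Z\<rangle> = \<langle>\<nabla>\<^sub>U(\<sigma>(W)) - \<nabla>\<^sub>W(\<sigma>(U)) - \<sigma>([U,W]), Z\<rangle>\<close> for fields
  with constant components.\<close>

definition cov_ext_deriv ::
  "('a, 'e::euclidean_space) chart set \<Rightarrow> (('a, 'e) chart \<Rightarrow> 'e \<Rightarrow> 'e \<Rightarrow> 'e \<Rightarrow> 'e) \<Rightarrow>
   ('a \<Rightarrow> 'e \<Rightarrow> 'e \<Rightarrow> real) \<Rightarrow> ('a, 'e) chart \<Rightarrow> 'e \<Rightarrow> 'e \<Rightarrow> 'e \<Rightarrow> 'e \<Rightarrow> real" where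
  "cov_ext_deriv A \<Gamma> \<sigma> c z u w v =
     (frechet_derivative (\<lambda>z. bil_in A c \<sigma> z w v) (at z) u - bil_in A c \<sigma> z w (\<Gamma> c z u v))
     - (frechet_derivative (\<lambda>z. bil_in A c \<sigma> z u v) (at z) w - bil_in A c \<sigma> z u (\<Gamma> c z w v))"

text \<open>Given \<open>J\<^sup>t\<sigma> = \<sigma>J\<close>, the condition \<open>d\<^sup>\<nabla>\<sigma> = 0\<close> does not depend on the choice of the
  torsion-free connection \<open>\<nabla>\<close> with \<open>\<nabla>J = 0\<close>, and such a connection exists.\<close>

definition teichmueller_covector ::
  "('a, real^2) chart set \<Rightarrow> ('a \<Rightarrow> real^2 \<Rightarrow> real^2) \<Rightarrow> ('a \<Rightarrow> real^2 \<Rightarrow> real^2 \<Rightarrow> real) \<Rightarrow> bool" where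
  "teichmueller_covector A J \<sigma> \<longleftrightarrow> \<sigma> \<in> two_tensors A \<and>
     (\<forall>p u w. \<sigma> p u (J p w) = \<sigma> p (J p u) w) \<and>
     (\<exists>\<Gamma>. connection A \<Gamma> \<and> torsion_free A \<Gamma> \<and> parallel_endo A \<Gamma> J \<and>
        (\<forall>c\<in>A. \<forall>z\<in>cimg c. \<forall>u w v. cov_ext_deriv A \<Gamma> \<sigma> c z u w v = 0))"

section \<open>Quadratic differentials and isothermic surfaces\<close>

definition holomorphic_chart ::
  "('a::topological_space, real^2) chart set \<Rightarrow> ('a \<Rightarrow> real^2 \<Rightarrow> real^2) \<Rightarrow>
   ('a, complex) chart \<Rightarrow> bool" where
  "holomorphic_chart A J k \<longleftrightarrow> is_chart k \<and>
     (\<forall>c\<in>A. smooth_on (cmap c ` (cdom c \<inter> cdom k)) (cmap k \<circ> cinv c)) \<and>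
     (\<forall>p\<in>cdom k. (\<exists>u. to_chart A k p u \<noteq> 0) \<and>
        (\<forall>u. to_chart A k p (J p u) = \<i> * to_chart A k p u))"

text \<open>The second condition says \<open>q = h dz\<^sup>2\<close> with \<open>h\<close> holomorphic in every holomorphic
  coordinate \<open>z\<close> of \<open>J\<close>.\<close>

definition holomorphic_quadratic_differential ::
  "('a::topological_space, real^2) chart set \<Rightarrow> ('a \<Rightarrow> real^2 \<Rightarrow> real^2) \<Rightarrow>
   ('a \<Rightarrow> real^2 \<Rightarrow> real^2 \<Rightarrow> complex) \<Rightarrow> bool" where
  "holomorphic_quadratic_differential A J q \<longleftrightarrow>
     (\<forall>p. bilinear (q p) \<and> (\<forall>u w. q p u w = q p w u \<and> q p (J p u) w = \<i> * q p u w)) \<and>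
     (\<forall>k. holomorphic_chart A J k \<longrightarrow>
        (\<exists>h. h holomorphic_on cimg k \<and>
           (\<forall>p\<in>cdom k. \<forall>u w. q p u w = h (cmap k p) * to_chart A k p u * to_chart A k p w)))"

text \<open>The \<open>(2,0)\<close>-part: complex bilinear extension of \<open>Q\<close>, evaluated on the
  \<open>(1,0)\<close>-parts \<open>(U - \<i> J U)/2\<close> of the arguments.\<close>

definition part_2_0 ::
  "('a \<Rightarrow> real^2 \<Rightarrow> real^2) \<Rightarrow> ('a \<Rightarrow> real^2 \<Rightarrow> real^2 \<Rightarrow> real) \<Rightarrow>
   'a \<Rightarrow> real^2 \<Rightarrow> real^2 \<Rightarrow> complex" where
  "part_2_0 J Q p u w = (of_real (Q p u w) - \<i> * of_real (Q p (J p u) w)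
     - \<i> * of_real (Q p u (J p w)) - of_real (Q p (J p u) (J p w))) / 4"

definition globally_isothermic ::
  "('a::topological_space, real^2) chart set \<Rightarrow> ('b, 'f::euclidean_space) chart set \<Rightarrow>
   ('b \<Rightarrow> 'f \<Rightarrow> 'f \<Rightarrow> real) set \<Rightarrow> ('a \<Rightarrow> 'b) \<Rightarrow> ('a \<Rightarrow> real^2 \<Rightarrow> real^2 \<Rightarrow> complex) \<Rightarrow> bool" where
  "globally_isothermic A B C x q \<longleftrightarrow> (\<forall>g\<in>C.
     holomorphic_quadratic_differential A (complex_structure A B g x) q \<and>
     (\<forall>p \<nu>. normal_vector A B g x p \<nu> \<longrightarrow> (\<forall>u w.
        2 * Re (q p (shape_operator A B g x p \<nu> u) w)
        = 2 * Re (q p u (shape_operator A B g x p \<nu> w)))))"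

text \<open>Here \<open>Y\<close> is a vector field on \<open>M\<close>.\<close>

definition retraction_form ::
  "('a, real^2) chart set \<Rightarrow> ('b, 'f::euclidean_space) chart set \<Rightarrow>
   ('b \<Rightarrow> 'f \<Rightarrow> 'f \<Rightarrow> real) \<Rightarrow> ('a \<Rightarrow> 'b) \<Rightarrow> ('a \<Rightarrow> real^2 \<Rightarrow> real^2 \<Rightarrow> complex) \<Rightarrow>
   ('b \<Rightarrow> 'f) \<Rightarrow> 'a \<Rightarrow> real^2 \<Rightarrow> real" where
  "retraction_form A B g x q Y p u = 2 * Re (q p (tan_part A B g x (Y \<circ> x) p) u)"

section \<open>The operator and its decomposition\<close>

definition wedge_pairing :: "('e \<Rightarrow> 'e \<Rightarrow> real) \<Rightarrow> ('e \<Rightarrow> 'e) \<Rightarrow> 'e \<Rightarrow> 'e \<Rightarrow> real" where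
  "wedge_pairing \<sigma> S u w = \<sigma> u (S w) - \<sigma> w (S u)"

definition transpose_compose ::
  "('a \<Rightarrow> 'e \<Rightarrow> 'e) \<Rightarrow> ('a \<Rightarrow> 'e \<Rightarrow> 'e \<Rightarrow> real) \<Rightarrow> 'a \<Rightarrow> 'e \<Rightarrow> 'e \<Rightarrow> real" where
  "transpose_compose J \<sigma> p u w = \<sigma> p u (J p w)"

definition D_op ::
  "('a, real^2) chart set \<Rightarrow> ('b, 'f::euclidean_space) chart set \<Rightarrow>
   ('b \<Rightarrow> 'f \<Rightarrow> 'f \<Rightarrow> real) \<Rightarrow> ('a \<Rightarrow> 'b) \<Rightarrow> ('a \<Rightarrow> real^2 \<Rightarrow> real^2 \<Rightarrow> real) \<Rightarrow>
   ('a \<Rightarrow> 'f) \<Rightarrow> 'a \<Rightarrow> real^2 \<Rightarrow> real^2 \<Rightarrow> real" where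
  "D_op A B g x \<sigma> V p = (let J = complex_structure A B g x in
     wedge_pairing (\<sigma> p)
       (\<lambda>u. lie_endo A (tan_part A B g x V) J p u
          + 2 *\<^sub>R shape_operator0 A B g x p (nor_part A B g x V p) (J p u)))"

definition beta_op ::
  "('a, real^2) chart set \<Rightarrow> ('b, 'f::euclidean_space) chart set \<Rightarrow>
   ('b \<Rightarrow> 'f \<Rightarrow> 'f \<Rightarrow> real) \<Rightarrow> ('a \<Rightarrow> 'b) \<Rightarrow> ('a \<Rightarrow> real^2 \<Rightarrow> real^2 \<Rightarrow> real) \<Rightarrow>
   ('a \<Rightarrow> 'f) \<Rightarrow> 'a \<Rightarrow> real^2 \<Rightarrow> real" where
  "beta_op A B g x Q V p u = - 2 * Q p u (tan_part A B g x V p)"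

definition E_op ::
  "('a, real^2) chart set \<Rightarrow> ('b, 'f::euclidean_space) chart set \<Rightarrow>
   ('b \<Rightarrow> 'f \<Rightarrow> 'f \<Rightarrow> real) \<Rightarrow> ('a \<Rightarrow> 'b) \<Rightarrow> ('a \<Rightarrow> real^2 \<Rightarrow> real^2 \<Rightarrow> real) \<Rightarrow>
   ('a \<Rightarrow> 'f) \<Rightarrow> 'a \<Rightarrow> real^2 \<Rightarrow> real^2 \<Rightarrow> real" where
  "E_op A B g x Q V p u w =
     - 2 * wedge_pairing (Q p) (shape_operator0 A B g x p (nor_part A B g x V p)) u w"

text \<open>Linear differential operators of order at most one from sections of \<open>x\<^sup>*TM\<close> to 2-forms:
  the double commutator with multiplication by functions vanishes.\<close>

definition first_order_linear_operator ::
  "('a, real^2) chart set \<Rightarrow> ('b, 'f::euclidean_space) chart set \<Rightarrow> ('a \<Rightarrow> 'b) \<Rightarrow>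
   (('a \<Rightarrow> 'f) \<Rightarrow> 'a \<Rightarrow> real^2 \<Rightarrow> real^2 \<Rightarrow> real) \<Rightarrow> bool" where
  "first_order_linear_operator A B x D \<longleftrightarrow>
     (\<forall>V \<in> sections A B x. D V \<in> two_forms A) \<and>
     (\<forall>V \<in> sections A B x. \<forall>W \<in> sections A B x. \<forall>a b p u w.
        D (\<lambda>p. a *\<^sub>R V p + b *\<^sub>R W p) p u w = a * D V p u w + b * D W p u w) \<and>
     (\<forall>V \<in> sections A B x. \<forall>f h. smooth_fun A f \<longrightarrow> smooth_fun A h \<longrightarrow> (\<forall>p u w.
        D (\<lambda>p. (f p * h p) *\<^sub>R V p) p u w - f p * D (\<lambda>p. h p *\<^sub>R V p) p u w
        - h p * D (\<lambda>p. f p *\<^sub>R V p) p u w + f p * h p * D V p u w = 0))"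

end

(*
  For a torsion-free connection with \<nabla>J = 0 and d^\<nabla> \<sigma> = 0 one has
  (L_X J)U = J \<nabla>_U X - \<nabla>_{JU} X, and an identity for 2 x 2 matrices gives
  \<langle>\<sigma> \<and> L_X J\<rangle> = d(-2 \<langle>Q, X\<rangle>); the term with the shape operator is E because A_0 J = - J A_0.
  Sections with prescribed value at a point (bump functions) turn E = 0 into the pointwise symmetry
  Q(A U, W) = Q(U, A W). Holomorphy of q is the Cauchy-Riemann equation hidden in d^\<nabla> \<sigma> = 0.
  The flow of a conformal field Y preserves the conformal structure of the surface to first order,
  so L_X J + 2 A_0 J = 0 for X, A belonging to Y \<circ> x, which is why D(Y \<circ> x) = 0.

  The preferred charts carry no continuity, so J, tangential parts and shape operators are shown to be
  smooth by characterising each in an arbitrary chart as the solution v of I(v, W) = \<phi>(W) with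
  smooth \<phi>, to which Cramer's rule applies.
*)

theory Submission
  imports Defs
begin

section \<open>Calculus of smooth maps\<close>

text \<open>\<open>ext_deriv\<close>, \<open>lie_endo\<close>, \<open>lie_metric\<close> and
  \<open>christoffel\<close> are read off in the preferred chart at the point, where components are
  the tensors themselves. Pointwise identities are therefore proved in that one chart, and a
  connection is kept only as a single symmetric bilinear map \<open>G\<close> at the point.
  Smoothness cannot be treated so: it needs \<open>ext_deriv\<close> and the second fundamental form
  in arbitrary charts, where the second derivatives of the transition maps must drop out, by their
  symmetry, by normality, or against the transformation law of the Christoffel symbols. Identities
  on the tangent plane are checked on a frame \<open>u\<close>, \<open>J u\<close>. The metric
  \<open>g\<close> is fixed throughout. Conformal invariance enters only at the end: another metric
  of the class changes shape operators by multiples of the identity and Lie derivatives by multiples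
  of the metric. For holomorphy, a holomorphic chart is smooth as a function of the charts of
  \<open>A\<close>; the derivative of its inverse has to be produced from the Cauchy-Riemann
  property.\<close>

abbreviation fder :: "('a::real_normed_vector \<Rightarrow> 'b::real_normed_vector) \<Rightarrow> 'a \<Rightarrow> 'a \<Rightarrow> 'b" where
  "fder f z \<equiv> frechet_derivative f (at z)"

lemma fder_eqI: "(f has_derivative f') (at z) \<Longrightarrow> fder f z = f'"
  using frechet_derivative_at by metis

lemma has_derivative_cong_open:
  assumes "open S" "z \<in> S" "\<And>y. y \<in> S \<Longrightarrow> f y = g y"
  shows "(f has_derivative f') (at z) \<longleftrightarrow> (g has_derivative f') (at z)"
  using has_derivative_transform_within_open[of f f' z UNIV S g]
    has_derivative_transform_within_open[of g f' z UNIV S f] assms by auto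

lemma fder_cong_open:
  assumes "open S" "z \<in> S" "\<And>y. y \<in> S \<Longrightarrow> f y = g y"
  shows "fder f z = fder g z"
  using has_derivative_cong_open[OF assms] unfolding frechet_derivative_def by simp

lemma differentiable_cong_open:
  assumes "open S" "z \<in> S" "\<And>y. y \<in> S \<Longrightarrow> f y = g y"
  shows "f differentiable at z \<longleftrightarrow> g differentiable at z"
  using has_derivative_cong_open[OF assms] unfolding differentiable_def by simp

text \<open>Openness of \<open>S\<close> makes equality on \<open>S\<close> an equality near each
  point, which is what the Frechet derivatives see.\<close>

lemma Ck_on_cong:
  assumes "open S" "\<And>y. y \<in> S \<Longrightarrow> f y = g y"
  shows "Ck_on k S f \<longleftrightarrow> Ck_on k S g"
  using assms(2)
proof (induction k arbitrary: f g)
  case 0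
  then show ?case by (auto cong: continuous_on_cong)
next
  case (Suc k)
  have "Ck_on k S (\<lambda>z. fder f z v) \<longleftrightarrow> Ck_on k S (\<lambda>z. fder g z v)" for v
    by (rule Suc.IH) (use fder_cong_open[OF assms(1) _ Suc.prems] in simp)
  moreover have "f differentiable at z \<longleftrightarrow> g differentiable at z" if "z \<in> S" for z
    using differentiable_cong_open[OF assms(1) that Suc.prems] by simp
  ultimately show ?case by simp
qed

lemma Ck_on_transfer:
  "Ck_on k S f \<Longrightarrow> open S \<Longrightarrow> (\<And>y. y \<in> S \<Longrightarrow> f y = g y) \<Longrightarrow> Ck_on k S g"
  using Ck_on_cong by blast

lemma Ck_on_SucI:
  assumes "open S" "\<And>z. z \<in> S \<Longrightarrow> (f has_derivative f' z) (at z)" "\<And>v. Ck_on k S (\<lambda>z. f' z v)"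
  shows "Ck_on (Suc k) S f"
proof -
  have "Ck_on k S (\<lambda>z. fder f z v)" for v
    by (rule Ck_on_transfer[OF assms(3) assms(1)]) (simp add: fder_eqI[OF assms(2)])
  then show ?thesis using assms(2) unfolding Ck_on.simps differentiable_def by blast
qed

lemma Ck_on_SucD: "Ck_on (Suc k) S f \<Longrightarrow> Ck_on k S f"
proof (induction k arbitrary: f)
  case 0
  then show ?case
    by (auto intro!: continuous_at_imp_continuous_on differentiable_imp_continuous_within)
next
  case (Suc k)
  then show ?case by (metis Ck_on.simps(2))
qed

lemma Ck_on_subset: "Ck_on k S f \<Longrightarrow> T \<subseteq> S \<Longrightarrow> Ck_on k T f"
proof (induction k arbitrary: f)
  case 0
  then show ?case by (auto intro: continuous_on_subset)
next
  case (Suc k)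
  then show ?case by auto
qed

lemma Ck_on_local:
  assumes "\<And>z. z \<in> S \<Longrightarrow> \<exists>U. open U \<and> z \<in> U \<and> Ck_on k U f"
  shows "Ck_on k S f"
  using assms
proof (induction k arbitrary: f)
  case 0
  have "isCont f z" if "z \<in> S" for z
    using 0[OF that] by (auto simp: continuous_on_eq_continuous_at)
  then show ?case by (auto intro: continuous_at_imp_continuous_on)
next
  case (Suc k)
  show ?case
    unfolding Ck_on.simps
  proof (intro conjI ballI allI)
    fix z assume "z \<in> S"
    then show "f differentiable at z" using Suc.prems by fastforce
  next
    fix v
    show "Ck_on k S (\<lambda>z. fder f z v)"
      by (rule Suc.IH) (use Suc.prems in fastforce)
  qed
qed

lemma smooth_on_cong:
  "open S \<Longrightarrow> (\<And>y. y \<in> S \<Longrightarrow> f y = g y) \<Longrightarrow> smooth_on S f \<longleftrightarrow> smooth_on S g"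
  unfolding smooth_on_def using Ck_on_cong by metis

lemma smooth_on_subset: "smooth_on S f \<Longrightarrow> T \<subseteq> S \<Longrightarrow> smooth_on T f"
  unfolding smooth_on_def using Ck_on_subset by blast

lemma smooth_on_local:
  assumes "\<And>z. z \<in> S \<Longrightarrow> \<exists>U. open U \<and> z \<in> U \<and> smooth_on U f"
  shows "smooth_on S f"
  unfolding smooth_on_def
proof
  fix k show "Ck_on k S f"
    by (rule Ck_on_local) (use assms in \<open>simp add: smooth_on_def, blast\<close>)
qed

lemma smooth_on_differentiable: "smooth_on S f \<Longrightarrow> z \<in> S \<Longrightarrow> f differentiable at z"
  unfolding smooth_on_def by (metis Ck_on.simps(2))

lemma smooth_on_has_derivative:
  "smooth_on S f \<Longrightarrow> z \<in> S \<Longrightarrow> (f has_derivative fder f z) (at z)"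
  using smooth_on_differentiable frechet_derivative_works by blast

lemma smooth_on_linear_fder: "smooth_on S f \<Longrightarrow> z \<in> S \<Longrightarrow> linear (fder f z)"
  using smooth_on_differentiable linear_frechet_derivative by blast

lemma smooth_on_fder: "smooth_on S f \<Longrightarrow> smooth_on S (\<lambda>z. fder f z v)"
  unfolding smooth_on_def by (metis Ck_on.simps(2))

lemma smooth_on_continuous: "smooth_on S f \<Longrightarrow> continuous_on S f"
  unfolding smooth_on_def by (metis Ck_on.simps(1))

lemma Ck_on_const: "Ck_on k S (\<lambda>z. c)"
  by (induction k arbitrary: c) auto

lemma smooth_on_const: "smooth_on S (\<lambda>z. c)"
  by (simp add: smooth_on_def Ck_on_const)

lemma Ck_on_bounded_linear:
  fixes f :: "'a::real_normed_vector \<Rightarrow> 'b::real_normed_vector" and L :: "'b \<Rightarrow> 'c::real_normed_vector"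
  assumes "bounded_linear L" "open S" "Ck_on k S f"
  shows "Ck_on k S (\<lambda>z. L (f z))"
  using assms(3)
proof (induction k arbitrary: f)
  case 0
  then show ?case
    using bounded_linear.continuous_on[OF assms(1)] by auto
next
  case (Suc k)
  have d: "((\<lambda>z. L (f z)) has_derivative (\<lambda>v. L (fder f z v))) (at z)" if "z \<in> S" for z
    using Suc.prems that by (intro bounded_linear.has_derivative[OF assms(1)]) (simp add: frechet_derivative_works[symmetric])
  show ?case by (rule Ck_on_SucI[OF assms(2) d]) (use Suc in simp_all)
qed

lemma smooth_on_bounded_linear:
  "bounded_linear L \<Longrightarrow> open S \<Longrightarrow> smooth_on S f \<Longrightarrow> smooth_on S (\<lambda>z. L (f z))"
  by (simp add: smooth_on_def Ck_on_bounded_linear)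

lemma smooth_on_ident: "smooth_on S (\<lambda>z. z)"
  unfolding smooth_on_def
proof
  fix k show "Ck_on k S (\<lambda>z. z)" by (cases k) (auto simp: Ck_on_const)
qed

lemma Ck_on_add:
  assumes "open S" "Ck_on k S f" "Ck_on k S g"
  shows "Ck_on k S (\<lambda>z. f z + g z)"
  using assms(2,3)
proof (induction k arbitrary: f g)
  case 0
  then show ?case by (auto intro: continuous_on_add)
next
  case (Suc k)
  have d: "((\<lambda>z. f z + g z) has_derivative (\<lambda>v. fder f z v + fder g z v)) (at z)" if "z \<in> S" for z
    using Suc.prems that by (auto intro!: has_derivative_add simp: frechet_derivative_works[symmetric])
  show ?case by (rule Ck_on_SucI[OF assms(1) d]) (use Suc in simp_all)
qed

lemma Ck_on_bilinear:
  assumes B: "bounded_bilinear B" and "open S" "Ck_on k S f" "Ck_on k S g"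
  shows "Ck_on k S (\<lambda>z. B (f z) (g z))"
  using assms(3,4)
proof (induction k arbitrary: f g)
  case 0
  then show ?case using bounded_bilinear.continuous_on[OF B] by auto
next
  case (Suc k)
  have d: "((\<lambda>z. B (f z) (g z)) has_derivative (\<lambda>v. B (f z) (fder g z v) + B (fder f z v) (g z))) (at z)"
    if "z \<in> S" for z
    using Suc.prems that by (auto intro!: bounded_bilinear.FDERIV[OF B] simp: frechet_derivative_works[symmetric])
  have "Ck_on k S (\<lambda>z. B (f z) (fder g z v) + B (fder f z v) (g z))" for v
    by (intro Ck_on_add[OF assms(2)] Suc.IH) (use Suc.prems Ck_on_SucD in auto)
  then show ?case by (intro Ck_on_SucI[OF assms(2) d]) auto
qed

lemma Ck_on_sum:
  assumes "open S" "\<And>i. i \<in> I \<Longrightarrow> Ck_on k S (f i)"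
  shows "Ck_on k S (\<lambda>z. \<Sum>i\<in>I. f i z)"
  using assms(2) by (induction I rule: infinite_finite_induct) (auto intro: Ck_on_const Ck_on_add assms(1))

lemma smooth_on_add: "open S \<Longrightarrow> smooth_on S f \<Longrightarrow> smooth_on S g \<Longrightarrow> smooth_on S (\<lambda>z. f z + g z)"
  by (simp add: smooth_on_def Ck_on_add)

lemma smooth_on_bilinear:
  "bounded_bilinear B \<Longrightarrow> open S \<Longrightarrow> smooth_on S f \<Longrightarrow> smooth_on S g \<Longrightarrow> smooth_on S (\<lambda>z. B (f z) (g z))"
  by (simp add: smooth_on_def Ck_on_bilinear)

lemmas smooth_on_scaleR = smooth_on_bilinear[OF bounded_bilinear_scaleR]
lemmas smooth_on_mult = smooth_on_bilinear[OF bounded_bilinear_mult]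
lemmas smooth_on_inner = smooth_on_bilinear[OF bounded_bilinear_inner]

lemma smooth_on_minus: "open S \<Longrightarrow> smooth_on S f \<Longrightarrow> smooth_on S (\<lambda>z. - f z)"
  by (rule smooth_on_bounded_linear[OF bounded_linear_minus[OF bounded_linear_ident]])

lemma smooth_on_diff: "open S \<Longrightarrow> smooth_on S f \<Longrightarrow> smooth_on S g \<Longrightarrow> smooth_on S (\<lambda>z. f z - g z)"
  using smooth_on_add[of S f "\<lambda>z. - g z"] smooth_on_minus by auto

lemma smooth_on_sum:
  "open S \<Longrightarrow> (\<And>i. i \<in> I \<Longrightarrow> smooth_on S (f i)) \<Longrightarrow> smooth_on S (\<lambda>z. \<Sum>i\<in>I. f i z)"
  by (simp add: smooth_on_def Ck_on_sum)

text \<open>The chain rule gives \<open>fder f (g z) (fder g z v)\<close>, whose direction moves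
  with \<open>z\<close>, while the induction hypothesis controls derivatives in fixed directions.
  Expanding the direction in the basis of the intermediate space leaves products of functions of
  order \<open>k\<close>.\<close>

lemma Ck_on_compose:
  fixes g :: "_ \<Rightarrow> 'b::euclidean_space"
  assumes "open S" "open T" "\<And>z. z \<in> S \<Longrightarrow> g z \<in> T" "Ck_on k T f" "Ck_on k S g"
  shows "Ck_on k S (\<lambda>z. f (g z))"
  using assms(3-5)
proof (induction k arbitrary: f g)
  case 0
  then show ?case by (auto intro: continuous_on_compose2[of T f S g])
next
  case (Suc k)
  have d: "((\<lambda>z. f (g z)) has_derivative (\<lambda>v. \<Sum>i\<in>Basis. (fder g z v \<bullet> i) *\<^sub>R fder f (g z) i)) (at z)"
    if "z \<in> S" for z
  proof -
    have f: "f differentiable at (g z)" and g: "g differentiable at z" using Suc.prems that by auto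
    have 1: "((\<lambda>z. f (g z)) has_derivative (\<lambda>v. fder f (g z) (fder g z v))) (at z)"
      using has_derivative_compose[of g "fder g z" z UNIV f "fder f (g z)"] f g
      by (simp add: frechet_derivative_works[symmetric])
    have 2: "fder f (g z) w = (\<Sum>i\<in>Basis. (w \<bullet> i) *\<^sub>R fder f (g z) i)" for w
    proof -
      interpret linear "fder f (g z)" by (rule linear_frechet_derivative[OF f])
      have "fder f (g z) w = fder f (g z) (\<Sum>i\<in>Basis. (w \<bullet> i) *\<^sub>R i)" by (simp add: euclidean_representation)
      then show ?thesis by (simp add: sum scale)
    qed
    have "(\<lambda>v. fder f (g z) (fder g z v)) = (\<lambda>v. \<Sum>i\<in>Basis. (fder g z v \<bullet> i) *\<^sub>R fder f (g z) i)"
      by (intro ext 2)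
    then show ?thesis using 1 by (simp only:)
  qed
  have "Ck_on k S (\<lambda>z. \<Sum>i\<in>Basis. (fder g z v \<bullet> i) *\<^sub>R fder f (g z) i)" for v
  proof -
    have "Ck_on k S (\<lambda>z. fder g z v \<bullet> i)" for i
      by (rule Ck_on_bounded_linear[OF bounded_linear_inner_left assms(1)]) (use Suc.prems in auto)
    moreover have "Ck_on k S (\<lambda>z. fder f (g z) i)" for i
      using Suc.IH[of g "\<lambda>y. fder f y i"] Suc.prems Ck_on_SucD[of k S g] by auto
    ultimately show ?thesis by (intro Ck_on_sum Ck_on_bilinear[OF bounded_bilinear_scaleR] assms(1))
  qed
  then show ?case by (intro Ck_on_SucI[OF assms(1) d]) auto
qed

lemma smooth_on_compose:
  fixes g :: "_ \<Rightarrow> 'b::euclidean_space"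
  assumes "open S" "open T" "smooth_on T f" "smooth_on S g" "\<And>z. z \<in> S \<Longrightarrow> g z \<in> T"
  shows "smooth_on S (\<lambda>z. f (g z))"
  using assms Ck_on_compose unfolding smooth_on_def by blast

text \<open>The derivative is a polynomial in \<open>inverse\<close> itself, so the induction on the
  order closes.\<close>

lemma Ck_on_inverse: "Ck_on k {r::real. r \<noteq> 0} inverse"
proof (induction k)
  case 0
  then show ?case by (auto intro!: continuous_intros)
next
  case (Suc k)
  have o: "open {r::real. r \<noteq> 0}" by (simp add: open_Collect_neq continuous_on_id)
  have d: "(inverse has_derivative (\<lambda>v. - (v * (inverse r * inverse r)))) (at r)" if "r \<noteq> 0" for r :: real
    using has_derivative_inverse'[OF that] by (simp add: mult.commute mult.left_commute)
  have "Ck_on k {r. r \<noteq> 0} (\<lambda>r. - (v * (inverse r * inverse r)))" for v :: real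
    using Ck_on_bounded_linear[OF bounded_linear_minus[OF bounded_linear_mult_right[of v]] o]
      Ck_on_bilinear[OF bounded_bilinear_mult o Suc Suc] by blast
  then show ?case by (intro Ck_on_SucI[OF o d]) auto
qed

lemma smooth_on_inverse:
  fixes f :: "_ \<Rightarrow> real"
  assumes "open S" "smooth_on S f" "\<And>z. z \<in> S \<Longrightarrow> f z \<noteq> 0"
  shows "smooth_on S (\<lambda>z. inverse (f z))"
proof (rule smooth_on_compose[where T = "{r. r \<noteq> 0}" and f = inverse])
  show "open {r::real. r \<noteq> 0}" by (simp add: open_Collect_neq continuous_on_id)
qed (use assms Ck_on_inverse in \<open>auto simp: smooth_on_def\<close>)

lemma Ck_on_sqrt: "Ck_on k {0<..} sqrt"
proof (induction k)
  case 0
  then show ?case by (auto intro!: continuous_intros)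
next
  case (Suc k)
  have o: "open {0::real<..}" by simp
  have d: "(sqrt has_derivative (\<lambda>v. v * (inverse (sqrt r) / 2))) (at r)" if "r > 0" for r :: real
    by (rule has_derivative_eq_rhs[OF DERIV_real_sqrt[OF that, unfolded has_field_derivative_def]])
      (simp add: fun_eq_iff)
  have i: "Ck_on k {0<..} (\<lambda>r. inverse (sqrt r))"
    by (rule Ck_on_compose[where T = "{r. r \<noteq> 0}" and f = inverse])
      (use Suc Ck_on_inverse in \<open>auto simp: open_Collect_neq continuous_on_id\<close>)
  have "Ck_on k {0<..} (\<lambda>r. v * (inverse (sqrt r) / 2))" for v :: real
    using Ck_on_bounded_linear[OF bounded_linear_mult_right[of "v / 2"] o i] by simp
  then show ?case by (intro Ck_on_SucI[OF o d]) auto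
qed

lemma smooth_on_sqrt:
  assumes "open S" "smooth_on S f" "\<And>z. z \<in> S \<Longrightarrow> f z > 0"
  shows "smooth_on S (\<lambda>z. sqrt (f z))"
  by (rule smooth_on_compose[where T = "{0<..}" and f = sqrt])
    (use assms Ck_on_sqrt in \<open>auto simp: smooth_on_def\<close>)

lemma smooth_on_divide:
  fixes f :: "_ \<Rightarrow> real"
  assumes "open S" "smooth_on S f" "smooth_on S g" "\<And>z. z \<in> S \<Longrightarrow> g z \<noteq> 0"
  shows "smooth_on S (\<lambda>z. f z / g z)"
  unfolding divide_inverse by (intro smooth_on_mult smooth_on_inverse assms)

subsection \<open>Smooth bump functions\<close>

text \<open>Flat functions exp(-1/t) / t^n. The parameter \<open>n\<close> is there because
  differentiating the classical case \<open>n = 0\<close> produces higher powers of 1/t; the whole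
  family is closed under differentiation.\<close>

definition flat_exp :: "nat \<Rightarrow> real \<Rightarrow> real" where
  "flat_exp n t = (if t > 0 then exp (- inverse t) * inverse t ^ n else 0)"

lemma flat_exp_tendsto_0: "(flat_exp n \<longlongrightarrow> 0) (at 0)"
proof -
  have "((\<lambda>s. s ^ n / exp s) \<longlongrightarrow> 0) (at_top :: real filter)"
    by (rule tendsto_power_div_exp_0)
  then have "((\<lambda>t. inverse t ^ n / exp (inverse t)) \<longlongrightarrow> (0::real)) (at_right 0)"
    by (rule filterlim_compose) (rule filterlim_inverse_at_top_right)
  then have r: "(flat_exp n \<longlongrightarrow> 0) (at_right 0)"
    by (rule Lim_transform_eventually)
      (auto simp: flat_exp_def eventually_at_filter exp_minus field_simps)
  have "((\<lambda>t. 0) \<longlongrightarrow> (0::real)) (at_left 0)" by simp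
  then have "(flat_exp n \<longlongrightarrow> 0) (at_left 0)"
    by (rule Lim_transform_eventually) (auto simp: flat_exp_def eventually_at_filter)
  then show ?thesis using r by (simp add: filterlim_at_split)
qed

lemma flat_exp_deriv:
  "(flat_exp n has_real_derivative (flat_exp (n + 2) t - real n * flat_exp (n + 1) t)) (at t)"
proof -
  consider "t > 0" | "t < 0" | "t = 0" by linarith
  then show ?thesis
  proof cases
    case 1
    \<comment> \<open>Reassembles the power of \<open>inverse t\<close> after the power rule has
      lowered the exponent by a truncated subtraction.\<close>
    have p: "inverse t * inverse t ^ (k - Suc 0) = inverse t ^ k" if "k \<noteq> 0" for k
      using that by (cases k) auto
    have "((\<lambda>t. exp (- inverse t) * inverse t ^ n) has_real_derivative
        (flat_exp (n + 2) t - real n * flat_exp (n + 1) t)) (at t)"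
      using 1 by (cases n) (auto intro!: derivative_eq_intros simp: flat_exp_def power2_eq_square algebra_simps, metis p)
    then show ?thesis
      by (rule has_field_derivative_transform_within_open[where S = "{0<..}"]) (use 1 in \<open>auto simp: flat_exp_def\<close>)
  next
    case 2
    have "((\<lambda>t. 0) has_real_derivative (flat_exp (n + 2) t - real n * flat_exp (n + 1) t)) (at t)"
      using 2 by (simp add: flat_exp_def)
    then show ?thesis
      by (rule has_field_derivative_transform_within_open[where S = "{..<0}"]) (use 2 in \<open>auto simp: flat_exp_def\<close>)
  next
    case 3
    \<comment> \<open>The difference quotient at 0 is the next member of the family; at
      \<open>h = 0\<close> both sides are 0 because division by zero gives 0.\<close>
    have "(\<lambda>h. (flat_exp n (0 + h) - flat_exp n 0) / h) = flat_exp (n + 1)"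
      by (auto simp: flat_exp_def fun_eq_iff field_simps)
    then show ?thesis using flat_exp_tendsto_0[of "n + 1"] 3 by (simp add: DERIV_def flat_exp_def)
  qed
qed

lemma Ck_on_flat_exp: "Ck_on k UNIV (flat_exp n)"
proof (induction k arbitrary: n)
  case 0
  then show ?case
    using DERIV_isCont[OF flat_exp_deriv] by (auto intro!: continuous_at_imp_continuous_on)
next
  case (Suc k)
  have d: "(flat_exp n has_derivative (\<lambda>v. (flat_exp (n + 2) t - real n * flat_exp (n + 1) t) * v)) (at t)" for t
    using flat_exp_deriv[of n t] by (simp add: has_field_derivative_def)
  have "Ck_on k UNIV (\<lambda>t. (flat_exp (n + 2) t + (- real n) * flat_exp (n + 1) t) * v)" for v
    by (intro Ck_on_bilinear[OF bounded_bilinear_mult] Ck_on_add Ck_on_const Suc open_UNIV)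
  then show ?case by (intro Ck_on_SucI[OF open_UNIV d]) simp
qed

text \<open>The value 1 at the centre is enough: the function only serves to prescribe a section at
  a single point.\<close>

lemma bump_function:
  fixes z0 :: "'a::euclidean_space"
  assumes "r > 0"
  obtains \<phi> :: "'a \<Rightarrow> real" where "smooth_on UNIV \<phi>" "\<phi> z0 = 1" "\<And>z. z \<notin> ball z0 r \<Longrightarrow> \<phi> z = 0"
proof
  let ?\<phi> = "\<lambda>z. flat_exp 0 (r\<^sup>2 - (z - z0) \<bullet> (z - z0)) / flat_exp 0 (r\<^sup>2)"
  have "smooth_on UNIV (flat_exp 0)" by (simp add: smooth_on_def Ck_on_flat_exp)
  moreover have "smooth_on UNIV (\<lambda>z. r\<^sup>2 - (z - z0) \<bullet> (z - z0))"
    by (intro smooth_on_diff smooth_on_inner smooth_on_const smooth_on_ident open_UNIV)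
  ultimately have "smooth_on UNIV (\<lambda>z. flat_exp 0 (r\<^sup>2 - (z - z0) \<bullet> (z - z0)))"
    by (rule smooth_on_compose[OF open_UNIV open_UNIV]) simp
  then show "smooth_on UNIV ?\<phi>"
    unfolding divide_inverse by (intro smooth_on_mult smooth_on_const open_UNIV)
  show "?\<phi> z0 = 1" using assms by (simp add: flat_exp_def)
  show "?\<phi> z = 0" if "z \<notin> ball z0 r" for z
  proof -
    have "r\<^sup>2 \<le> (norm (z - z0))\<^sup>2" using that assms by (intro power_mono) (auto simp: dist_norm norm_minus_commute)
    then show ?thesis by (simp add: flat_exp_def power2_norm_eq_inner)
  qed
qed

subsection \<open>Symmetry of second derivatives\<close>

text \<open>The mean value theorem is applied along \<open>u\<close> and then along
  \<open>v\<close>. The second difference on the left is symmetric in \<open>u\<close> and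
  \<open>v\<close>, so exchanging their roles writes the same number with the other mixed
  derivative.\<close>

lemma second_difference_mvt:
  fixes f :: "'a::real_normed_vector \<Rightarrow> real"
  assumes f: "Ck_on 2 S f" and "h > 0"
    and S: "\<And>s t. 0 \<le> s \<Longrightarrow> s \<le> h \<Longrightarrow> 0 \<le> t \<Longrightarrow> t \<le> h \<Longrightarrow> z + s *\<^sub>R u + t *\<^sub>R v \<in> S"
  shows "\<exists>s t. 0 < s \<and> s < h \<and> 0 < t \<and> t < h \<and>
    f (z + h *\<^sub>R u + h *\<^sub>R v) - f (z + h *\<^sub>R u) - f (z + h *\<^sub>R v) + f z
    = h * h * fder (\<lambda>y. fder f y u) (z + s *\<^sub>R u + t *\<^sub>R v) v"
proof -
  have diff: "y \<in> S \<Longrightarrow> f differentiable at y" "y \<in> S \<Longrightarrow> (\<lambda>y. fder f y u) differentiable at y" for y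
    using f by (auto simp: numeral_2_eq_2)
  have line: "((\<lambda>s. k (a + s *\<^sub>R w)) has_real_derivative fder k (a + s *\<^sub>R w) w) (at s)"
    if "k differentiable at (a + s *\<^sub>R w)" for k :: "'a \<Rightarrow> real" and a w s
  proof -
    interpret linear "fder k (a + s *\<^sub>R w)" using that by (rule linear_frechet_derivative)
    have "((\<lambda>s. k (a + s *\<^sub>R w)) has_derivative (\<lambda>r. fder k (a + s *\<^sub>R w) (r *\<^sub>R w))) (at s)"
      by (rule has_derivative_compose[of "\<lambda>s. a + s *\<^sub>R w" _ _ _ k])
        (use that in \<open>auto intro!: derivative_eq_intros simp: frechet_derivative_works[symmetric]\<close>)
    then show ?thesis by (simp add: has_field_derivative_def scale mult.commute[of _ "fder _ _ _"])
  qed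
  define G where "G s = f (z + s *\<^sub>R u + h *\<^sub>R v) - f (z + s *\<^sub>R u)" for s
  have G: "(G has_real_derivative (fder f (z + s *\<^sub>R u + h *\<^sub>R v) u - fder f (z + s *\<^sub>R u) u)) (at s)"
    if "0 \<le> s" "s \<le> h" for s
  proof -
    have "z + h *\<^sub>R v + s *\<^sub>R u \<in> S" "z + s *\<^sub>R u \<in> S"
      using S[of s h] S[of s 0] that \<open>h > 0\<close> by (auto simp: algebra_simps)
    then have "((\<lambda>s. f (z + h *\<^sub>R v + s *\<^sub>R u) - f (z + s *\<^sub>R u)) has_real_derivative
      (fder f (z + h *\<^sub>R v + s *\<^sub>R u) u - fder f (z + s *\<^sub>R u) u)) (at s)"
      by (intro DERIV_diff line diff)
    then show ?thesis by (simp add: G_def[abs_def] algebra_simps)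
  qed
  obtain s where s: "0 < s" "s < h"
    "G h - G 0 = (h - 0) * (fder f (z + s *\<^sub>R u + h *\<^sub>R v) u - fder f (z + s *\<^sub>R u) u)"
    using MVT2[of 0 h G "\<lambda>s. fder f (z + s *\<^sub>R u + h *\<^sub>R v) u - fder f (z + s *\<^sub>R u) u"] G \<open>h > 0\<close> by auto
  obtain t where t: "0 < t" "t < h"
    "fder f (z + s *\<^sub>R u + h *\<^sub>R v) u - fder f (z + s *\<^sub>R u + 0 *\<^sub>R v) u
     = (h - 0) * fder (\<lambda>y. fder f y u) (z + s *\<^sub>R u + t *\<^sub>R v) v"
    using MVT2[of 0 h "\<lambda>t. fder f (z + s *\<^sub>R u + t *\<^sub>R v) u"
        "\<lambda>t. fder (\<lambda>y. fder f y u) (z + s *\<^sub>R u + t *\<^sub>R v) v"]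
      line[OF diff(2)] S s \<open>h > 0\<close> by force
  show ?thesis
    using s t by (intro exI[of _ s] exI[of _ t]) (simp add: G_def algebra_simps)
qed

lemma symmetric_second_derivative_real:
  fixes f :: "'a::real_normed_vector \<Rightarrow> real"
  assumes "open S" "z \<in> S" and f: "Ck_on 2 S f"
  shows "fder (\<lambda>y. fder f y u) z v = fder (\<lambda>y. fder f y v) z u"
proof (rule ccontr)
  let ?a = "\<lambda>y. fder (\<lambda>y. fder f y u) y v" and ?b = "\<lambda>y. fder (\<lambda>y. fder f y v) y u"
  assume ne: "?a z \<noteq> ?b z"
  define e where "e = \<bar>?a z - ?b z\<bar> / 2"
  have "e > 0" using ne by (simp add: e_def)
  have "continuous_on S ?a" "continuous_on S ?b" using f by (auto simp: numeral_2_eq_2)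
  then have "isCont ?a z" "isCont ?b z"
    using assms(1,2) by (auto simp: continuous_on_eq_continuous_at)
  then obtain d1 d2 where d: "d1 > 0" "d2 > 0"
      "\<And>y. dist y z < d1 \<Longrightarrow> dist (?a y) (?a z) < e" "\<And>y. dist y z < d2 \<Longrightarrow> dist (?b y) (?b z) < e"
    using \<open>e > 0\<close> unfolding continuous_at_eps_delta by metis
  obtain d3 where d3: "d3 > 0" "ball z d3 \<subseteq> S" using assms(1,2) open_contains_ball by blast
  define m where "m = min d3 (min d1 d2)"
  \<comment> \<open>With this side length the parallelogram spanned at \<open>z\<close> stays within
    \<open>m / 2\<close> of \<open>z\<close>; the summand 1 keeps the denominator positive when
    \<open>u\<close> and \<open>v\<close> both vanish.\<close>
  define h where "h = m / (2 * (norm u + norm v + 1))"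
  have "m > 0" using d d3 by (simp add: m_def)
  have pos: "2 * (norm u + norm v + 1) > 0" by (smt (verit) norm_ge_zero)
  then have "h > 0" using \<open>m > 0\<close> by (simp add: h_def)
  have near: "dist (z + s *\<^sub>R u + t *\<^sub>R v) z < m" if "0 \<le> s" "s \<le> h" "0 \<le> t" "t \<le> h" for s t
  proof -
    have "dist (z + s *\<^sub>R u + t *\<^sub>R v) z \<le> s * norm u + t * norm v"
      using norm_triangle_ineq[of "s *\<^sub>R u" "t *\<^sub>R v"] that by (simp add: dist_norm)
    also have "\<dots> \<le> h * norm u + h * norm v" using that by (intro add_mono mult_right_mono) auto
    also have "\<dots> \<le> h * (norm u + norm v + 1)" using \<open>h > 0\<close> by (simp add: algebra_simps)
    also have "\<dots> = m / 2" using pos by (simp add: h_def field_simps)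
    also have "\<dots> < m" using \<open>m > 0\<close> by simp
    finally show ?thesis .
  qed
  have inS: "z + s *\<^sub>R u + t *\<^sub>R v \<in> S" if "0 \<le> s" "s \<le> h" "0 \<le> t" "t \<le> h" for s t
    using near[OF that] d3 by (auto simp: m_def dist_commute)
  have inS': "z + s *\<^sub>R v + t *\<^sub>R u \<in> S" if "0 \<le> s" "s \<le> h" "0 \<le> t" "t \<le> h" for s t
    using inS[of t s] that by (simp add: algebra_simps)
  have "\<exists>s t. 0 < s \<and> s < h \<and> 0 < t \<and> t < h \<and>
    f (z + h *\<^sub>R u + h *\<^sub>R v) - f (z + h *\<^sub>R u) - f (z + h *\<^sub>R v) + f z
      = h * h * ?a (z + s *\<^sub>R u + t *\<^sub>R v)"
    by (rule second_difference_mvt[OF f \<open>h > 0\<close>]) (rule inS)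
  then obtain s t where st: "0 < s" "s < h" "0 < t" "t < h"
    "f (z + h *\<^sub>R u + h *\<^sub>R v) - f (z + h *\<^sub>R u) - f (z + h *\<^sub>R v) + f z
      = h * h * ?a (z + s *\<^sub>R u + t *\<^sub>R v)"
    by blast
  have "\<exists>s t. 0 < s \<and> s < h \<and> 0 < t \<and> t < h \<and>
    f (z + h *\<^sub>R v + h *\<^sub>R u) - f (z + h *\<^sub>R v) - f (z + h *\<^sub>R u) + f z
      = h * h * ?b (z + s *\<^sub>R v + t *\<^sub>R u)"
    by (rule second_difference_mvt[OF f \<open>h > 0\<close>]) (rule inS')
  then obtain s' t' where st': "0 < s'" "s' < h" "0 < t'" "t' < h"
    "f (z + h *\<^sub>R v + h *\<^sub>R u) - f (z + h *\<^sub>R v) - f (z + h *\<^sub>R u) + f z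
      = h * h * ?b (z + s' *\<^sub>R v + t' *\<^sub>R u)"
    by blast
  have "h * h * ?a (z + s *\<^sub>R u + t *\<^sub>R v) = h * h * ?b (z + s' *\<^sub>R v + t' *\<^sub>R u)"
    using st(5) st'(5) by (simp add: algebra_simps)
  then have eq: "?a (z + s *\<^sub>R u + t *\<^sub>R v) = ?b (z + s' *\<^sub>R v + t' *\<^sub>R u)"
    using \<open>h > 0\<close> by simp
  have "dist (?a (z + s *\<^sub>R u + t *\<^sub>R v)) (?a z) < e"
    using d(3) near[of s t] st by (auto simp: m_def)
  moreover have "dist (?b (z + s' *\<^sub>R v + t' *\<^sub>R u)) (?b z) < e"
    using d(4) near[of t' s'] st' by (auto simp: m_def algebra_simps)
  \<comment> \<open>The common value of the two mixed derivatives would lie closer than half of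
    their distance at \<open>z\<close> to both of them.\<close>
  moreover have False if "\<bar>c - a\<bar> < \<bar>a - b\<bar> / 2" "\<bar>c - b\<bar> < \<bar>a - b\<bar> / 2" for a b c :: real
    using that by (simp add: abs_if split: if_splits)
  ultimately show False unfolding eq e_def dist_real_def by blast
qed

lemma symmetric_second_derivative:
  fixes f :: "_ \<Rightarrow> 'b::euclidean_space"
  assumes "open S" "z \<in> S" "smooth_on S f"
  shows "fder (\<lambda>y. fder f y u) z v = fder (\<lambda>y. fder f y v) z u"
proof (rule euclidean_eqI)
  fix i :: 'b assume "i \<in> Basis"
  have 1: "fder (\<lambda>y. f y \<bullet> i) y = (\<lambda>w. fder f y w \<bullet> i)" if "y \<in> S" for y
    by (rule fder_eqI) (auto intro!: derivative_eq_intros smooth_on_has_derivative[OF assms(3) that])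
  have 2: "fder (\<lambda>y. fder (\<lambda>y. f y \<bullet> i) y w) z w' = fder (\<lambda>y. fder f y w) z w' \<bullet> i" for w w'
  proof -
    have "fder (\<lambda>y. fder (\<lambda>y. f y \<bullet> i) y w) z = fder (\<lambda>y. fder f y w \<bullet> i) z"
      by (rule fder_cong_open[OF assms(1,2)]) (simp add: 1)
    also have "\<dots> = (\<lambda>w'. fder (\<lambda>y. fder f y w) z w' \<bullet> i)"
      by (rule fder_eqI)
        (auto intro!: derivative_eq_intros smooth_on_has_derivative[OF smooth_on_fder[OF assms(3)] assms(2)])
    finally show ?thesis by simp
  qed
  have "smooth_on S (\<lambda>y. f y \<bullet> i)"
    by (intro smooth_on_inner smooth_on_const assms)
  then show "fder (\<lambda>y. fder f y u) z v \<bullet> i = fder (\<lambda>y. fder f y v) z u \<bullet> i"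
    using symmetric_second_derivative_real[OF assms(1,2), of "\<lambda>y. f y \<bullet> i" u v]
    unfolding smooth_on_def 2 by blast
qed

subsection \<open>Families of linear and bilinear maps\<close>

lemma linear_expand:
  fixes w :: "'b::euclidean_space"
  assumes "linear L"
  shows "L w = (\<Sum>i\<in>Basis. (w \<bullet> i) *\<^sub>R L i)"
proof -
  interpret linear L by fact
  have "L w = L (\<Sum>i\<in>Basis. (w \<bullet> i) *\<^sub>R i)" by (simp add: euclidean_representation)
  then show ?thesis by (simp add: sum scale)
qed

text \<open>Smoothness of a tensor field is recorded only for constant arguments in a chart.
  Expansion in a basis extends it to arguments that vary smoothly with the point.\<close>

lemma smooth_on_linear_family:
  fixes L :: "_ \<Rightarrow> 'b::euclidean_space \<Rightarrow> _"
  assumes "open S" "\<And>z. z \<in> S \<Longrightarrow> linear (L z)" "\<And>i. smooth_on S (\<lambda>z. L z i)" "smooth_on S a"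
  shows "smooth_on S (\<lambda>z. L z (a z))"
proof -
  have "smooth_on S (\<lambda>z. \<Sum>i\<in>Basis. (a z \<bullet> i) *\<^sub>R L z i)"
    by (intro smooth_on_sum smooth_on_scaleR smooth_on_inner smooth_on_const assms)
  then show ?thesis
    by (subst smooth_on_cong[OF assms(1)]) (auto intro: linear_expand[OF assms(2)])
qed

lemma smooth_on_bilinear_family:
  fixes B :: "_ \<Rightarrow> 'b::euclidean_space \<Rightarrow> 'd::euclidean_space \<Rightarrow> _"
  assumes "open S" "\<And>z. z \<in> S \<Longrightarrow> bilinear (B z)" "\<And>i j. smooth_on S (\<lambda>z. B z i j)"
    "smooth_on S a" "smooth_on S b"
  shows "smooth_on S (\<lambda>z. B z (a z) (b z))"
proof (rule smooth_on_linear_family[where L = "\<lambda>z. B z (a z)", OF assms(1) _ _ assms(5)])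
  show "smooth_on S (\<lambda>z. B z (a z) j)" for j
    by (rule smooth_on_linear_family[where L = "\<lambda>z w. B z w j", OF assms(1) _ _ assms(4)])
      (use assms(2,3) in \<open>auto simp: bilinear_def\<close>)
qed (use assms(2) in \<open>auto simp: bilinear_def\<close>)

text \<open>Product rule: differentiate the family with its argument frozen at \<open>a z\<close>,
  then the argument with the family frozen at \<open>z\<close>.\<close>

lemma has_derivative_linear_family:
  fixes L :: "_ \<Rightarrow> 'b::euclidean_space \<Rightarrow> _"
  assumes "open S" "z \<in> S" "\<And>y. y \<in> S \<Longrightarrow> linear (L y)"
    "\<And>i. (\<lambda>y. L y i) differentiable at z" "(a has_derivative a') (at z)"
  shows "((\<lambda>y. L y (a y)) has_derivative (\<lambda>v. fder (\<lambda>y. L y (a z)) z v + L z (a' v))) (at z)"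
proof -
  have d: "((\<lambda>y. L y i) has_derivative fder (\<lambda>y. L y i) z) (at z)" for i
    using assms(4) frechet_derivative_works by blast
  have c: "((\<lambda>y. L y w) has_derivative (\<lambda>v. \<Sum>i\<in>Basis. (w \<bullet> i) *\<^sub>R fder (\<lambda>y. L y i) z v)) (at z)" for w
  proof -
    have "((\<lambda>y. \<Sum>i\<in>Basis. (w \<bullet> i) *\<^sub>R L y i) has_derivative
        (\<lambda>v. \<Sum>i\<in>Basis. (w \<bullet> i) *\<^sub>R fder (\<lambda>y. L y i) z v)) (at z)"
      by (intro has_derivative_sum has_derivative_scaleR_right d)
    then show ?thesis
      by (subst has_derivative_cong_open[OF assms(1,2)]) (auto intro: linear_expand[OF assms(3)])
  qed
  have "((\<lambda>y. \<Sum>i\<in>Basis. (a y \<bullet> i) *\<^sub>R L y i) has_derivative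
      (\<lambda>v. \<Sum>i\<in>Basis. (a z \<bullet> i) *\<^sub>R fder (\<lambda>y. L y i) z v + (a' v \<bullet> i) *\<^sub>R L z i)) (at z)"
    by (intro has_derivative_sum has_derivative_scaleR has_derivative_inner_left assms d)
  then have "((\<lambda>y. L y (a y)) has_derivative
      (\<lambda>v. \<Sum>i\<in>Basis. (a z \<bullet> i) *\<^sub>R fder (\<lambda>y. L y i) z v + (a' v \<bullet> i) *\<^sub>R L z i)) (at z)"
    by (subst has_derivative_cong_open[OF assms(1,2)]) (auto intro: linear_expand[OF assms(3)])
  moreover have "(\<Sum>i\<in>Basis. (a z \<bullet> i) *\<^sub>R fder (\<lambda>y. L y i) z v + (a' v \<bullet> i) *\<^sub>R L z i)
      = fder (\<lambda>y. L y (a z)) z v + L z (a' v)" for v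
    using fder_eqI[OF c[of "a z"]] linear_expand[OF assms(3)[OF assms(2)], of "a' v"]
    by (simp add: sum.distrib)
  ultimately show ?thesis by simp
qed

lemma linear_fder_family:
  fixes L :: "_ \<Rightarrow> 'b::euclidean_space \<Rightarrow> _"
  assumes "open S" "z \<in> S" "\<And>y. y \<in> S \<Longrightarrow> linear (L y)" "\<And>i. (\<lambda>y. L y i) differentiable at z"
  shows "linear (\<lambda>w. fder (\<lambda>y. L y w) z v)"
proof -
  have d: "((\<lambda>y. L y i) has_derivative fder (\<lambda>y. L y i) z) (at z)" for i
    using assms(4) frechet_derivative_works by blast
  have "fder (\<lambda>y. L y (a + b)) z = (\<lambda>v. fder (\<lambda>y. L y a) z v + fder (\<lambda>y. L y b) z v)" for a b
  proof -
    have "((\<lambda>y. L y (a + b)) has_derivative (\<lambda>v. fder (\<lambda>y. L y a) z v + fder (\<lambda>y. L y b) z v)) (at z)"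
      by (subst has_derivative_cong_open[OF assms(1,2), of _ "\<lambda>y. L y a + L y b"])
        (auto simp: linear_add[OF assms(3)] intro!: has_derivative_add d)
    then show ?thesis by (rule fder_eqI)
  qed
  moreover have "fder (\<lambda>y. L y (r *\<^sub>R a)) z = (\<lambda>v. r *\<^sub>R fder (\<lambda>y. L y a) z v)" for r a
  proof -
    have "((\<lambda>y. L y (r *\<^sub>R a)) has_derivative (\<lambda>v. r *\<^sub>R fder (\<lambda>y. L y a) z v)) (at z)"
      by (subst has_derivative_cong_open[OF assms(1,2), of _ "\<lambda>y. r *\<^sub>R L y a"])
        (auto simp: linear_cmul[OF assms(3)] intro!: has_derivative_scaleR_right d)
    then show ?thesis by (rule fder_eqI)
  qed
  ultimately show ?thesis by (intro linearI) auto
qed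

lemma has_derivative_bilinear_family:
  fixes B :: "_ \<Rightarrow> 'b::euclidean_space \<Rightarrow> 'd::euclidean_space \<Rightarrow> _"
  assumes "open S" "z \<in> S" "\<And>y. y \<in> S \<Longrightarrow> bilinear (B y)"
    "\<And>i j. (\<lambda>y. B y i j) differentiable at z" "(a has_derivative a') (at z)" "(b has_derivative b') (at z)"
  shows "((\<lambda>y. B y (a y) (b y)) has_derivative
    (\<lambda>v. fder (\<lambda>y. B y (a z) (b z)) z v + B z (a' v) (b z) + B z (a z) (b' v))) (at z)"
proof -
  have 1: "((\<lambda>y. B y (a y) j) has_derivative (\<lambda>v. fder (\<lambda>y. B y (a z) j) z v + B z (a' v) j)) (at z)" for j
    by (rule has_derivative_linear_family[where L = "\<lambda>y w. B y w j", OF assms(1,2) _ _ assms(5)])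
      (use assms(3,4) in \<open>auto simp: bilinear_def\<close>)
  have "((\<lambda>y. B y (a y) (b y)) has_derivative
    (\<lambda>v. fder (\<lambda>y. B y (a y) (b z)) z v + B z (a z) (b' v))) (at z)"
    by (rule has_derivative_linear_family[where L = "\<lambda>y w. B y (a y) w", OF assms(1,2) _ _ assms(6)])
      (use assms(3) differentiableI[OF 1] in \<open>auto simp: bilinear_def\<close>)
  then show ?thesis by (simp add: fder_eqI[OF 1])
qed

lemma bilinear_fder_family:
  fixes B :: "_ \<Rightarrow> 'b::euclidean_space \<Rightarrow> 'd::euclidean_space \<Rightarrow> _"
  assumes "open S" "z \<in> S" "\<And>y. y \<in> S \<Longrightarrow> bilinear (B y)" "\<And>i j. (\<lambda>y. B y i j) differentiable at z"
  shows "bilinear (\<lambda>u w. fder (\<lambda>y. B y u w) z v)"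
  unfolding bilinear_def
proof (intro conjI allI)
  fix i
  show "linear (\<lambda>w. fder (\<lambda>y. B y i w) z v)"
    by (rule linear_fder_family[where L = "\<lambda>y. B y i", OF assms(1,2)])
      (use assms(3,4) in \<open>auto simp: bilinear_def\<close>)
next
  fix i
  show "linear (\<lambda>u. fder (\<lambda>y. B y u i) z v)"
    by (rule linear_fder_family[where L = "\<lambda>y u. B y u i", OF assms(1,2)])
      (use assms(3,4) in \<open>auto simp: bilinear_def\<close>)
qed

section \<open>Linear algebra of the Euclidean plane\<close>

lemma bilinear_rules:
  assumes "bilinear b"
  shows "b (u + v) w = b u w + b v w" "b u (v + w) = b u v + b u w"
    "b (r *\<^sub>R u) w = r *\<^sub>R b u w" "b u (r *\<^sub>R w) = r *\<^sub>R b u w"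
    "b (- u) w = - b u w" "b u (- w) = - b u w"
    "b (u - v) w = b u w - b v w" "b u (v - w) = b u v - b u w"
    "b 0 w = 0" "b u 0 = 0"
  using assms
  by (simp_all add: bilinear_ladd bilinear_radd bilinear_lmul bilinear_rmul bilinear_lneg bilinear_rneg
      bilinear_lsub bilinear_rsub bilinear_lzero bilinear_rzero)

lemma linear_rules:
  assumes "linear L"
  shows "L (u + v) = L u + L v" "L (r *\<^sub>R u) = r *\<^sub>R L u" "L (- u) = - L u" "L (u - v) = L u - L v" "L 0 = 0"
  using assms by (simp_all add: linear_add linear_cmul linear_neg linear_diff linear_0)

definition inner_form :: "('a::euclidean_space \<Rightarrow> 'a \<Rightarrow> real) \<Rightarrow> bool" where
  "inner_form b \<longleftrightarrow> bilinear b \<and> (\<forall>u w. b u w = b w u) \<and> (\<forall>u. u \<noteq> 0 \<longrightarrow> 0 < b u u)"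

lemma inner_formD:
  assumes "inner_form b"
  shows "bilinear b" "b u w = b w u" "u \<noteq> 0 \<Longrightarrow> 0 < b u u" "b u u = 0 \<Longrightarrow> u = 0"
proof -
  show "bilinear b" "b u w = b w u" "u \<noteq> 0 \<Longrightarrow> 0 < b u u" using assms unfolding inner_form_def by auto
  show "b u u = 0 \<Longrightarrow> u = 0" using assms unfolding inner_form_def by force
qed

lemma inner_form_eqI:
  assumes "inner_form b" "\<And>w. b u w = b v w"
  shows "u = v"
proof -
  have "b (u - v) (u - v) = 0" using assms(2) by (simp add: bilinear_rules(7)[OF inner_formD(1)[OF assms(1)]])
  then show ?thesis using inner_formD(4)[OF assms(1)] by force
qed

text \<open>The map \<open>T\<close> sends \<open>v\<close> to the coordinates of
  \<open>b v\<close>. Definiteness makes it injective, hence onto in finite dimension. Tangential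
  parts, shape operators and Christoffel symbols obtain existence and uniqueness from here.\<close>

lemma inner_form_represents:
  fixes b :: "'a::euclidean_space \<Rightarrow> 'a \<Rightarrow> real"
  assumes b: "inner_form b" and \<phi>: "linear \<phi>"
  shows "\<exists>!v. \<forall>w. b v w = \<phi> w"
proof -
  note bl = bilinear_rules[OF inner_formD(1)[OF b]]
  define T where "T v = (\<Sum>i\<in>Basis. b v i *\<^sub>R i)" for v
  have "linear T"
    unfolding T_def by (rule linearI) (simp_all add: bl sum.distrib scaleR_left_distrib scaleR_sum_right)
  have Tb: "T v \<bullet> i = b v i" if "i \<in> Basis" for v i
    using that by (simp add: T_def)
  have ext: "b v w = \<psi> w" if "linear \<psi>" "\<And>i. i \<in> Basis \<Longrightarrow> b v i = \<psi> i" for v w \<psi>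
  proof -
    have "linear (b v)" using inner_formD(1)[OF b] by (simp add: bilinear_def)
    then show ?thesis using linear_eq_on_span[of "b v" \<psi> Basis w] that by auto
  qed
  have "inj T"
  proof (rule linear_injective_0[OF \<open>linear T\<close>, THEN iffD2], intro allI impI)
    fix v assume "T v = 0"
    then have "b v i = 0" if "i \<in> Basis" for i using Tb[OF that, of v] by simp
    then have "b v v = 0" using ext[of "\<lambda>_. 0" v v] by (auto simp: linear_iff)
    then show "v = 0" using inner_formD(4)[OF b] by blast
  qed
  then have "surj T" using linear_injective_imp_surjective[OF \<open>linear T\<close>] by blast
  then obtain v where v: "T v = (\<Sum>i\<in>Basis. \<phi> i *\<^sub>R i)" by (metis surjD)
  have "b v i = \<phi> i" if "i \<in> Basis" for i
    using Tb[OF that, of v] that unfolding v by simp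
  then have "\<forall>w. b v w = \<phi> w" using ext[OF \<phi>] by blast
  moreover have "v' = v" if "\<forall>w. b v' w = \<phi> w" for v'
    using inner_form_eqI[OF b, of v' v] that \<open>\<forall>w. b v w = \<phi> w\<close> by simp
  ultimately show ?thesis by blast
qed

abbreviation e1 :: "real^2" where "e1 \<equiv> axis 1 1"
abbreviation e2 :: "real^2" where "e2 \<equiv> axis 2 1"

lemma axis_components: "e1 $ 1 = 1" "e1 $ 2 = 0" "e2 $ 1 = 0" "e2 $ 2 = 1"
  by (simp_all add: axis_def)

lemma plane_expand: "(u::real^2) = u $ 1 *\<^sub>R e1 + u $ 2 *\<^sub>R e2"
  by (simp add: vec_eq_iff forall_2 axis_components)

lemma plane_bilinear_expand:
  fixes u w :: "real^2" and b :: "real^2 \<Rightarrow> real^2 \<Rightarrow> real"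
  assumes "bilinear b"
  shows "b u w = u $ 1 * w $ 1 * b e1 e1 + u $ 1 * w $ 2 * b e1 e2 + u $ 2 * w $ 1 * b e2 e1
    + u $ 2 * w $ 2 * b e2 e2"
proof -
  have "b u w = b (u $ 1 *\<^sub>R e1 + u $ 2 *\<^sub>R e2) (w $ 1 *\<^sub>R e1 + w $ 2 *\<^sub>R e2)"
    using plane_expand[of u] plane_expand[of w] by simp
  then show ?thesis by (simp add: bilinear_rules[OF assms] algebra_simps)
qed

definition det2 :: "real^2 \<Rightarrow> real^2 \<Rightarrow> real" where
  "det2 u w = u $ 1 * w $ 2 - u $ 2 * w $ 1"

lemma det2_eq_det: "det (vector [u, w] :: real^2^2) = det2 u w"
  by (simp add: det_2 det2_def)

lemma gram_pos:
  assumes "inner_form (b :: real^2 \<Rightarrow> real^2 \<Rightarrow> real)"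
  shows "0 < b e1 e1 * b e2 e2 - b e1 e2 * b e2 e1"
proof -
  note bl = bilinear_rules[OF inner_formD(1)[OF assms]]
  \<comment> \<open>Gram-Schmidt without denominators: \<open>v\<close> is orthogonal to
    \<open>e1\<close>, and \<open>b v v\<close> is \<open>b e1 e1\<close> times the Gram
    determinant.\<close>
  define v where "v = b e1 e1 *\<^sub>R e2 - b e1 e2 *\<^sub>R e1"
  have p: "0 < b e1 e1" by (rule inner_formD(3)[OF assms]) simp
  then have "v $ 2 \<noteq> 0" by (simp add: v_def axis_components)
  then have "v \<noteq> 0" by auto
  then have "0 < b v v" by (rule inner_formD(3)[OF assms])
  also have "b v v = b e1 e1 * (b e1 e1 * b e2 e2 - b e1 e2 * b e2 e1)"
    using inner_formD(2)[OF assms, of e1 e2] by (simp add: v_def bl algebra_simps)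
  finally show ?thesis using p by (simp add: zero_less_mult_iff)
qed

text \<open>Cramer's rule. On the right \<open>v\<close> occurs only through \<open>b v e1\<close>
  and \<open>b v e2\<close>, so smoothness of these numbers passes to \<open>v\<close>.\<close>

lemma plane_solve:
  fixes b :: "real^2 \<Rightarrow> real^2 \<Rightarrow> real"
  assumes "inner_form b"
  shows "v = (1 / (b e1 e1 * b e2 e2 - b e1 e2 * b e2 e1)) *\<^sub>R
    ((b v e1 * b e2 e2 - b v e2 * b e1 e2) *\<^sub>R e1 + (b v e2 * b e1 e1 - b v e1 * b e1 e2) *\<^sub>R e2)"
proof -
  note bl = plane_bilinear_expand[OF inner_formD(1)[OF assms]]
  have sym: "b e2 e1 = b e1 e2" by (rule inner_formD(2)[OF assms])
  have "b v e1 = v $ 1 * b e1 e1 + v $ 2 * b e2 e1" "b v e2 = v $ 1 * b e1 e2 + v $ 2 * b e2 e2"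
    using bl[of v e1] bl[of v e2] by (simp_all add: axis_components)
  then have "b v e1 * b e2 e2 - b v e2 * b e1 e2 = v $ 1 * (b e1 e1 * b e2 e2 - b e1 e2 * b e2 e1)"
    "b v e2 * b e1 e1 - b v e1 * b e1 e2 = v $ 2 * (b e1 e1 * b e2 e2 - b e1 e2 * b e2 e1)"
    by (simp_all add: sym algebra_simps)
  then show ?thesis
    using gram_pos[OF assms] plane_expand[of v] by (simp add: scaleR_right_distrib)
qed

lemma smooth_on_solve:
  fixes b :: "_ \<Rightarrow> real^2 \<Rightarrow> real^2 \<Rightarrow> real"
  assumes "open S" "\<And>z. z \<in> S \<Longrightarrow> inner_form (b z)" "\<And>i j. smooth_on S (\<lambda>z. b z i j)"
    "\<And>w. smooth_on S (\<lambda>z. b z (v z) w)"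
  shows "smooth_on S v"
proof -
  let ?d = "\<lambda>z. b z e1 e1 * b z e2 e2 - b z e1 e2 * b z e2 e1"
  have ne: "?d z \<noteq> 0" if "z \<in> S" for z using gram_pos[OF assms(2)[OF that]] by simp
  have "smooth_on S (\<lambda>z. (1 / ?d z) *\<^sub>R
    ((b z (v z) e1 * b z e2 e2 - b z (v z) e2 * b z e1 e2) *\<^sub>R e1
      + (b z (v z) e2 * b z e1 e1 - b z (v z) e1 * b z e1 e2) *\<^sub>R e2))"
    by (intro smooth_on_scaleR smooth_on_divide smooth_on_add smooth_on_diff smooth_on_mult smooth_on_const
        assms(1,3,4)) (use ne in auto)
  then show ?thesis
    by (subst smooth_on_cong[OF assms(1)]) (auto intro: plane_solve[OF assms(2)])
qed

text \<open>The solution of \<open>b (J u) w = s * det2 u w\<close>, with \<open>s\<close> the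
  square root of the Gram determinant: the rotation is the area form with one index raised.\<close>

definition rotation_of :: "(real^2 \<Rightarrow> real^2 \<Rightarrow> real) \<Rightarrow> real^2 \<Rightarrow> real^2" where
  "rotation_of b u = (1 / sqrt (b e1 e1 * b e2 e2 - b e1 e2 * b e2 e1)) *\<^sub>R
    ((- b e1 e2 * u $ 1 - b e2 e2 * u $ 2) *\<^sub>R e1 + (b e1 e1 * u $ 1 + b e1 e2 * u $ 2) *\<^sub>R e2)"

lemma is_rotation_rotation_of:
  assumes "inner_form b"
  shows "is_rotation b (rotation_of b)"
proof -
  note bl = plane_bilinear_expand[OF inner_formD(1)[OF assms]]
  have sym: "b e2 e1 = b e1 e2" by (rule inner_formD(2)[OF assms])
  define s where "s = 1 / sqrt (b e1 e1 * b e2 e2 - b e1 e2 * b e2 e1)"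
  have s: "s > 0" "s * s * (b e1 e1 * b e2 e2 - b e1 e2 * b e1 e2) = 1"
    using gram_pos[OF assms] by (simp_all add: s_def sym)
  have c: "rotation_of b u $ 1 = s * (- b e1 e2 * u $ 1 - b e2 e2 * u $ 2)"
    "rotation_of b u $ 2 = s * (b e1 e1 * u $ 1 + b e1 e2 * u $ 2)" for u
    by (simp_all add: rotation_of_def s_def[symmetric] axis_components)
  have "linear (rotation_of b)"
    by (rule linearI) (simp_all add: vec_eq_iff forall_2 c algebra_simps)
  moreover have "b u (rotation_of b u) = 0" for u
    unfolding bl[of u "rotation_of b u"] c sym by (simp add: algebra_simps)
  moreover have "b (rotation_of b u) (rotation_of b u) = b u u" for u
  proof -
    have "b (rotation_of b u) (rotation_of b u)
        = (s * s * (b e1 e1 * b e2 e2 - b e1 e2 * b e1 e2)) * b u u"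
      unfolding bl[of "rotation_of b u" "rotation_of b u"] bl[of u u] c sym by (simp add: algebra_simps)
    then show ?thesis by (simp add: s(2))
  qed
  moreover have "0 < det2 u (rotation_of b u)" if "u \<noteq> 0" for u
  proof -
    have "det2 u (rotation_of b u) = s * b u u"
      unfolding bl[of u u] det2_def c sym by (simp add: algebra_simps)
    then show ?thesis using s(1) inner_formD(3)[OF assms that] by simp
  qed
  ultimately show ?thesis by (simp add: is_rotation_def det2_eq_det)
qed

locale rotation_plane =
  fixes b :: "real^2 \<Rightarrow> real^2 \<Rightarrow> real" and J :: "real^2 \<Rightarrow> real^2"
  assumes b: "inner_form b" and J: "is_rotation b J"
begin

lemmas bl = bilinear_rules[OF inner_formD(1)[OF b], simplified real_scaleR_def]
lemmas sym = inner_formD(2)[OF b]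
lemma linear_J: "linear J" using J by (simp add: is_rotation_def)
lemmas Jl = linear_rules[OF linear_J]
lemma J_perp: "b u (J u) = 0" "b (J u) u = 0" and J_isometry: "b (J u) (J u) = b u u"
  using J sym[of u "J u"] by (simp_all add: is_rotation_def)
lemma det2_J_pos: "u \<noteq> 0 \<Longrightarrow> 0 < det2 u (J u)"
  using J by (simp add: is_rotation_def det2_eq_det)

text \<open>Polarisation of \<open>b u (J u) = 0\<close>.\<close>

lemma J_skew: "b (J u) w = - b u (J w)"
proof -
  have "b (u + w) (J (u + w)) = 0" by (rule J_perp)
  then show ?thesis using sym[of w "J u"] by (simp add: bl Jl J_perp)
qed

lemma J_J: "J (J u) = - u"
proof -
  have "b (J (J u) + u) (J (J u) + u) = 0"
    using J_skew[of "J u" u] sym[of u "J (J u)"] by (simp add: bl J_isometry)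
  then show ?thesis using inner_formD(4)[OF b] by (metis eq_neg_iff_add_eq_0)
qed

lemma b_J_J: "b (J u) (J w) = b u w"
  using J_skew[of u "J w"] by (simp add: J_J bl)

text \<open>Identities that are linear in \<open>w\<close> need only be checked at
  \<open>w = u\<close> and \<open>w = J u\<close>. The coefficients are Cramer's rule for
  \<open>det2\<close>.\<close>

lemma frame:
  assumes "u \<noteq> 0"
  obtains a c where "w = a *\<^sub>R u + c *\<^sub>R J u"
proof
  let ?d = "det2 u (J u)"
  have "?d \<noteq> 0" using det2_J_pos[OF assms] by simp
  then show "w = (det2 w (J u) / ?d) *\<^sub>R u + (det2 u w / ?d) *\<^sub>R J u"
    by (simp add: vec_eq_iff forall_2 field_simps) (simp add: det2_def algebra_simps)
qed

lemma eq_0I: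
  assumes "u \<noteq> 0" "b v u = 0" "b v (J u) = 0"
  shows "v = 0"
proof -
  obtain a c where "v = a *\<^sub>R u + c *\<^sub>R J u" using frame[OF assms(1)] .
  then have "b v v = 0" using assms(2,3) by (metis bl(2,4) mult_zero_right add_0)
  then show ?thesis using inner_formD(4)[OF b] by blast
qed

text \<open>In the frame \<open>u\<close>, \<open>J u\<close>, orthogonality removes the first
  coefficient of \<open>K u\<close>, isometry makes the square of the second equal to 1, and the
  orientation chooses the sign.\<close>

lemma rotation_unique:
  assumes "is_rotation b K"
  shows "K = J"
proof
  fix u
  interpret K: rotation_plane b K by unfold_locales (fact b, fact assms)
  show "K u = J u"
  proof (cases "u = 0")
    case True
    then show ?thesis by (simp add: Jl K.Jl)
  next
    case False
    obtain a c where K: "K u = a *\<^sub>R u + c *\<^sub>R J u" using frame[OF False] .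
    have pos: "b u u > 0" using inner_formD(3)[OF b False] .
    have "b u (K u) = a * b u u" by (simp add: K bl J_perp)
    then have "a = 0" using pos K.J_perp(1)[of u] by simp
    have "b (K u) (K u) = c * c * b u u" by (simp add: K \<open>a = 0\<close> bl J_isometry)
    then have "c * c = 1" using K.J_isometry[of u] pos by simp
    have "det2 u (K u) = c * det2 u (J u)" by (simp add: K \<open>a = 0\<close> det2_def algebra_simps)
    then have "c > 0" using K.det2_J_pos[OF False] det2_J_pos[OF False] by (simp add: zero_less_mult_iff)
    then have "c = 1" using \<open>c * c = 1\<close> by (metis abs_of_pos real_sqrt_abs2 real_sqrt_one)
    then show ?thesis by (simp add: K \<open>a = 0\<close>)
  qed
qed

text \<open>Both sides are the oriented area form of \<open>b\<close>. The right side involves no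
  \<open>J\<close>, which yields the smoothness of \<open>J\<close> and reduces the trace identity
  to determinants.\<close>

lemma b_J_eq_det2: "b (J u) w = sqrt (b e1 e1 * b e2 e2 - b e1 e2 * b e2 e1) * det2 u w"
proof -
  note ex = plane_bilinear_expand[OF inner_formD(1)[OF b]]
  have s2: "b e2 e1 = b e1 e2" by (rule sym)
  define s where "s = sqrt (b e1 e1 * b e2 e2 - b e1 e2 * b e2 e1)"
  have s: "s > 0" "s * s = b e1 e1 * b e2 e2 - b e1 e2 * b e1 e2"
    using gram_pos[OF b] by (simp_all add: s_def s2)
  have J: "J = rotation_of b" using rotation_unique[OF is_rotation_rotation_of[OF b]] by simp
  have "J u $ 1 = 1 / s * (- b e1 e2 * u $ 1 - b e2 e2 * u $ 2)"
    "J u $ 2 = 1 / s * (b e1 e1 * u $ 1 + b e1 e2 * u $ 2)"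
    unfolding J by (simp_all add: rotation_of_def s_def[symmetric] axis_components)
  then have c: "s * (J u $ 1) = - b e1 e2 * u $ 1 - b e2 e2 * u $ 2"
    "s * (J u $ 2) = b e1 e1 * u $ 1 + b e1 e2 * u $ 2"
    using s(1) by simp_all
  have "s * b (J u) w = (s * (J u $ 1)) * (w $ 1 * b e1 e1 + w $ 2 * b e1 e2)
      + (s * (J u $ 2)) * (w $ 1 * b e1 e2 + w $ 2 * b e2 e2)"
    unfolding ex[of "J u" w] s2 by (simp add: algebra_simps)
  also have "\<dots> = s * s * det2 u w"
    unfolding c s(2) det2_def by (simp add: algebra_simps)
  finally show ?thesis using s(1) by (simp add: s_def[symmetric])
qed

text \<open>The derivative at 0 of the rule that 1 + t \<open>S\<close> multiplies areas by det(1 +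
  t \<open>S\<close>), written with the area form \<open>b (J u) w\<close>.\<close>

lemma trace_identity:
  assumes "linear S"
  shows "b (J (S u)) w + b (J u) (S w) = trace (matrix S) * b (J u) w"
proof -
  have S: "S v $ k = v $ 1 * S e1 $ k + v $ 2 * S e2 $ k" for v k
    using arg_cong[OF plane_expand[of v], of S] by (simp add: linear_rules[OF assms])
  have "det2 (S u) w + det2 u (S w) = trace (matrix S) * det2 u w"
    unfolding det2_def trace_def matrix_def sum_2 S[of u 1] S[of u 2] S[of w 1] S[of w 2]
    by (simp add: algebra_simps)
  then show ?thesis
    unfolding b_J_eq_det2 distrib_left[symmetric] by (simp only: mult.left_commute)
qed

text \<open>For self-adjoint \<open>S\<close> the trace identity reads J S + S J = tr(S) J.
  Subtracting half of the trace from \<open>S\<close> removes the right side.\<close>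

lemma traceless_anticommute:
  assumes "linear S" "\<And>u w. b (S u) w = b u (S w)"
  defines "S0 \<equiv> \<lambda>u. S u - (trace (matrix S) / 2) *\<^sub>R u"
  shows "S0 (J u) = - J (S0 u)"
proof -
  have "J (S u) + S (J u) = trace (matrix S) *\<^sub>R J u"
    by (rule inner_form_eqI[OF b]) (use trace_identity[OF assms(1), of u] assms(2)[of "J u"] in \<open>simp add: bl\<close>)
  moreover have "trace (matrix S) *\<^sub>R J u
      = (trace (matrix S) / 2) *\<^sub>R J u + (trace (matrix S) / 2) *\<^sub>R J u"
    by (simp flip: scaleR_left_distrib)
  ultimately have "S (J u) = (trace (matrix S) / 2) *\<^sub>R J u + (trace (matrix S) / 2) *\<^sub>R J u - J (S u)"
    by (simp only: eq_diff_eq add.commute)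
  then show ?thesis by (simp add: S0_def Jl)
qed

text \<open>Both sides are alternating in \<open>u\<close> and \<open>w\<close>, so the case
  \<open>w = J u\<close> decides, and there J-symmetry of \<open>\<sigma>\<close> suffices. It says
  that -\<open>T J\<close> and \<open>J T\<close> have the same wedge pairing with
  \<open>\<sigma>\<close>; a commutator \<open>J T - T J\<close> therefore counts \<open>J T\<close>
  twice, the source of the factor 2 in \<open>\<beta>\<close>.\<close>

lemma wedge_endo_identity:
  assumes "bilinear \<sigma>" "\<And>u w. \<sigma> u (J w) = \<sigma> (J u) w" "linear T"
  shows "\<sigma> w (T (J u)) - \<sigma> u (T (J w)) = \<sigma> u (J (T w)) - (\<sigma> w (J (T u)) :: real)"
proof (cases "u = 0")
  case True
  then show ?thesis by (simp add: bilinear_rules[OF assms(1)] linear_rules[OF assms(3)] Jl)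
next
  case False
  obtain a c where w: "w = a *\<^sub>R u + c *\<^sub>R J u" using frame[OF False] .
  show ?thesis unfolding w
    by (simp add: bilinear_rules[OF assms(1)] linear_rules[OF assms(3)] Jl J_J assms(2)[symmetric] algebra_simps)
qed

text \<open>In the frame \<open>u\<close>, \<open>J u\<close> the only nontrivial case is
  \<open>\<sigma> u (J u) = \<sigma> (J u) u\<close>, an instance of the assumption.\<close>

lemma quadratic_symmetric:
  fixes \<sigma> :: "real^2 \<Rightarrow> real^2 \<Rightarrow> real"
  assumes "bilinear \<sigma>" "\<And>u w. \<sigma> u (J w) = \<sigma> (J u) w"
  shows "\<sigma> u w = \<sigma> w u"
proof (cases "u = 0")
  case True
  then show ?thesis by (simp add: bilinear_rules[OF assms(1)])
next
  case False
  obtain a c where w: "w = a *\<^sub>R u + c *\<^sub>R J u" using frame[OF False] .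
  show ?thesis unfolding w by (simp add: bilinear_rules[OF assms(1)] assms(2))
qed

text \<open>To be read with \<open>R\<close> the Lie derivative of \<open>J\<close>,
  \<open>K\<close> that of the induced metric and \<open>S\<close> a shape operator. The assumptions
  \<open>KR\<close> are the derivatives of \<open>b u (J u) = 0\<close> and
  \<open>b (J u) (J u) = b u u\<close>. They determine the products of \<open>R u\<close> with
  \<open>u\<close> and \<open>J u\<close>, where the conformal factor \<open>k\<close>
  cancels.\<close>

lemma rotation_variation:
  assumes S: "linear S" "\<And>u w. b (S u) w = b u (S w)" and R: "linear R"
    and K: "\<And>u w. K u w = k * b u w + 2 * b (S u) w"
    and KR: "\<And>u. K u (J u) + b u (R u) = 0" "\<And>u. 2 * b (R u) (J u) + K (J u) (J u) = K u u"
  shows "R u + 2 *\<^sub>R (S (J u) - (trace (matrix S) / 2) *\<^sub>R J u) = 0"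
proof (cases "u = 0")
  case True
  then show ?thesis by (simp add: linear_rules[OF R] linear_rules[OF S(1)] Jl)
next
  case False
  let ?v = "R u + 2 *\<^sub>R (S (J u) - (trace (matrix S) / 2) *\<^sub>R J u)"
  have t: "trace (matrix S) * b u u = b (S u) u + b (S (J u)) (J u)"
    using trace_identity[OF S(1), of u "J u"] S(2)[of "J u" "J u"] by (simp add: b_J_J)
  have "b u (R u) = - 2 * b (S u) (J u)" using KR(1)[of u] by (simp add: K J_perp)
  moreover have "b (S (J u)) u = b (S u) (J u)" using S(2)[of "J u" u] sym by simp
  ultimately have 1: "b ?v u = 0" using sym[of "R u" u] by (simp add: bl J_perp)
  have "b (R u) (J u) = b (S u) u - b (S (J u)) (J u)"
    using KR(2)[of u] by (simp add: K J_isometry)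
  then have 2: "b ?v (J u) = 0" using t by (simp add: bl J_isometry field_simps)
  show ?thesis by (rule eq_0I[OF False 1 2])
qed

end

section \<open>Calculus in charts\<close>

lemma has_derivative_linear_family_comp:
  fixes L :: "'b::euclidean_space \<Rightarrow> 'c::euclidean_space \<Rightarrow> 'd::real_normed_vector"
  assumes "open S" "z \<in> S" "\<And>y. y \<in> S \<Longrightarrow> t y \<in> T" "(t has_derivative t') (at z)"
    "\<And>y. y \<in> T \<Longrightarrow> linear (L y)" "\<And>i. (\<lambda>y. L y i) differentiable at (t z)"
    "(a has_derivative a') (at z)"
  shows "((\<lambda>y. L (t y) (a y)) has_derivative
    (\<lambda>v. fder (\<lambda>y. L y (a z)) (t z) (t' v) + L (t z) (a' v))) (at z)"
proof -
  have c: "((\<lambda>y. L (t y) i) has_derivative (\<lambda>v. fder (\<lambda>y. L y i) (t z) (t' v))) (at z)" for i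
    by (rule has_derivative_compose[OF assms(4)]) (use assms(6) frechet_derivative_works in blast)
  have "((\<lambda>y. L (t y) (a y)) has_derivative
    (\<lambda>v. fder (\<lambda>y. L (t y) (a z)) z v + L (t z) (a' v))) (at z)"
    by (rule has_derivative_linear_family[where L = "\<lambda>y. L (t y)", OF assms(1,2) _ _ assms(7)])
      (use assms(3,5) differentiableI[OF c] in auto)
  then show ?thesis by (simp add: fder_eqI[OF c])
qed

lemma has_derivative_bilinear_family_comp:
  fixes B :: "'b::euclidean_space \<Rightarrow> 'c::euclidean_space \<Rightarrow> 'c2::euclidean_space \<Rightarrow> 'd::real_normed_vector"
  assumes "open S" "z \<in> S" "\<And>y. y \<in> S \<Longrightarrow> t y \<in> T" "(t has_derivative t') (at z)"
    "\<And>y. y \<in> T \<Longrightarrow> bilinear (B y)" "\<And>i j. (\<lambda>y. B y i j) differentiable at (t z)"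
    "(a has_derivative a') (at z)" "(b has_derivative b') (at z)"
  shows "((\<lambda>y. B (t y) (a y) (b y)) has_derivative
    (\<lambda>v. fder (\<lambda>y. B y (a z) (b z)) (t z) (t' v) + B (t z) (a' v) (b z) + B (t z) (a z) (b' v))) (at z)"
proof -
  have c: "((\<lambda>y. B (t y) i j) has_derivative (\<lambda>v. fder (\<lambda>y. B y i j) (t z) (t' v))) (at z)" for i j
    by (rule has_derivative_compose[OF assms(4)]) (use assms(6) frechet_derivative_works in blast)
  have "((\<lambda>y. B (t y) (a y) (b y)) has_derivative
    (\<lambda>v. fder (\<lambda>y. B (t y) (a z) (b z)) z v + B (t z) (a' v) (b z) + B (t z) (a z) (b' v))) (at z)"
    by (rule has_derivative_bilinear_family[where B = "\<lambda>y. B (t y)", OF assms(1,2) _ _ assms(7,8)])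
      (use assms(3,5) differentiableI[OF c] in auto)
  then show ?thesis by (simp add: fder_eqI[OF c])
qed

abbreviation sder :: "('a::real_normed_vector \<Rightarrow> 'b::real_normed_vector) \<Rightarrow> 'a \<Rightarrow> 'a \<Rightarrow> 'a \<Rightarrow> 'b" where
  "sder f z u w \<equiv> fder (\<lambda>y. fder f y w) z u"

lemma fder_compose:
  assumes "smooth_on S t" "z \<in> S" "smooth_on T f" "t z \<in> T"
  shows "fder (\<lambda>y. f (t y)) z = (\<lambda>v. fder f (t z) (fder t z v))"
  by (rule fder_eqI, rule has_derivative_compose[of t "fder t z" z UNIV f "fder f (t z)"])
    (use assms smooth_on_has_derivative in auto)

lemma sder_compose:
  fixes t :: "'a::euclidean_space \<Rightarrow> 'b::euclidean_space"
  assumes "open S" "z \<in> S" "smooth_on S t" "smooth_on T f" "\<And>y. y \<in> S \<Longrightarrow> t y \<in> T"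
  shows "sder (\<lambda>y. f (t y)) z u w = sder f (t z) (fder t z u) (fder t z w) + fder f (t z) (sder t z u w)"
proof -
  have "sder (\<lambda>y. f (t y)) z u w = fder (\<lambda>y. fder f (t y) (fder t y w)) z u"
    by (subst fder_cong_open[OF assms(1,2)]) (use fder_compose[OF assms(3) _ assms(4) assms(5)] in auto)
  also have "\<dots> = sder f (t z) (fder t z u) (fder t z w) + fder f (t z) (sder t z u w)"
    by (subst fder_eqI[OF has_derivative_linear_family_comp[where L = "fder f" and t = t and T = T, OF assms(1,2)]])
      (use assms smooth_on_has_derivative smooth_on_linear_fder smooth_on_fder smooth_on_differentiable in blast)+
  finally show ?thesis .
qed

lemma fder_pullback_bilinear:
  fixes t :: "'a::euclidean_space \<Rightarrow> 'b::euclidean_space" and g' :: "'b \<Rightarrow> 'b \<Rightarrow> 'b \<Rightarrow> real"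
  assumes "open S" "z \<in> S" "smooth_on S t" "\<And>y. y \<in> S \<Longrightarrow> t y \<in> T"
    "\<And>y. y \<in> T \<Longrightarrow> bilinear (g' y)" "\<And>i j. smooth_on T (\<lambda>y. g' y i j)"
    "\<And>y. y \<in> S \<Longrightarrow> g y a b = g' (t y) (fder t y a) (fder t y b)"
  shows "fder (\<lambda>y. g y a b) z v = fder (\<lambda>y. g' y (fder t z a) (fder t z b)) (t z) (fder t z v)
    + g' (t z) (sder t z v a) (fder t z b) + g' (t z) (fder t z a) (sder t z v b)"
proof -
  have "fder (\<lambda>y. g y a b) z v = fder (\<lambda>y. g' (t y) (fder t y a) (fder t y b)) z v"
    by (subst fder_cong_open[OF assms(1,2)]) (use assms(7) in auto)
  also have "\<dots> = fder (\<lambda>y. g' y (fder t z a) (fder t z b)) (t z) (fder t z v)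
    + g' (t z) (sder t z v a) (fder t z b) + g' (t z) (fder t z a) (sder t z v b)"
    by (subst fder_eqI[OF has_derivative_bilinear_family_comp[where B = g' and t = t and T = T, OF assms(1,2)]])
      (use assms smooth_on_has_derivative smooth_on_fder smooth_on_differentiable in blast)+
  finally show ?thesis .
qed

text \<open>Christoffel symbols of the first kind. Keeping the index lowered avoids inverting the
  metric and gives a formula that is smooth and linear in each slot.\<close>

definition koszul :: "('b::real_normed_vector \<Rightarrow> 'b \<Rightarrow> 'b \<Rightarrow> real) \<Rightarrow> 'b \<Rightarrow> 'b \<Rightarrow> 'b \<Rightarrow> 'b \<Rightarrow> real" where
  "koszul g y a b c = (fder (\<lambda>y. g y b c) y a + fder (\<lambda>y. g y a c) y b - fder (\<lambda>y. g y a b) y c) / 2"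

text \<open>Transformation law of the Christoffel symbols. Of the six terms with second derivatives
  of \<open>t\<close>, four cancel by symmetry of these derivatives and of the metric, and the
  remaining two are equal, absorbing the factor 1/2.\<close>

lemma koszul_pullback:
  fixes t :: "'a::euclidean_space \<Rightarrow> 'b::euclidean_space" and g' :: "'b \<Rightarrow> 'b \<Rightarrow> 'b \<Rightarrow> real"
  assumes "open S" "z \<in> S" "smooth_on S t" "\<And>y. y \<in> S \<Longrightarrow> t y \<in> T"
    "\<And>y. y \<in> T \<Longrightarrow> bilinear (g' y)" "\<And>i j. smooth_on T (\<lambda>y. g' y i j)" "\<And>y i j. g' y i j = g' y j i"
    "\<And>y a b. y \<in> S \<Longrightarrow> g y a b = g' (t y) (fder t y a) (fder t y b)"
  shows "koszul g z a b c = koszul g' (t z) (fder t z a) (fder t z b) (fder t z c)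
    + g' (t z) (sder t z a b) (fder t z c)"
proof -
  have p: "fder (\<lambda>y. g y a b) z v = fder (\<lambda>y. g' y (fder t z a) (fder t z b)) (t z) (fder t z v)
    + g' (t z) (sder t z v a) (fder t z b) + g' (t z) (fder t z a) (sder t z v b)" for a b v
    by (rule fder_pullback_bilinear[OF assms(1-6)]) (use assms(8) in auto)
  have s: "sder t z u w = sder t z w u" for u w
    by (rule symmetric_second_derivative[OF assms(1-3)])
  show ?thesis
    unfolding koszul_def p s[of c a] s[of c b] s[of b a]
    by (simp add: assms(7)[of "t z" "fder t z b"] assms(7)[of "t z" "fder t z a"] field_simps)
qed

lemma koszul_linear:
  fixes g :: "'b::euclidean_space \<Rightarrow> 'b \<Rightarrow> 'b \<Rightarrow> real"
  assumes "open T" "y \<in> T" "\<And>y. y \<in> T \<Longrightarrow> bilinear (g y)" "\<And>i j. smooth_on T (\<lambda>y. g y i j)"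
  shows "linear (koszul g y a b)" "linear (\<lambda>b. koszul g y a b c)" "linear (\<lambda>a. koszul g y a b c)"
proof -
  have d: "(\<lambda>y. g y i j) differentiable at y" for i j
    by (rule smooth_on_differentiable[OF assms(4,2)])
  have l: "bilinear (\<lambda>u w. fder (\<lambda>y. g y u w) y v)" for v
    by (rule bilinear_fder_family[OF assms(1,2,3) d])
  have v: "linear (fder (\<lambda>y. g y u w) y)" for u w
    by (rule linear_frechet_derivative[OF d])
  note r = bilinear_rules[OF l] linear_rules[OF v]
  show "linear (koszul g y a b)" "linear (\<lambda>b. koszul g y a b c)" "linear (\<lambda>a. koszul g y a b c)"
    unfolding koszul_def by (rule linearI; simp add: r field_simps)+
qed

subsection \<open>Charts\<close>

lemma chartD:
  assumes "is_chart c"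
  shows "open (cdom c)" "open (cimg c)" "p \<in> cdom c \<Longrightarrow> cinv c (cmap c p) = p"
    "z \<in> cimg c \<Longrightarrow> cmap c (cinv c z) = z" "z \<in> cimg c \<Longrightarrow> cinv c z \<in> cdom c"
    "continuous_on (cdom c) (cmap c)" "continuous_on (cimg c) (cinv c)"
  using assms unfolding is_chart_def homeomorphism_def by auto

lemma chart_image_iff:
  assumes "is_chart c"
  shows "z \<in> cmap c ` (cdom c \<inter> U) \<longleftrightarrow> z \<in> cimg c \<and> cinv c z \<in> U"
  using chartD(3)[OF assms] chartD(4,5)[OF assms, of z] by force

lemma chart_open_image:
  assumes "is_chart c" "open U"
  shows "open (cmap c ` (cdom c \<inter> U))"
proof -
  have "cmap c ` (cdom c \<inter> U) = {z \<in> cimg c. cinv c z \<in> U}"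
    using chart_image_iff[OF assms(1)] by blast
  moreover have "open (cimg c \<inter> cinv c -` U)"
    using continuous_on_open_vimage[OF chartD(2)[OF assms(1)], of "cinv c"] chartD(7)[OF assms(1)] assms(2)
    by (simp add: Int_commute)
  ultimately show ?thesis by (simp add: Int_def vimage_def)
qed

text \<open>\<open>F\<close> is left general because it stands for a chart of the atlas, for the
  immersion followed by a chart of the target, and for a complex chart.\<close>

lemma chart_change_has_derivative:
  assumes c: "is_chart c" and c': "is_chart c'" and p: "p \<in> cdom c" "p \<in> cdom c'"
    and F: "(F \<circ> cinv c) differentiable at (cmap c p)"
    and t: "(cmap c \<circ> cinv c') differentiable at (cmap c' p)"
  shows "((F \<circ> cinv c') has_derivative
    (fder (F \<circ> cinv c) (cmap c p) \<circ> fder (cmap c \<circ> cinv c') (cmap c' p))) (at (cmap c' p))"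
proof -
  let ?S = "cmap c' ` (cdom c' \<inter> cdom c)"
  have S: "open ?S" "cmap c' p \<in> ?S"
    using chart_open_image[OF c' chartD(1)[OF c]] p by auto
  have tp: "(cmap c \<circ> cinv c') (cmap c' p) = cmap c p" using chartD(3)[OF c' p(2)] by simp
  have "(((F \<circ> cinv c) \<circ> (cmap c \<circ> cinv c')) has_derivative
    (fder (F \<circ> cinv c) (cmap c p) \<circ> fder (cmap c \<circ> cinv c') (cmap c' p))) (at (cmap c' p))"
    by (rule diff_chain_at) (use F t tp in \<open>simp_all add: frechet_derivative_works[symmetric]\<close>)
  moreover have "((F \<circ> cinv c) \<circ> (cmap c \<circ> cinv c')) z = (F \<circ> cinv c') z" if "z \<in> ?S" for z
    using that chartD(3)[OF c] chart_image_iff[OF c', of z "cdom c"] by auto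
  ultimately show ?thesis using has_derivative_cong_open[OF S] by blast
qed

lemma fder_chart_self:
  assumes "is_chart c" "p \<in> cdom c"
  shows "fder (cmap c \<circ> cinv c) (cmap c p) = (\<lambda>u. u)"
proof -
  have "fder (cmap c \<circ> cinv c) (cmap c p) = fder (\<lambda>z. z) (cmap c p)"
    by (rule fder_cong_open[OF chartD(2)[OF assms(1)]]) (use assms chartD(4)[OF assms(1)] in auto)
  then show ?thesis by simp
qed

locale smooth_atlas =
  fixes A :: "('a::{t2_space,second_countable_topology}, 'e::euclidean_space) chart set"
  assumes atlas: "atlas A"
begin

lemma is_chart: "c \<in> A \<Longrightarrow> is_chart c"
  using atlas by (simp add: atlas_def)

lemmas open_cimg = chartD(2)[OF is_chart]
  and cinv_cmap = chartD(3)[OF is_chart]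
  and cinv_in = chartD(5)[OF is_chart]

lemma chart_at: "chart_at A p \<in> A" "p \<in> cdom (chart_at A p)"
proof -
  have "\<exists>c. c \<in> A \<and> p \<in> cdom c" using atlas unfolding atlas_def by blast
  then have "chart_at A p \<in> A \<and> p \<in> cdom (chart_at A p)" unfolding chart_at_def by (rule someI_ex)
  then show "chart_at A p \<in> A" "p \<in> cdom (chart_at A p)" by auto
qed

lemma open_overlap: "c \<in> A \<Longrightarrow> c' \<in> A \<Longrightarrow> open (cmap c ` (cdom c \<inter> cdom c'))"
  by (intro chart_open_image is_chart chartD(1))

lemma smooth_transition:
  "c \<in> A \<Longrightarrow> c' \<in> A \<Longrightarrow> smooth_on (cmap c ` (cdom c \<inter> cdom c')) (cmap c' \<circ> cinv c)"
  using atlas by (simp add: atlas_def)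

lemma transition_differentiable:
  "c \<in> A \<Longrightarrow> c' \<in> A \<Longrightarrow> p \<in> cdom c \<Longrightarrow> p \<in> cdom c' \<Longrightarrow> (cmap c' \<circ> cinv c) differentiable at (cmap c p)"
  by (rule smooth_on_differentiable[OF smooth_transition]) auto

lemma transition_cocycle:
  assumes "c1 \<in> A" "c2 \<in> A" "c3 \<in> A" "p \<in> cdom c1" "p \<in> cdom c2" "p \<in> cdom c3"
  shows "fder (cmap c3 \<circ> cinv c1) (cmap c1 p) u
    = fder (cmap c3 \<circ> cinv c2) (cmap c2 p) (fder (cmap c2 \<circ> cinv c1) (cmap c1 p) u)"
  using fder_eqI[OF chart_change_has_derivative[OF is_chart[OF assms(2)] is_chart[OF assms(1)] assms(5,4)
      transition_differentiable[OF assms(2,3,5,6)] transition_differentiable[OF assms(1,2,4,5)]]] by simp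

lemma linear_transition:
  "c \<in> A \<Longrightarrow> c' \<in> A \<Longrightarrow> p \<in> cdom c \<Longrightarrow> p \<in> cdom c' \<Longrightarrow> linear (fder (cmap c' \<circ> cinv c) (cmap c p))"
  by (intro linear_frechet_derivative transition_differentiable)

lemma linear_to_chart: "c \<in> A \<Longrightarrow> p \<in> cdom c \<Longrightarrow> linear (to_chart A c p)"
  unfolding to_chart_def by (intro linear_transition chart_at)

lemma linear_from_chart: "c \<in> A \<Longrightarrow> p \<in> cdom c \<Longrightarrow> linear (from_chart A c p)"
  unfolding from_chart_def by (intro linear_transition chart_at)

lemma to_from_chart [simp]: "c \<in> A \<Longrightarrow> p \<in> cdom c \<Longrightarrow> to_chart A c p (from_chart A c p u) = u"
  unfolding to_chart_def from_chart_def
  by (subst transition_cocycle[symmetric]) (simp_all add: chart_at fder_chart_self is_chart)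

lemma from_to_chart [simp]: "c \<in> A \<Longrightarrow> p \<in> cdom c \<Longrightarrow> from_chart A c p (to_chart A c p u) = u"
  unfolding to_chart_def from_chart_def
  by (subst transition_cocycle[symmetric]) (simp_all add: chart_at fder_chart_self is_chart)

lemma to_chart_change:
  "c \<in> A \<Longrightarrow> c' \<in> A \<Longrightarrow> p \<in> cdom c \<Longrightarrow> p \<in> cdom c' \<Longrightarrow>
   fder (cmap c' \<circ> cinv c) (cmap c p) (to_chart A c p v) = to_chart A c' p v"
  unfolding to_chart_def by (subst transition_cocycle[symmetric]) (simp_all add: chart_at)

lemma from_chart_change:
  "c \<in> A \<Longrightarrow> c' \<in> A \<Longrightarrow> p \<in> cdom c \<Longrightarrow> p \<in> cdom c' \<Longrightarrow>
   from_chart A c' p (fder (cmap c' \<circ> cinv c) (cmap c p) u) = from_chart A c p u"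
  unfolding from_chart_def by (subst transition_cocycle[symmetric]) (simp_all add: chart_at)

lemma transition_eq: "c \<in> A \<Longrightarrow> c' \<in> A \<Longrightarrow> p \<in> cdom c \<Longrightarrow> p \<in> cdom c' \<Longrightarrow>
   fder (cmap c' \<circ> cinv c) (cmap c p) u = to_chart A c' p (from_chart A c p u)"
  using to_chart_change[of c c' p "from_chart A c p u"] by simp

lemma to_chart_at [simp]: "to_chart A (chart_at A p) p u = u"
  unfolding to_chart_def by (simp add: fder_chart_self chart_at is_chart)

lemma from_chart_at [simp]: "from_chart A (chart_at A p) p u = u"
  unfolding from_chart_def by (simp add: fder_chart_self chart_at is_chart)

lemma from_chart_eq_0_iff: "c \<in> A \<Longrightarrow> p \<in> cdom c \<Longrightarrow> from_chart A c p u = 0 \<longleftrightarrow> u = 0"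
  using to_from_chart[of c p u] linear_0[OF linear_to_chart] linear_0[OF linear_from_chart] by metis

lemma linear_form_in:
  "c \<in> A \<Longrightarrow> z \<in> cimg c \<Longrightarrow> linear (\<alpha> (cinv c z)) \<Longrightarrow> linear (form_in A c \<alpha> z)"
  unfolding form_in_def
  using linear_compose[OF linear_from_chart, of c "cinv c z" "\<alpha> (cinv c z)"] cinv_in
  by (simp add: o_def)

lemma bilinear_bil_in:
  assumes "c \<in> A" "z \<in> cimg c" "bilinear (\<sigma> (cinv c z))"
  shows "bilinear (bil_in A c \<sigma> z)"
proof -
  have "linear (from_chart A c (cinv c z))"
    by (rule linear_from_chart) (use assms cinv_in in auto)
  note r = bilinear_rules[OF assms(3)] linear_rules[OF this]
  show ?thesis unfolding bil_in_def bilinear_def by (intro conjI allI linearI) (simp_all add: r)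
qed

lemma bil_in_apply:
  "c \<in> A \<Longrightarrow> p \<in> cdom c \<Longrightarrow> bil_in A c \<sigma> (cmap c p) (to_chart A c p u) (to_chart A c p w) = \<sigma> p u w"
  using cinv_cmap by (simp add: bil_in_def)

lemma form_in_apply:
  "c \<in> A \<Longrightarrow> p \<in> cdom c \<Longrightarrow> form_in A c \<alpha> (cmap c p) (to_chart A c p u) = \<alpha> p u"
  using cinv_cmap by (simp add: form_in_def)

lemma in_chart_at:
  "bil_in A (chart_at A p) \<sigma> (cmap (chart_at A p) p) u w = \<sigma> p u w"
  "endo_in A (chart_at A p) J (cmap (chart_at A p) p) u = J p u"
  "vec_in A (chart_at A p) V (cmap (chart_at A p) p) = V p"
  by (simp_all add: bil_in_def endo_in_def vec_in_def cinv_cmap[OF chart_at])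

lemma bil_in_change:
  assumes "c \<in> A" "c' \<in> A" "z \<in> cmap c ` (cdom c \<inter> cdom c')"
  defines "t \<equiv> cmap c' \<circ> cinv c"
  shows "bil_in A c \<sigma> z u w = bil_in A c' \<sigma> (t z) (fder t z u) (fder t z w)"
proof -
  obtain p where p: "p \<in> cdom c" "p \<in> cdom c'" "z = cmap c p" using assms(3) by auto
  show ?thesis
    using p assms(1,2) by (simp add: t_def bil_in_def cinv_cmap from_chart_change)
qed

lemma form_in_change:
  assumes "c \<in> A" "c' \<in> A" "z \<in> cmap c ` (cdom c \<inter> cdom c')"
  defines "t \<equiv> cmap c' \<circ> cinv c"
  shows "form_in A c \<alpha> z u = form_in A c' \<alpha> (t z) (fder t z u)"
proof -
  obtain p where p: "p \<in> cdom c" "p \<in> cdom c'" "z = cmap c p" using assms(3) by auto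
  show ?thesis
    using p assms(1,2) by (simp add: t_def form_in_def cinv_cmap from_chart_change)
qed

text \<open>The second derivatives of the transition map cancel in the exterior derivative.\<close>

lemma ext_deriv_in_chart:
  assumes \<alpha>: "\<alpha> \<in> one_forms A" and c: "c \<in> A" "p \<in> cdom c"
  shows "ext_deriv A \<alpha> p u w =
    fder (\<lambda>z. form_in A c \<alpha> z (to_chart A c p w)) (cmap c p) (to_chart A c p u)
    - fder (\<lambda>z. form_in A c \<alpha> z (to_chart A c p u)) (cmap c p) (to_chart A c p w)"
proof -
  define c0 where "c0 = chart_at A p"
  define t where "t = cmap c \<circ> cinv c0"
  let ?S = "cmap c0 ` (cdom c0 \<inter> cdom c)" and ?z = "cmap c0 p"
  have c0: "c0 \<in> A" "p \<in> cdom c0" by (auto simp: c0_def chart_at)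
  have S: "open ?S" "?z \<in> ?S" using open_overlap[OF c0(1) c(1)] c c0 by auto
  have t: "smooth_on ?S t" unfolding t_def by (rule smooth_transition[OF c0(1) c(1)])
  have tz: "t ?z = cmap c p" using cinv_cmap[OF c0(1) c0(2)] by (simp add: t_def)
  have Dt: "fder t ?z v = to_chart A c p v" for v
    by (simp add: t_def to_chart_def c0_def)
  have *: "fder (\<lambda>z. form_in A c0 \<alpha> z w) ?z u
    = fder (\<lambda>z. form_in A c \<alpha> z (fder t ?z w)) (t ?z) (fder t ?z u) + form_in A c \<alpha> (t ?z) (sder t ?z u w)" for u w
  proof -
    have "fder (\<lambda>z. form_in A c0 \<alpha> z w) ?z u = fder (\<lambda>y. form_in A c \<alpha> (t y) (fder t y w)) ?z u"
      by (subst fder_cong_open[OF S]) (use form_in_change[OF c0(1) c(1)] in \<open>auto simp: t_def\<close>)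
    also have "\<dots> = fder (\<lambda>z. form_in A c \<alpha> z (fder t ?z w)) (t ?z) (fder t ?z u)
        + form_in A c \<alpha> (t ?z) (sder t ?z u w)"
    proof (subst fder_eqI[OF has_derivative_linear_family_comp[where L = "form_in A c \<alpha>" and t = t and T = "cimg c", OF S]])
      show "t y \<in> cimg c" if "y \<in> ?S" for y
        using that by (auto simp: t_def cinv_cmap[OF c0(1)])
      show "(t has_derivative fder t ?z) (at ?z)" by (rule smooth_on_has_derivative[OF t S(2)])
      show "linear (form_in A c \<alpha> y)" if "y \<in> cimg c" for y
        using that \<alpha> by (intro linear_form_in[OF c(1)]) (auto simp: one_forms_def)
      show "(\<lambda>y. form_in A c \<alpha> y i) differentiable at (t ?z)" for i
        using \<alpha> c unfolding tz by (intro smooth_on_differentiable[of "cimg c"]) (auto simp: one_forms_def)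
      show "((\<lambda>y. fder t y w) has_derivative (\<lambda>v. sder t ?z v w)) (at ?z)"
        by (rule smooth_on_has_derivative[OF smooth_on_fder[OF t] S(2)])
    qed simp
    finally show ?thesis .
  qed
  show ?thesis
    using *[of w u] *[of u w] symmetric_second_derivative[OF S t, of u w]
    unfolding ext_deriv_def Let_def c0_def[symmetric] tz Dt by simp
qed

end

section \<open>Immersed surfaces in charts\<close>

lemma inner_form_pullback:
  assumes "inner_form b" "linear L" "\<And>u. L u = 0 \<Longrightarrow> u = 0"
  shows "inner_form (\<lambda>u w. b (L u) (L w))"
proof -
  note r = bilinear_rules[OF inner_formD(1)[OF assms(1)]] linear_rules[OF assms(2)]
  have "bilinear (\<lambda>u w. b (L u) (L w))"
    unfolding bilinear_def by (intro conjI allI linearI) (simp_all add: r)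
  moreover have "b (L u) (L w) = b (L w) (L u)" for u w by (rule inner_formD(2)[OF assms(1)])
  moreover have "0 < b (L u) (L u)" if "u \<noteq> 0" for u
    using inner_formD(3)[OF assms(1), of "L u"] assms(3) that by blast
  ultimately show ?thesis by (auto simp: inner_form_def)
qed

lemma det2_linear:
  assumes "linear L"
  shows "det2 (L a) (L b) = det (matrix L) * det2 a b"
proof -
  have L: "L v $ k = v $ 1 * L e1 $ k + v $ 2 * L e2 $ k" for v k
    using arg_cong[OF plane_expand[of v], of L] by (simp add: linear_rules[OF assms])
  show ?thesis
    unfolding det2_def det_2 matrix_def L[of a 1] L[of a 2] L[of b 1] L[of b 2] by (simp add: algebra_simps)
qed

locale immersed_surface = S: smooth_atlas A + M: smooth_atlas B
  for A :: "('s::{t2_space,second_countable_topology}, real^2) chart set"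
    and B :: "('m::{t2_space,second_countable_topology}, 'f::euclidean_space) chart set" +
  fixes g :: "'m \<Rightarrow> 'f \<Rightarrow> 'f \<Rightarrow> real" and x :: "'s \<Rightarrow> 'm"
  assumes oriented: "oriented_atlas A" and metric: "riemannian_metric B g" and immersion: "immersion A B x"
begin

abbreviation W where "W c d \<equiv> cmap c ` (cdom c \<inter> x -` cdom d)"
abbreviation X where "X c d \<equiv> cmap d \<circ> x \<circ> cinv c"
abbreviation gd where "gd d \<equiv> bil_in B d g"
abbreviation I where "I \<equiv> induced_metric A B g x"
abbreviation dx where "dx \<equiv> differential A B x"
abbreviation J where "J \<equiv> complex_structure A B g x"
abbreviation normal where "normal \<equiv> normal_vector A B g x"
abbreviation tanp where "tanp \<equiv> tan_part A B g x"
abbreviation norp where "norp \<equiv> nor_part A B g x"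
abbreviation secs where "secs \<equiv> sections A B x"
abbreviation Ic where "Ic c \<equiv> bil_in A c I"
abbreviation Jc where "Jc c \<equiv> endo_in A c J"
abbreviation shape where "shape \<equiv> shape_operator A B g x"

subsection \<open>The immersion\<close>

lemma open_preimage: "d \<in> B \<Longrightarrow> open (x -` cdom d)"
  using immersion chartD(1)[OF M.is_chart] unfolding immersion_def smooth_map_def
  by (simp add: continuous_on_open_vimage)

lemma open_W: "c \<in> A \<Longrightarrow> d \<in> B \<Longrightarrow> open (W c d)"
  by (intro chart_open_image S.is_chart open_preimage)

lemma smooth_X: "c \<in> A \<Longrightarrow> d \<in> B \<Longrightarrow> smooth_on (W c d) (X c d)"
  using immersion unfolding immersion_def smooth_map_def by blast

lemma W_I: "p \<in> cdom c \<Longrightarrow> x p \<in> cdom d \<Longrightarrow> cmap c p \<in> W c d"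
  by auto

lemma W_E:
  assumes "z \<in> W c d" "c \<in> A"
  obtains p where "p \<in> cdom c" "x p \<in> cdom d" "z = cmap c p" "cinv c z = p"
  using assms S.cinv_cmap by auto

lemma X_apply: "c \<in> A \<Longrightarrow> p \<in> cdom c \<Longrightarrow> X c d (cmap c p) = cmap d (x p)"
  by (simp add: S.cinv_cmap)

lemma X_in_cimg: "c \<in> A \<Longrightarrow> z \<in> W c d \<Longrightarrow> X c d z \<in> cimg d"
  by (erule W_E) auto

lemma W_subset: "W c d \<subseteq> cimg c"
  by auto

text \<open>The sets \<open>W c d\<close> are open and cover the image of \<open>c\<close>, since
  the image under \<open>x\<close> of every point lies in some chart of the target.\<close>

lemma smooth_on_cimg:
  assumes "c \<in> A" "\<And>d. d \<in> B \<Longrightarrow> smooth_on (W c d) F"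
  shows "smooth_on (cimg c) F"
proof (rule smooth_on_local)
  fix z assume "z \<in> cimg c"
  then obtain p where "p \<in> cdom c" "z = cmap c p" by auto
  then have "z \<in> W c (chart_at B (x p))" using M.chart_at by blast
  then show "\<exists>U. open U \<and> z \<in> U \<and> smooth_on U F"
    using open_W[OF assms(1) M.chart_at(1)] assms(2)[OF M.chart_at(1)] by blast
qed

lemma smooth_DX: "c \<in> A \<Longrightarrow> d \<in> B \<Longrightarrow> smooth_on (W c d) (\<lambda>z. fder (X c d) z u)"
  by (intro smooth_on_fder smooth_X)

lemma linear_DX: "c \<in> A \<Longrightarrow> d \<in> B \<Longrightarrow> z \<in> W c d \<Longrightarrow> linear (fder (X c d) z)"
  by (rule smooth_on_linear_fder[OF smooth_X])

lemma X_target: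
  assumes "c \<in> A" "d \<in> B" "z \<in> W c d"
  shows "X c d' z = (cmap d' \<circ> cinv d) (X c d z)"
proof -
  obtain p where "p \<in> cdom c" "x p \<in> cdom d" "z = cmap c p" "cinv c z = p" using W_E[OF assms(3,1)] .
  then show ?thesis by (simp add: M.cinv_cmap[OF assms(2)])
qed

lemma X_source:
  assumes "c \<in> A" "c' \<in> A" "z \<in> cmap c ` (cdom c \<inter> cdom c')"
  shows "X c d z = X c' d ((cmap c' \<circ> cinv c) z)"
  using assms by (auto simp: S.cinv_cmap)

text \<open>\<open>dx\<close> is defined through preferred charts at both ends. The source chart is
  replaced by the chain rule with a transition on the right, the target chart by one with a
  transition on the left.\<close>

lemma to_chart_dx:
  assumes "c \<in> A" "d \<in> B" "p \<in> cdom c" "x p \<in> cdom d"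
  shows "to_chart B d (x p) (dx p u) = fder (X c d) (cmap c p) (to_chart A c p u)"
proof -
  define c0 d0 where "c0 = chart_at A p" and "d0 = chart_at B (x p)"
  have c0: "c0 \<in> A" "p \<in> cdom c0" and d0: "d0 \<in> B" "x p \<in> cdom d0"
    by (auto simp: c0_def d0_def S.chart_at M.chart_at)
  have diff: "X c d' differentiable at (cmap c p)" if "d' \<in> B" "x p \<in> cdom d'" for d'
    by (rule smooth_on_differentiable[OF smooth_X[OF assms(1) that(1)] W_I[OF assms(3) that(2)]])
  have source: "dx p u = fder (X c d0) (cmap c p) (to_chart A c p u)"
    using fder_eqI[OF chart_change_has_derivative[OF S.is_chart[OF assms(1)] S.is_chart[OF c0(1)] assms(3) c0(2)
        diff[OF d0] S.transition_differentiable[OF c0(1) assms(1) c0(2) assms(3)]]]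
    by (simp add: differential_def to_chart_def c0_def d0_def)
  have "fder (X c d) (cmap c p) = fder (\<lambda>z. (cmap d \<circ> cinv d0) (X c d0 z)) (cmap c p)"
    by (rule fder_cong_open[OF open_W[OF assms(1) d0(1)] W_I[OF assms(3) d0(2)]])
      (rule X_target[OF assms(1) d0(1)])
  also have "\<dots> = (\<lambda>v. to_chart B d (x p) (fder (X c d0) (cmap c p) v))"
  proof (rule fder_eqI)
    have Xp: "X c d0 (cmap c p) = cmap d0 (x p)" by (rule X_apply[OF assms(1,3)])
    have "((cmap d \<circ> cinv d0) has_derivative to_chart B d (x p)) (at (X c d0 (cmap c p)))"
      using M.transition_differentiable[OF d0(1) assms(2) d0(2) assms(4)]
      unfolding Xp to_chart_def d0_def[symmetric] by (simp add: frechet_derivative_works[symmetric])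
    then show "((\<lambda>z. (cmap d \<circ> cinv d0) (X c d0 z)) has_derivative
        (\<lambda>v. to_chart B d (x p) (fder (X c d0) (cmap c p) v))) (at (cmap c p))"
      using has_derivative_compose[of "X c d0" _ "cmap c p" UNIV "cmap d \<circ> cinv d0"] diff[OF d0]
        frechet_derivative_works by blast
  qed
  finally show ?thesis by (simp add: source)
qed

lemma linear_dx: "linear (dx p)"
proof -
  let ?c = "chart_at A p" and ?d = "chart_at B (x p)"
  have "dx p = fder (X ?c ?d) (cmap ?c p)"
    by (rule ext) (simp add: differential_def)
  then show ?thesis using linear_DX[OF S.chart_at(1) M.chart_at(1) W_I[OF S.chart_at(2) M.chart_at(2)]] by simp
qed

lemma dx_eq_0: "dx p u = 0 \<Longrightarrow> u = 0"
  using immersion linear_injective_0[OF linear_dx] unfolding immersion_def by blast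

subsection \<open>The induced metric and its rotation\<close>

lemma g_inner: "inner_form (g y)"
  using metric by (auto simp: riemannian_metric_def two_tensors_def inner_form_def)

lemmas gl = bilinear_rules[OF inner_formD(1)[OF g_inner], simplified real_scaleR_def]
lemmas g_sym = inner_formD(2)[OF g_inner]

lemma gd_sym: "gd d z u w = gd d z w u"
  unfolding bil_in_def by (rule g_sym)

lemma gd_bilinear: "d \<in> B \<Longrightarrow> z \<in> cimg d \<Longrightarrow> bilinear (gd d z)"
  by (rule M.bilinear_bil_in) (auto intro: inner_formD(1) g_inner)

lemma gd_smooth: "d \<in> B \<Longrightarrow> smooth_on (cimg d) (\<lambda>z. gd d z u w)"
  using metric by (auto simp: riemannian_metric_def two_tensors_def)

lemma I_inner: "inner_form (I p)"
  unfolding induced_metric_def[abs_def] by (rule inner_form_pullback[OF g_inner linear_dx dx_eq_0])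

lemma I_in_inner: "c \<in> A \<Longrightarrow> z \<in> cimg c \<Longrightarrow> inner_form (Ic c z)"
  unfolding bil_in_def[abs_def]
  by (rule inner_form_pullback[OF I_inner S.linear_from_chart])
    (auto simp: S.from_chart_eq_0_iff S.cinv_in S.cinv_cmap)

lemma I_in_eq:
  assumes "c \<in> A" "d \<in> B" "z \<in> W c d"
  shows "Ic c z u w = gd d (X c d z) (fder (X c d) z u) (fder (X c d) z w)"
proof -
  obtain p where p: "p \<in> cdom c" "x p \<in> cdom d" "z = cmap c p" "cinv c z = p" using W_E[OF assms(3,1)] .
  have "fder (X c d) z v = to_chart B d (x p) (dx p (from_chart A c p v))" for v
    using to_chart_dx[OF assms(1,2) p(1,2), of "from_chart A c p v"] p assms(1) by simp
  then show ?thesis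
    using p assms by (simp add: bil_in_def induced_metric_def M.cinv_cmap)
qed

lemma smooth_gd_X:
  assumes "c \<in> A" "d \<in> B" "smooth_on (W c d) a" "smooth_on (W c d) b"
  shows "smooth_on (W c d) (\<lambda>z. gd d (X c d z) (a z) (b z))"
proof (rule smooth_on_bilinear_family[where B = "\<lambda>z. gd d (X c d z)", OF open_W[OF assms(1,2)] _ _ assms(3,4)])
  show "bilinear (gd d (X c d z))" if "z \<in> W c d" for z
    by (intro gd_bilinear assms(2) X_in_cimg[OF assms(1) that])
  show "smooth_on (W c d) (\<lambda>z. gd d (X c d z) i j)" for i j
    by (rule smooth_on_compose[OF open_W[OF assms(1,2)] M.open_cimg[OF assms(2)]
          gd_smooth[OF assms(2)] smooth_X[OF assms(1,2)] X_in_cimg[OF assms(1)]])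
qed

lemma I_in_smooth_W: "c \<in> A \<Longrightarrow> d \<in> B \<Longrightarrow> smooth_on (W c d) (\<lambda>z. Ic c z u w)"
  using smooth_gd_X[OF _ _ smooth_DX smooth_DX, of c d u w]
  by (subst smooth_on_cong[OF open_W]) (auto simp: I_in_eq)

lemma I_in_smooth: "c \<in> A \<Longrightarrow> smooth_on (cimg c) (\<lambda>z. Ic c z u w)"
  by (intro smooth_on_cimg I_in_smooth_W)

text \<open>The explicit rotation and its uniqueness make the definite description in
  \<open>complex_structure\<close> meaningful.\<close>

lemma rotation_I: "rotation_plane (I p) (J p)"
proof -
  let ?K = "rotation_of (I p)"
  interpret K: rotation_plane "I p" ?K
    by unfold_locales (intro I_inner, rule is_rotation_rotation_of[OF I_inner])
  have "J p = ?K"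
    unfolding complex_structure_def by (rule the_equality) (auto intro: K.J K.rotation_unique)
  then show ?thesis by (simp add: K.rotation_plane_axioms)
qed

lemma to_chart_det_pos:
  assumes "c \<in> A" "p \<in> cdom c"
  shows "0 < det (matrix (to_chart A c p))"
  using oriented assms S.chart_at[of p] unfolding oriented_atlas_def to_chart_def by blast

text \<open>Metric and rotation are transported by the same isomorphism, so the algebraic conditions
  carry over. Positivity of \<open>det2\<close> carries over because transition maps of an oriented
  atlas have positive determinant.\<close>

lemma rotation_in:
  assumes c: "c \<in> A" and z: "z \<in> cimg c"
  shows "rotation_plane (Ic c z) (Jc c z)"
proof
  show "inner_form (Ic c z)" by (rule I_in_inner[OF c z])
  define p where "p = cinv c z"
  have p: "p \<in> cdom c" using S.cinv_in[OF c z] by (simp add: p_def)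
  interpret rotation_plane "I p" "J p" by (rule rotation_I)
  note l = linear_rules[OF S.linear_to_chart[OF c p]] linear_rules[OF S.linear_from_chart[OF c p]]
  show "is_rotation (Ic c z) (Jc c z)"
    unfolding is_rotation_def det2_eq_det
  proof (intro conjI allI impI)
    show "linear (Jc c z)"
      by (rule linearI) (simp_all add: endo_in_def p_def[symmetric] l Jl)
    fix u
    show "Ic c z u (Jc c z u) = 0"
      "Ic c z (Jc c z u) (Jc c z u) = Ic c z u u"
      using c p by (simp_all add: bil_in_def endo_in_def p_def[symmetric] J_perp J_isometry)
    assume "u \<noteq> 0"
    then have "from_chart A c p u \<noteq> 0" using S.from_chart_eq_0_iff[OF c p] by simp
    then have "0 < det2 (from_chart A c p u) (J p (from_chart A c p u))" by (rule det2_J_pos)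
    then have "0 < det2 (to_chart A c p (from_chart A c p u)) (to_chart A c p (J p (from_chart A c p u)))"
      using to_chart_det_pos[OF c p] by (simp add: det2_linear[OF S.linear_to_chart[OF c p]])
    then show "0 < det2 u (Jc c z u)"
      using c p by (simp add: endo_in_def p_def[symmetric])
  qed
qed

text \<open>Pairing \<open>Jc c z u\<close> with \<open>w\<close> gives the area form, a smooth
  expression in the metric coefficients, and solving for the vector preserves smoothness.\<close>

lemma J_in_smooth:
  assumes c: "c \<in> A"
  shows "smooth_on (cimg c) (\<lambda>z. Jc c z u)"
proof (rule smooth_on_solve[where b = "Ic c", OF S.open_cimg[OF c] I_in_inner[OF c] I_in_smooth[OF c]])
  fix w
  let ?b = "Ic c"
  have o: "open (cimg c)" by (rule S.open_cimg[OF c])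
  have "smooth_on (cimg c) (\<lambda>z. sqrt (?b z e1 e1 * ?b z e2 e2 - ?b z e1 e2 * ?b z e2 e1) * det2 u w)"
    by (intro smooth_on_mult smooth_on_sqrt smooth_on_diff smooth_on_const I_in_smooth[OF c] o)
      (use gram_pos[OF I_in_inner[OF c]] in simp)
  then show "smooth_on (cimg c) (\<lambda>z. ?b z (Jc c z u) w)"
    by (subst smooth_on_cong[OF o]) (auto simp: rotation_plane.b_J_eq_det2[OF rotation_in[OF c]])
qed

subsection \<open>Tangential and normal parts\<close>

lemma normal_iff: "normal p (V - dx p u) \<longleftrightarrow> (\<forall>w. I p u w = g (x p) V (dx p w))"
  unfolding normal_vector_def induced_metric_def by (auto simp: gl)

lemma tan_part_ex1: "\<exists>!u. \<forall>w. I p u w = g (x p) v (dx p w)"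
  by (rule inner_form_represents[OF I_inner]) (rule linearI; simp add: gl linear_rules[OF linear_dx])

lemma tan_part_eq: "I p (tanp V p) w = g (x p) (V p) (dx p w)"
  using theI'[OF tan_part_ex1[of p "V p"]] unfolding tan_part_def normal_iff by blast

lemma tan_part_unique: "(\<And>w. I p u w = g (x p) (V p) (dx p w)) \<Longrightarrow> tanp V p = u"
  by (rule inner_form_eqI[OF I_inner[of p]]) (simp add: tan_part_eq)

lemma tan_part_combine:
  "tanp (\<lambda>p. f p *\<^sub>R V p + h p *\<^sub>R V' p) p = f p *\<^sub>R tanp V p + h p *\<^sub>R tanp V' p"
  by (rule tan_part_unique)
    (simp add: gl tan_part_eq bilinear_rules[OF inner_formD(1)[OF I_inner]])

lemma nor_part_normal: "normal p (norp V p)"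
  unfolding nor_part_def normal_iff by (simp add: tan_part_eq)

lemma nor_part_combine:
  "norp (\<lambda>p. f p *\<^sub>R V p + h p *\<^sub>R V' p) p = f p *\<^sub>R norp V p + h p *\<^sub>R norp V' p"
  by (simp add: nor_part_def tan_part_combine linear_rules[OF linear_dx] algebra_simps)

lemma tan_part_of_normal: "normal p (V p) \<Longrightarrow> tanp V p = 0"
  by (rule tan_part_unique) (simp add: normal_vector_def bilinear_rules[OF inner_formD(1)[OF I_inner]])

lemma nor_part_of_normal: "normal p (V p) \<Longrightarrow> norp V p = V p"
  by (simp add: nor_part_def tan_part_of_normal linear_rules[OF linear_dx])

definition sec_in :: "('s, real^2) chart \<Rightarrow> ('m, 'f) chart \<Rightarrow> ('s \<Rightarrow> 'f) \<Rightarrow> real^2 \<Rightarrow> 'f" where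
  "sec_in c d V z = to_chart B d (x (cinv c z)) (V (cinv c z))"

lemma sec_in_smooth: "V \<in> secs \<Longrightarrow> c \<in> A \<Longrightarrow> d \<in> B \<Longrightarrow> smooth_on (W c d) (sec_in c d V)"
  by (simp add: sections_def sec_in_def[abs_def])

lemma sec_in_apply: "c \<in> A \<Longrightarrow> p \<in> cdom c \<Longrightarrow> sec_in c d V (cmap c p) = to_chart B d (x p) (V p)"
  by (simp add: sec_in_def S.cinv_cmap)

lemma g_in_chart:
  "d \<in> B \<Longrightarrow> y \<in> cdom d \<Longrightarrow> gd d (cmap d y) (to_chart B d y u) (to_chart B d y w) = g y u w"
  by (rule M.bil_in_apply)

lemma tan_in_eq:
  assumes "c \<in> A" "d \<in> B" "z \<in> W c d"
  shows "Ic c z (vec_in A c (tanp V) z) w = gd d (X c d z) (sec_in c d V z) (fder (X c d) z w)"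
proof -
  obtain p where p: "p \<in> cdom c" "x p \<in> cdom d" "z = cmap c p" "cinv c z = p" using W_E[OF assms(3,1)] .
  have "Ic c z (vec_in A c (tanp V) z) w = I p (tanp V p) (from_chart A c p w)"
    using p assms(1) by (simp add: bil_in_def vec_in_def)
  also have "\<dots> = g (x p) (V p) (dx p (from_chart A c p w))" by (rule tan_part_eq)
  also have "\<dots> = gd d (cmap d (x p)) (to_chart B d (x p) (V p)) (to_chart B d (x p) (dx p (from_chart A c p w)))"
    by (rule g_in_chart[symmetric]) (use assms p in auto)
  finally show ?thesis
    using p assms by (simp add: to_chart_dx[OF assms(1,2) p(1,2)] X_apply sec_in_apply S.cinv_cmap)
qed

lemma tan_in_smooth:
  assumes "V \<in> secs" "c \<in> A"
  shows "smooth_on (cimg c) (vec_in A c (tanp V))"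
proof (rule smooth_on_cimg[OF assms(2)])
  fix d assume d: "d \<in> B"
  show "smooth_on (W c d) (vec_in A c (tanp V))"
  proof (rule smooth_on_solve[where b = "Ic c", OF open_W[OF assms(2) d] _ I_in_smooth_W[OF assms(2) d]])
    show "inner_form (Ic c z)" if "z \<in> W c d" for z
      by (rule I_in_inner[OF assms(2)]) (use that in auto)
    show "smooth_on (W c d) (\<lambda>z. Ic c z (vec_in A c (tanp V) z) w)" for w
      using smooth_gd_X[OF assms(2) d sec_in_smooth[OF assms d] smooth_DX[OF assms(2) d]]
      by (subst smooth_on_cong[OF open_W[OF assms(2) d]]) (auto simp: tan_in_eq[OF assms(2) d])
  qed
qed

lemma nor_in_eq:
  assumes "c \<in> A" "d \<in> B" "z \<in> W c d"
  shows "sec_in c d (norp V) z = sec_in c d V z - fder (X c d) z (vec_in A c (tanp V) z)"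
proof -
  obtain p where p: "p \<in> cdom c" "x p \<in> cdom d" "z = cmap c p" "cinv c z = p" using W_E[OF assms(3,1)] .
  show ?thesis
    using to_chart_dx[OF assms(1,2) p(1,2), of "tanp V p"] p assms
    by (simp add: sec_in_def vec_in_def nor_part_def linear_rules[OF M.linear_to_chart[OF assms(2) p(2)]])
qed

lemma nor_in_smooth:
  assumes "V \<in> secs" "c \<in> A" "d \<in> B"
  shows "smooth_on (W c d) (sec_in c d (norp V))"
proof -
  have "smooth_on (W c d) (vec_in A c (tanp V))"
    by (rule smooth_on_subset[OF tan_in_smooth[OF assms(1,2)] W_subset])
  then have "smooth_on (W c d) (\<lambda>z. fder (X c d) z (vec_in A c (tanp V) z))"
    using smooth_on_linear_family[where L = "\<lambda>z. fder (X c d) z" and S = "W c d"]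
      open_W[OF assms(2,3)] linear_DX[OF assms(2,3)] smooth_DX[OF assms(2,3)] by blast
  then have "smooth_on (W c d) (\<lambda>z. sec_in c d V z - fder (X c d) z (vec_in A c (tanp V) z))"
    by (intro smooth_on_diff open_W sec_in_smooth assms)
  then show ?thesis
    by (subst smooth_on_cong[OF open_W[OF assms(2,3)]]) (auto simp: nor_in_eq[OF assms(2,3)])
qed

lemma nor_in_normal:
  assumes "c \<in> A" "d \<in> B" "z \<in> W c d"
  shows "gd d (X c d z) (sec_in c d (norp V) z) (fder (X c d) z w) = 0"
proof -
  note l = bilinear_rules[OF gd_bilinear[OF assms(2) X_in_cimg[OF assms(1,3)]]]
  show ?thesis
    using tan_in_eq[OF assms, of V w] unfolding nor_in_eq[OF assms] l I_in_eq[OF assms] by simp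
qed

subsection \<open>The second fundamental form\<close>

text \<open>In coordinates \<open>sff\<close> is \<open>g (\<nabla>\<^sub>u (dx w), n)\<close> without the projection of \<open>\<nabla>\<^sub>u (dx w)\<close> to the normal
  bundle, so it is a tensor only for normal \<open>n\<close>.\<close>

definition sff :: "('s, real^2) chart \<Rightarrow> ('m, 'f) chart \<Rightarrow> real^2 \<Rightarrow> real^2 \<Rightarrow> real^2 \<Rightarrow> 'f \<Rightarrow> real" where
  "sff c d z u w n = gd d (X c d z) (sder (X c d) z u w) n
     + koszul (gd d) (X c d z) (fder (X c d) z u) (fder (X c d) z w) n"

definition sff_at :: "'s \<Rightarrow> real^2 \<Rightarrow> real^2 \<Rightarrow> 'f \<Rightarrow> real" where
  "sff_at p = sff (chart_at A p) (chart_at B (x p)) (cmap (chart_at A p) p)"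

lemma koszul_sym: "koszul (gd d) y a b c = koszul (gd d) y b a c"
  by (simp add: koszul_def gd_sym[of d _ a b])

lemma gd_koszul_linear:
  assumes "d \<in> B" "y \<in> cimg d"
  shows "linear (koszul (gd d) y a b)" "linear (\<lambda>b. koszul (gd d) y a b c)" "linear (\<lambda>a. koszul (gd d) y a b c)"
  using koszul_linear[OF M.open_cimg[OF assms(1)] assms(2) gd_bilinear[OF assms(1)] gd_smooth[OF assms(1)]]
  by blast+

lemma sff_sym:
  assumes "c \<in> A" "d \<in> B" "z \<in> W c d"
  shows "sff c d z u w n = sff c d z w u n"
  unfolding sff_def
  using symmetric_second_derivative[OF open_W[OF assms(1,2)] assms(3) smooth_X[OF assms(1,2)], of u w]
  by (simp add: koszul_sym[of d _ "fder _ _ u"])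

lemma linear_sder:
  assumes "c \<in> A" "d \<in> B" "z \<in> W c d"
  shows "linear (sder (X c d) z u)"
  by (rule linear_fder_family[where L = "fder (X c d)", OF open_W[OF assms(1,2)] assms(3) linear_DX[OF assms(1,2)]])
    (auto intro: smooth_on_differentiable[OF smooth_DX[OF assms(1,2)] assms(3)])

lemma sff_linear:
  assumes "c \<in> A" "d \<in> B" "z \<in> W c d"
  shows "linear (sff c d z u w)" "linear (\<lambda>w. sff c d z u w n)" "linear (\<lambda>u. sff c d z u w n)"
proof -
  have Xz: "X c d z \<in> cimg d" by (rule X_in_cimg[OF assms(1,3)])
  note l = bilinear_rules[OF gd_bilinear[OF assms(2) Xz]]
    linear_rules[OF gd_koszul_linear(1)[OF assms(2) Xz]]
    linear_rules[OF gd_koszul_linear(2)[OF assms(2) Xz]] linear_rules[OF linear_sder[OF assms]]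
    linear_rules[OF linear_DX[OF assms]]
  show "linear (sff c d z u w)" for u w
    unfolding sff_def by (rule linearI; unfold l; simp add: algebra_simps)
  show 2: "linear (\<lambda>w. sff c d z u w n)" for u
    unfolding sff_def by (rule linearI; unfold l; simp add: algebra_simps)
  show "linear (\<lambda>u. sff c d z u w n)"
    unfolding sff_sym[OF assms, of _ w] by (rule 2)
qed

text \<open>Constant arguments come first; then the three slots are filled with smooth fields one at
  a time, each by linearity in that slot.\<close>

lemma koszul_X_smooth:
  assumes "c \<in> A" "d \<in> B" "smooth_on (W c d) a" "smooth_on (W c d) b" "smooth_on (W c d) n"
  shows "smooth_on (W c d) (\<lambda>z. koszul (gd d) (X c d z) (a z) (b z) (n z))"
proof -
  note W = open_W[OF assms(1,2)]
  note lin = gd_koszul_linear[OF assms(2) X_in_cimg[OF assms(1)]]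
  have o: "open (cimg d)" by (rule M.open_cimg[OF assms(2)])
  have "smooth_on (cimg d) (\<lambda>y. koszul (gd d) y i j k)" for i j k
    unfolding koszul_def divide_inverse
    by (intro smooth_on_mult smooth_on_diff smooth_on_add smooth_on_const smooth_on_fder gd_smooth assms(2) o)
  then have 0: "smooth_on (W c d) (\<lambda>z. koszul (gd d) (X c d z) i j k)" for i j k
    by (rule smooth_on_compose[OF W o _ smooth_X[OF assms(1,2)] X_in_cimg[OF assms(1)]])
  have 1: "smooth_on (W c d) (\<lambda>z. koszul (gd d) (X c d z) i j (n z))" for i j
    by (rule smooth_on_linear_family[where L = "\<lambda>z. koszul (gd d) (X c d z) i j", OF W lin(1) 0 assms(5)])
  have 2: "smooth_on (W c d) (\<lambda>z. koszul (gd d) (X c d z) i (b z) (n z))" for i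
    by (rule smooth_on_linear_family[where L = "\<lambda>z j. koszul (gd d) (X c d z) i j (n z)", OF W lin(2) 1 assms(4)])
  show ?thesis
    by (rule smooth_on_linear_family[where L = "\<lambda>z i. koszul (gd d) (X c d z) i (b z) (n z)", OF W lin(3) 2 assms(3)])
qed

lemma sff_smooth:
  assumes "c \<in> A" "d \<in> B" "smooth_on (W c d) n"
  shows "smooth_on (W c d) (\<lambda>z. sff c d z u w (n z))"
  unfolding sff_def
  by (intro smooth_on_add open_W smooth_gd_X koszul_X_smooth smooth_on_fder smooth_X assms)

text \<open>A change of the source chart adds the image under the differential of \<open>x\<close>
  of a second derivative of \<open>t\<close>. That vector is tangential, so the normal vector
  \<open>n\<close> annihilates it.\<close>

lemma sff_source:
  assumes "c \<in> A" "c' \<in> A" "d \<in> B" "p \<in> cdom c" "p \<in> cdom c'" "x p \<in> cdom d"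
  defines "t \<equiv> cmap c' \<circ> cinv c"
  assumes n: "\<And>v. gd d (cmap d (x p)) (fder (X c' d) (cmap c' p) v) n = 0"
  shows "sff c d (cmap c p) u w n = sff c' d (cmap c' p) (fder t (cmap c p) u) (fder t (cmap c p) w) n"
proof -
  let ?S = "cmap c ` (cdom c \<inter> (x -` cdom d \<inter> cdom c'))" and ?z = "cmap c p"
  have S: "open ?S" "?z \<in> ?S"
    using assms by (auto intro!: chart_open_image S.is_chart open_Int open_preimage chartD(1))
  have t: "smooth_on ?S t"
    unfolding t_def by (rule smooth_on_subset[OF S.smooth_transition[OF assms(1,2)]]) auto
  have tS: "t y \<in> W c' d" if "y \<in> ?S" for y
    using that by (auto simp: t_def S.cinv_cmap[OF assms(1)])
  have tz: "t ?z = cmap c' p" using assms by (simp add: t_def S.cinv_cmap[OF assms(1)])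
  have eq: "X c d y = X c' d (t y)" if "y \<in> ?S" for y
    unfolding t_def by (rule X_source[OF assms(1,2)]) (use that in auto)
  note X' = smooth_X[OF assms(2,3)]
  have D: "fder (X c d) y v = fder (X c' d) (t y) (fder t y v)" if "y \<in> ?S" for y v
  proof -
    have "fder (X c d) y = fder (\<lambda>y. X c' d (t y)) y" by (rule fder_cong_open[OF S(1) that eq])
    then show ?thesis by (simp only: fder_compose[OF t that X' tS[OF that]])
  qed
  have D2: "sder (X c d) ?z u w
      = sder (X c' d) (t ?z) (fder t ?z u) (fder t ?z w) + fder (X c' d) (t ?z) (sder t ?z u w)"
  proof -
    have "sder (X c d) ?z u w = sder (\<lambda>y. X c' d (t y)) ?z u w"
      by (rule arg_cong[where f = "\<lambda>f. f u"], rule fder_cong_open[OF S], rule arg_cong[where f = "\<lambda>f. f w"])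
        (rule fder_cong_open[OF S(1) _ eq])
    then show ?thesis by (simp only: sder_compose[OF S t X' tS])
  qed
  have Xz: "X c d ?z = cmap d (x p)" "X c' d (cmap c' p) = cmap d (x p)"
    using X_apply assms(1,2,4,5) by blast+
  have l: "bilinear (gd d (cmap d (x p)))" by (rule gd_bilinear) (use assms in auto)
  show ?thesis
    unfolding sff_def Xz D[OF S(2)] D2 unfolding tz by (simp add: bilinear_rules[OF l] n)
qed

text \<open>The second derivative of \<open>s\<close> that the chain rule adds to the Hessian of
  \<open>X\<close> is exactly the inhomogeneous term by which the Christoffel symbols change. The
  two compensate for every \<open>n\<close>.\<close>

lemma sff_target:
  assumes "c \<in> A" "d \<in> B" "d' \<in> B" "p \<in> cdom c" "x p \<in> cdom d" "x p \<in> cdom d'"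
  defines "s \<equiv> cmap d' \<circ> cinv d"
  shows "sff c d (cmap c p) u w n = sff c d' (cmap c p) u w (fder s (cmap d (x p)) n)"
proof -
  let ?S = "cmap c ` (cdom c \<inter> (x -` cdom d \<inter> x -` cdom d'))" and ?z = "cmap c p"
  let ?T = "cmap d ` (cdom d \<inter> cdom d')" and ?y = "cmap d (x p)"
  have S: "open ?S" "?z \<in> ?S"
    using assms by (auto intro!: chart_open_image S.is_chart open_Int open_preimage)
  have T: "open ?T" "?y \<in> ?T"
    using assms by (auto intro: M.open_overlap)
  have s: "smooth_on ?T s"
    unfolding s_def by (rule M.smooth_transition[OF assms(2,3)])
  have Xz: "X c d ?z = ?y" "X c d' ?z = cmap d' (x p)"
    using X_apply assms(1,4) by blast+
  have sy: "s ?y = cmap d' (x p)" using assms by (simp add: s_def M.cinv_cmap[OF assms(2)])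
  have XS: "smooth_on ?S (X c d)" by (rule smooth_on_subset[OF smooth_X[OF assms(1,2)]]) auto
  have XT: "X c d y \<in> ?T" if "y \<in> ?S" for y
    using that by (auto simp: S.cinv_cmap[OF assms(1)])
  have eq: "X c d' y = s (X c d y)" if "y \<in> ?S" for y
    unfolding s_def by (rule X_target[OF assms(1,2)]) (use that in auto)
  have D: "fder (X c d') y v = fder s (X c d y) (fder (X c d) y v)" if "y \<in> ?S" for y v
  proof -
    have "fder (X c d') y = fder (\<lambda>y. s (X c d y)) y" by (rule fder_cong_open[OF S(1) that eq])
    then show ?thesis by (simp only: fder_compose[OF XS that s XT[OF that]])
  qed
  have D2: "sder (X c d') ?z u w
      = sder s (X c d ?z) (fder (X c d) ?z u) (fder (X c d) ?z w) + fder s (X c d ?z) (sder (X c d) ?z u w)"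
  proof -
    have "sder (X c d') ?z u w = sder (\<lambda>y. s (X c d y)) ?z u w"
      by (rule arg_cong[where f = "\<lambda>f. f u"], rule fder_cong_open[OF S], rule arg_cong[where f = "\<lambda>f. f w"])
        (rule fder_cong_open[OF S(1) _ eq])
    then show ?thesis by (simp only: sder_compose[OF S XS s XT])
  qed
  have sT: "s y \<in> cimg d'" if "y \<in> ?T" for y
    using that by (auto simp: s_def M.cinv_cmap[OF assms(2)])
  have gs: "gd d y a b = gd d' (s y) (fder s y a) (fder s y b)" if "y \<in> ?T" for y a b
    unfolding s_def by (rule M.bil_in_change[OF assms(2,3) that])
  have K: "koszul (gd d) ?y a b n = koszul (gd d') (s ?y) (fder s ?y a) (fder s ?y b) (fder s ?y n)
      + gd d' (s ?y) (sder s ?y a b) (fder s ?y n)" for a b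
    by (rule koszul_pullback[OF T s sT gd_bilinear[OF assms(3)] gd_smooth[OF assms(3)] gd_sym gs])
  have l: "bilinear (gd d' (cmap d' (x p)))" by (rule gd_bilinear) (use assms in auto)
  show ?thesis
    unfolding sff_def D[OF S(2)] D2 unfolding Xz K gs[OF T(2)] sy by (simp add: bilinear_rules[OF l])
qed

lemma sff_in_chart:
  assumes "c \<in> A" "d \<in> B" "p \<in> cdom c" "x p \<in> cdom d" and n: "normal p n"
  shows "sff c d (cmap c p) (to_chart A c p u) (to_chart A c p w) (to_chart B d (x p) n) = sff_at p u w n"
proof -
  define c0 d0 where "c0 = chart_at A p" and "d0 = chart_at B (x p)"
  have c0: "c0 \<in> A" "p \<in> cdom c0" and d0: "d0 \<in> B" "x p \<in> cdom d0"
    by (auto simp: c0_def d0_def S.chart_at M.chart_at)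
  have perp: "gd d (cmap d (x p)) (fder (X c d) (cmap c p) v) (to_chart B d (x p) n) = 0" for v
  proof -
    have "gd d (cmap d (x p)) (fder (X c d) (cmap c p) v) (to_chart B d (x p) n)
        = g (x p) (dx p (from_chart A c p v)) n"
      using g_in_chart[OF assms(2,4), of "dx p (from_chart A c p v)" n] to_chart_dx[OF assms(1-4), of "from_chart A c p v"]
        assms(1,3) by simp
    then show ?thesis using n g_sym unfolding normal_vector_def by metis
  qed
  have "sff_at p u w n = sff c0 d0 (cmap c0 p) u w n"
    by (simp add: sff_at_def c0_def d0_def)
  also have "\<dots> = sff c0 d (cmap c0 p) u w (to_chart B d (x p) n)"
    using sff_target[OF c0(1) d0(1) assms(2) c0(2) d0(2) assms(4)]
    by (simp add: to_chart_def d0_def[symmetric])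
  also have "\<dots> = sff c d (cmap c p) (to_chart A c p u) (to_chart A c p w) (to_chart B d (x p) n)"
    using sff_source[OF c0(1) assms(1,2) c0(2) assms(3,4) perp]
    by (simp add: to_chart_def[of A] c0_def[symmetric])
  finally show ?thesis by simp
qed

lemma sff_at_sym: "sff_at p u w n = sff_at p w u n"
  unfolding sff_at_def by (rule sff_sym) (auto intro: S.chart_at M.chart_at)

lemma sff_at_linear: "linear (\<lambda>w. sff_at p u w n)" "linear (\<lambda>u. sff_at p u w n)"
  unfolding sff_at_def by (rule sff_linear; auto intro: S.chart_at M.chart_at)+

lemma christoffel_eq:
  "g y (christoffel B g y a b) n = koszul (gd (chart_at B y)) (cmap (chart_at B y) y) a b n"
proof -
  have "linear (koszul (gd (chart_at B y)) (cmap (chart_at B y) y) a b)"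
    by (rule gd_koszul_linear) (auto intro: M.chart_at)
  from theI'[OF inner_form_represents[OF g_inner this]]
  show ?thesis unfolding christoffel_def Let_def koszul_def by blast
qed

lemma nabla_dx_eq: "g (x p) (nabla_dx A B g x p u w) n = sff_at p u w n"
proof -
  let ?c = "chart_at A p" and ?d = "chart_at B (x p)"
  have "g (x p) v n = gd ?d (cmap ?d (x p)) v n" for v
    using g_in_chart[OF M.chart_at, of "x p" v n] by simp
  moreover have "X ?c ?d (cmap ?c p) = cmap ?d (x p)" by (rule X_apply[OF S.chart_at])
  moreover have "dx p v = fder (X ?c ?d) (cmap ?c p) v" for v by (simp add: differential_def)
  ultimately show ?thesis
    unfolding nabla_dx_def Let_def sff_at_def sff_def by (simp add: gl christoffel_eq)
qed

lemma second_fundamental_form_eq: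
  assumes "normal p \<nu>"
  shows "g (x p) (second_fundamental_form A B g x p u w) \<nu> = sff_at p u w \<nu>"
proof -
  have "g (x p) (dx p v) \<nu> = 0" for v using assms g_sym unfolding normal_vector_def by metis
  then show ?thesis
    by (simp add: second_fundamental_form_def nor_part_def gl nabla_dx_eq)
qed

lemma shape_eq:
  assumes "normal p \<nu>"
  shows "I p (shape p \<nu> u) w = sff_at p u w \<nu>"
proof -
  have ex: "\<exists>!v. \<forall>w. I p v w = sff_at p u w \<nu>" for u
    by (rule inner_form_represents[OF I_inner sff_at_linear(1)])
  define S where "S u = (THE v. \<forall>w. I p v w = sff_at p u w \<nu>)" for u
  have S: "I p (S u) w = sff_at p u w \<nu>" for u w
    using theI'[OF ex[of u]] unfolding S_def by blast
  have "shape p \<nu> = S"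
    unfolding shape_operator_def
  proof (rule the_equality)
    show "\<forall>u w. I p (S u) w = g (x p) (second_fundamental_form A B g x p u w) \<nu>"
      by (simp add: S second_fundamental_form_eq[OF assms])
    show "T = S" if "\<forall>u w. I p (T u) w = g (x p) (second_fundamental_form A B g x p u w) \<nu>" for T
      by (rule ext, rule inner_form_eqI[OF I_inner[of p]])
        (simp add: S that second_fundamental_form_eq[OF assms])
  qed
  then show ?thesis by (simp add: S)
qed

lemma shape_linear:
  assumes "normal p \<nu>"
  shows "linear (shape p \<nu>)"
proof -
  note l = bilinear_rules[OF inner_formD(1)[OF I_inner[of p]]] linear_rules[OF sff_at_linear(2)[of p _ \<nu>]]
  show ?thesis
    by (rule linearI; rule inner_form_eqI[OF I_inner[of p]]; simp add: l shape_eq[OF assms])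
qed

lemma shape_sym: "normal p \<nu> \<Longrightarrow> I p (shape p \<nu> u) w = I p u (shape p \<nu> w)"
  using shape_eq[of p \<nu>] sff_at_sym inner_formD(2)[OF I_inner[of p]] by metis

definition shape_in :: "('s, real^2) chart \<Rightarrow> ('s \<Rightarrow> 'f) \<Rightarrow> real^2 \<Rightarrow> real^2 \<Rightarrow> real^2" where
  "shape_in c V = endo_in A c (\<lambda>p. shape p (norp V p))"

lemma shape_in_eq:
  assumes "c \<in> A" "d \<in> B" "z \<in> W c d"
  shows "Ic c z (shape_in c V z u) w = sff c d z u w (sec_in c d (norp V) z)"
proof -
  obtain p where p: "p \<in> cdom c" "x p \<in> cdom d" "z = cmap c p" "cinv c z = p" using W_E[OF assms(3,1)] .
  have "Ic c z (shape_in c V z u) w = sff_at p (from_chart A c p u) (from_chart A c p w) (norp V p)"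
    using p assms(1) by (simp add: bil_in_def shape_in_def endo_in_def shape_eq[OF nor_part_normal])
  then show ?thesis
    using sff_in_chart[OF assms(1,2) p(1,2) nor_part_normal[of p V], of "from_chart A c p u" "from_chart A c p w"]
      p assms(1) by (simp add: sec_in_apply)
qed

lemma shape_in_smooth:
  assumes "V \<in> secs" "c \<in> A"
  shows "smooth_on (cimg c) (\<lambda>z. shape_in c V z u)"
proof (rule smooth_on_cimg[OF assms(2)])
  fix d assume d: "d \<in> B"
  show "smooth_on (W c d) (\<lambda>z. shape_in c V z u)"
  proof (rule smooth_on_solve[where b = "Ic c", OF open_W[OF assms(2) d] _ I_in_smooth_W[OF assms(2) d]])
    show "inner_form (Ic c z)" if "z \<in> W c d" for z
      by (rule I_in_inner[OF assms(2)]) (use that in auto)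
    show "smooth_on (W c d) (\<lambda>z. Ic c z (shape_in c V z u) w)" for w
      using sff_smooth[OF assms(2) d nor_in_smooth[OF assms d]]
      by (subst smooth_on_cong[OF open_W[OF assms(2) d]]) (auto simp: shape_in_eq[OF assms(2) d])
  qed
qed

end

section \<open>The operator and its decomposition\<close>

context smooth_atlas
begin

section \<open>Exterior derivatives of one-forms and products with functions\<close>

lemma form_in_differentiable:
  "\<alpha> \<in> one_forms A \<Longrightarrow> c \<in> A \<Longrightarrow> p \<in> cdom c \<Longrightarrow> (\<lambda>z. form_in A c \<alpha> z u) differentiable at (cmap c p)"
  by (rule smooth_on_differentiable[of "cimg c"]) (auto simp: one_forms_def)

lemma ext_deriv_two_tensor:
  assumes "\<alpha> \<in> one_forms A"
  shows "ext_deriv A \<alpha> \<in> two_tensors A"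
  unfolding two_tensors_def
proof (intro CollectI conjI allI ballI)
  fix p
  let ?c = "chart_at A p"
  note d = form_in_differentiable[OF assms chart_at]
  have o: "open (cimg ?c)" "cmap ?c p \<in> cimg ?c"
    using open_cimg[OF chart_at(1)] chart_at by auto
  have "linear (\<lambda>w. fder (\<lambda>z. form_in A ?c \<alpha> z w) (cmap ?c p) u)" for u
    by (rule linear_fder_family[OF o _ d])
      (use assms in \<open>auto intro!: linear_form_in chart_at simp: one_forms_def\<close>)
  moreover have "linear (fder (\<lambda>z. form_in A ?c \<alpha> z w) (cmap ?c p))" for w
    by (rule linear_frechet_derivative[OF d])
  ultimately show "bilinear (ext_deriv A \<alpha> p)"
    unfolding bilinear_def ext_deriv_def Let_def
    by (intro conjI allI) (auto intro: linear_compose_sub)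
next
  fix c u w assume c: "c \<in> A"
  have o: "open (cimg c)" by (rule open_cimg[OF c])
  have "smooth_on (cimg c) (\<lambda>z. fder (\<lambda>z. form_in A c \<alpha> z w) z u - fder (\<lambda>z. form_in A c \<alpha> z u) z w)"
    using assms c by (intro smooth_on_diff smooth_on_fder o) (auto simp: one_forms_def)
  moreover have "fder (\<lambda>z. form_in A c \<alpha> z w) z u - fder (\<lambda>z. form_in A c \<alpha> z u) z w
      = bil_in A c (ext_deriv A \<alpha>) z u w" if z: "z \<in> cimg c" for z
  proof -
    obtain p where p: "p \<in> cdom c" "z = cmap c p" using z by auto
    then show ?thesis
      using c by (simp add: bil_in_def cinv_cmap ext_deriv_in_chart[OF assms c p(1)])
  qed
  ultimately show "smooth_on (cimg c) (\<lambda>z. bil_in A c (ext_deriv A \<alpha>) z u w)"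
    using smooth_on_cong[OF o] by (metis (mono_tags, lifting))
qed

lemma ext_deriv_two_form: "\<alpha> \<in> one_forms A \<Longrightarrow> ext_deriv A \<alpha> \<in> two_forms A"
  unfolding two_forms_def using ext_deriv_two_tensor by (simp add: ext_deriv_def Let_def)

lemma two_forms_add:
  assumes "\<omega> \<in> two_forms A" "\<omega>' \<in> two_forms A"
  shows "(\<lambda>p u w. \<omega> p u w + \<omega>' p u w) \<in> two_forms A"
proof -
  have "bilinear (\<lambda>u w. \<omega> p u w + \<omega>' p u w)" for p
  proof -
    have "bilinear (\<omega> p)" "bilinear (\<omega>' p)" using assms by (auto simp: two_forms_def two_tensors_def)
    then show ?thesis unfolding bilinear_def by (auto intro: linear_compose_add)
  qed
  moreover have "smooth_on (cimg c) (\<lambda>z. bil_in A c (\<lambda>p u w. \<omega> p u w + \<omega>' p u w) z u w)" if c: "c \<in> A" for c u w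
  proof -
    have "smooth_on (cimg c) (\<lambda>z. bil_in A c \<omega> z u w + bil_in A c \<omega>' z u w)"
      using assms c by (intro smooth_on_add open_cimg) (auto simp: two_forms_def two_tensors_def)
    then show ?thesis by (simp add: bil_in_def)
  qed
  ultimately show ?thesis using assms by (simp add: two_forms_def two_tensors_def)
qed

text \<open>The differential of the function \<open>f\<close> at \<open>p\<close>, acting on tangent
  vectors at \<open>p\<close>.\<close>

definition chart_fder :: "('a \<Rightarrow> real) \<Rightarrow> 'a \<Rightarrow> 'e \<Rightarrow> real" where
  "chart_fder f p = fder (f \<circ> cinv (chart_at A p)) (cmap (chart_at A p) p)"

lemma chart_fder_has_derivative:
  assumes "smooth_fun A f"
  shows "((f \<circ> cinv (chart_at A p)) has_derivative chart_fder f p) (at (cmap (chart_at A p) p))"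
  unfolding chart_fder_def
  by (rule smooth_on_has_derivative[of "cimg (chart_at A p)"])
    (use assms chart_at in \<open>auto simp: smooth_fun_def\<close>)

lemma chart_fder_mult:
  assumes "smooth_fun A f" "smooth_fun A h"
  shows "chart_fder (\<lambda>p. f p * h p) p u = f p * chart_fder h p u + chart_fder f p u * h p"
proof -
  let ?c = "chart_at A p"
  have "((\<lambda>z. (f \<circ> cinv ?c) z * (h \<circ> cinv ?c) z) has_derivative
    (\<lambda>u. f p * chart_fder h p u + chart_fder f p u * h p)) (at (cmap ?c p))"
    using has_derivative_mult[OF assms[THEN chart_fder_has_derivative, of p]]
    by (simp add: cinv_cmap[OF chart_at(1) chart_at(2)])
  then show ?thesis
    unfolding chart_fder_def[of "\<lambda>p. f p * h p"] by (simp add: fder_eqI o_def)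
qed

lemma ext_deriv_scale:
  assumes "smooth_fun A f" "\<alpha> \<in> one_forms A"
  shows "ext_deriv A (\<lambda>p u. f p * \<alpha> p u) p u w
    = f p * ext_deriv A \<alpha> p u w + chart_fder f p u * \<alpha> p w - chart_fder f p w * \<alpha> p u"
proof -
  let ?c = "chart_at A p"
  note inv = cinv_cmap[OF chart_at(1) chart_at(2)]
  have \<alpha>: "((\<lambda>z. form_in A ?c \<alpha> z w) has_derivative fder (\<lambda>z. form_in A ?c \<alpha> z w) (cmap ?c p)) (at (cmap ?c p))" for w
    using form_in_differentiable[OF assms(2) chart_at] frechet_derivative_works by blast
  have "((\<lambda>z. (f \<circ> cinv ?c) z * form_in A ?c \<alpha> z w) has_derivative
     (\<lambda>u. f p * fder (\<lambda>z. form_in A ?c \<alpha> z w) (cmap ?c p) u + chart_fder f p u * \<alpha> p w)) (at (cmap ?c p))" for w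
    by (rule has_derivative_eq_rhs[OF has_derivative_mult[OF chart_fder_has_derivative[OF assms(1)] \<alpha>]])
      (use form_in_apply[OF chart_at(1) chart_at(2), where \<alpha> = \<alpha> and p = p and u = w] inv in simp)
  then have "fder (\<lambda>z. form_in A ?c (\<lambda>p u. f p * \<alpha> p u) z w) (cmap ?c p) =
     (\<lambda>u. f p * fder (\<lambda>z. form_in A ?c \<alpha> z w) (cmap ?c p) u + chart_fder f p u * \<alpha> p w)" for w
    by (simp add: fder_eqI form_in_def o_def)
  then show ?thesis by (simp add: ext_deriv_def Let_def algebra_simps)
qed

lemma ext_deriv_linear:
  assumes "\<alpha> \<in> one_forms A" "\<alpha>' \<in> one_forms A"
  shows "ext_deriv A (\<lambda>p u. a * \<alpha> p u + b * \<alpha>' p u) p u w = a * ext_deriv A \<alpha> p u w + b * ext_deriv A \<alpha>' p u w"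
proof -
  let ?c = "chart_at A p"
  have "((\<lambda>z. a * form_in A ?c \<alpha> z w + b * form_in A ?c \<alpha>' z w) has_derivative
     (\<lambda>u. a * fder (\<lambda>z. form_in A ?c \<alpha> z w) (cmap ?c p) u + b * fder (\<lambda>z. form_in A ?c \<alpha>' z w) (cmap ?c p) u))
     (at (cmap ?c p))" for w
    using form_in_differentiable[OF assms(1) chart_at] form_in_differentiable[OF assms(2) chart_at]
    by (intro has_derivative_add has_derivative_mult_right) (simp_all add: frechet_derivative_works[symmetric])
  then have "fder (\<lambda>z. form_in A ?c (\<lambda>p u. a * \<alpha> p u + b * \<alpha>' p u) z w) (cmap ?c p) =
     (\<lambda>u. a * fder (\<lambda>z. form_in A ?c \<alpha> z w) (cmap ?c p) u + b * fder (\<lambda>z. form_in A ?c \<alpha>' z w) (cmap ?c p) u)" for w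
    by (simp add: fder_eqI form_in_def)
  then show ?thesis by (simp add: ext_deriv_def Let_def algebra_simps)
qed

lemma smooth_fun_const: "smooth_fun A (\<lambda>p. r)"
  by (simp add: smooth_fun_def o_def smooth_on_const)

lemma smooth_fun_mult: "smooth_fun A f \<Longrightarrow> smooth_fun A h \<Longrightarrow> smooth_fun A (\<lambda>p. f p * h p)"
  unfolding smooth_fun_def o_def using smooth_on_mult open_cimg by blast

end

locale teichmueller_immersion = immersed_surface A B g x
  for A :: "('s::{t2_space,second_countable_topology}, real^2) chart set"
    and B :: "('m::{t2_space,second_countable_topology}, 'f::euclidean_space) chart set"
    and g :: "'m \<Rightarrow> 'f \<Rightarrow> 'f \<Rightarrow> real" and x :: "'s \<Rightarrow> 'm" +
  fixes \<sigma> :: "'s \<Rightarrow> real^2 \<Rightarrow> real^2 \<Rightarrow> real"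
  assumes covector: "teichmueller_covector A J \<sigma>"
begin

abbreviation Q where "Q \<equiv> transpose_compose J \<sigma>"
abbreviation \<sigma>c where "\<sigma>c c \<equiv> bil_in A c \<sigma>"
abbreviation Qc where "Qc c \<equiv> bil_in A c Q"
abbreviation \<beta> where "\<beta> \<equiv> beta_op A B g x Q"
abbreviation E where "E \<equiv> E_op A B g x Q"
abbreviation D where "D \<equiv> D_op A B g x \<sigma>"

lemma \<sigma>_bilinear: "bilinear (\<sigma> p)"
  and \<sigma>_J: "\<sigma> p u (J p w) = \<sigma> p (J p u) w"
  and \<sigma>_smooth: "c \<in> A \<Longrightarrow> smooth_on (cimg c) (\<lambda>z. \<sigma>c c z u w)"
  using covector by (auto simp: teichmueller_covector_def two_tensors_def)

lemma Q_eq: "Q p u w = \<sigma> p u (J p w)"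
  by (simp add: transpose_compose_def)

lemma Q_bilinear: "bilinear (Q p)"
proof -
  interpret rotation_plane "I p" "J p" by (rule rotation_I)
  show ?thesis
    unfolding bilinear_def Q_eq by (intro conjI allI linearI) (simp_all add: bilinear_rules[OF \<sigma>_bilinear] Jl)
qed

lemma Q_J: "Q p u (J p w) = Q p (J p u) w"
  by (simp add: Q_eq \<sigma>_J)

lemma Q_sym: "Q p u w = Q p w u"
  by (rule rotation_plane.quadratic_symmetric[OF rotation_I, of "Q p"]) (rule Q_bilinear, rule Q_J)

lemma Q_in_eq: "c \<in> A \<Longrightarrow> z \<in> cimg c \<Longrightarrow> Qc c z u w = \<sigma>c c z u (Jc c z w)"
  using chartD(5)[OF S.is_chart, of c z] by (simp add: bil_in_def endo_in_def Q_eq)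

lemma \<sigma>_in_bilinear: "c \<in> A \<Longrightarrow> z \<in> cimg c \<Longrightarrow> bilinear (\<sigma>c c z)"
  by (rule S.bilinear_bil_in[OF _ _ \<sigma>_bilinear])

lemma J_in_linear: "c \<in> A \<Longrightarrow> z \<in> cimg c \<Longrightarrow> linear (Jc c z)"
  by (rule rotation_plane.linear_J[OF rotation_in])

lemma Q_in_smooth:
  assumes c: "c \<in> A"
  shows "smooth_on (cimg c) (\<lambda>z. Qc c z u w)"
proof -
  have o: "open (cimg c)" by (rule S.open_cimg[OF c])
  have "smooth_on (cimg c) (\<lambda>z. \<sigma>c c z u (Jc c z w))"
    by (rule smooth_on_bilinear_family[where B = "\<sigma>c c", OF o \<sigma>_in_bilinear[OF c] \<sigma>_smooth[OF c]
          smooth_on_const J_in_smooth[OF c]])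
  then show ?thesis by (subst smooth_on_cong[OF o]) (auto simp: Q_in_eq[OF c])
qed

lemma Q_in_bilinear: "c \<in> A \<Longrightarrow> z \<in> cimg c \<Longrightarrow> bilinear (Qc c z)"
  by (rule S.bilinear_bil_in[OF _ _ Q_bilinear])

lemma \<beta>_eq: "\<beta> V p u = - 2 * Q p u (tanp V p)"
  by (simp add: beta_op_def)

lemma \<beta>_in_eq:
  assumes "c \<in> A" "z \<in> cimg c"
  shows "form_in A c (\<beta> V) z u = - 2 * Qc c z u (vec_in A c (tanp V) z)"
  using assms S.cinv_in[OF assms(1) assms(2)]
  by (simp add: form_in_def \<beta>_eq bil_in_def vec_in_def)

lemma \<beta>_one_form:
  assumes "V \<in> secs"
  shows "\<beta> V \<in> one_forms A"
  unfolding one_forms_def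
proof (intro CollectI conjI allI ballI)
  show "linear (\<beta> V p)" for p
    by (rule linearI) (simp_all add: \<beta>_eq bilinear_rules[OF Q_bilinear] algebra_simps)
  fix c u assume c: "c \<in> A"
  have o: "open (cimg c)" by (rule S.open_cimg[OF c])
  have "smooth_on (cimg c) (\<lambda>z. - 2 * Qc c z u (vec_in A c (tanp V) z))"
    by (rule smooth_on_mult[OF o smooth_on_const smooth_on_bilinear_family[where B = "Qc c",
          OF o Q_in_bilinear[OF c] Q_in_smooth[OF c] smooth_on_const tan_in_smooth[OF assms c]]])
  then show "smooth_on (cimg c) (\<lambda>z. form_in A c (\<beta> V) z u)"
    by (subst smooth_on_cong[OF o]) (auto simp: \<beta>_in_eq[OF c])
qed

text \<open>The trace part contributes a multiple of \<open>Q p u w - Q p w u\<close>, which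
  vanishes by symmetry of \<open>Q\<close>. So the full shape operator may replace its trace-free
  part.\<close>

lemma E_eq: "E V p u w = - 2 * (Q p u (shape p (norp V p) w) - Q p w (shape p (norp V p) u))"
  using Q_sym[of p u w]
  by (simp add: E_op_def wedge_pairing_def shape_operator0_def bilinear_rules[OF Q_bilinear])

lemma E_two_form:
  assumes "V \<in> secs"
  shows "E V \<in> two_forms A"
proof -
  have "bilinear (E V p)" for p
    unfolding bilinear_def E_eq
    by (intro conjI allI linearI)
      (simp_all add: bilinear_rules[OF Q_bilinear] linear_rules[OF shape_linear[OF nor_part_normal]] algebra_simps)
  moreover have "smooth_on (cimg c) (\<lambda>z. bil_in A c (E V) z u w)" if c: "c \<in> A" for c u w
  proof -
    have o: "open (cimg c)" by (rule S.open_cimg[OF c])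
    have 1: "smooth_on (cimg c) (\<lambda>z. Qc c z u (shape_in c V z w))" for u w
      by (rule smooth_on_bilinear_family[where B = "Qc c", OF o Q_in_bilinear[OF c] Q_in_smooth[OF c]
            smooth_on_const shape_in_smooth[OF assms c]])
    have "smooth_on (cimg c) (\<lambda>z. - 2 * (Qc c z u (shape_in c V z w) - Qc c z w (shape_in c V z u)))"
      by (rule smooth_on_mult[OF o smooth_on_const smooth_on_diff[OF o 1 1]])
    moreover have "- 2 * (Qc c z u (shape_in c V z w) - Qc c z w (shape_in c V z u))
        = bil_in A c (E V) z u w" if "z \<in> cimg c" for z
      using c S.cinv_in[OF c that] by (simp add: bil_in_def E_eq shape_in_def endo_in_def)
    ultimately show ?thesis using smooth_on_cong[OF o] by (metis (mono_tags, lifting))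
  qed
  ultimately show ?thesis by (simp add: two_forms_def two_tensors_def E_eq)
qed

text \<open>Only the Christoffel symbols \<open>G\<close> at the base point of the preferred chart
  are needed later, where the components of \<open>J\<close> and \<open>\<sigma>\<close> are
  \<open>J p\<close> and \<open>\<sigma> p\<close>. The last equation is
  \<open>d\<^sup>\<nabla>\<sigma> = 0\<close>, the one before it
  \<open>\<nabla>J = 0\<close>.\<close>

lemma parallel_connection_at:
  fixes p :: 's
  defines "c \<equiv> chart_at A p" and "z \<equiv> cmap (chart_at A p) p"
  obtains G where "bilinear G" "\<And>a b. G a b = G b a"
    "\<And>a b. fder (\<lambda>z. Jc c z b) z a = J p (G a b) - G a (J p b)"
    "\<And>u w v. fder (\<lambda>z. \<sigma>c c z w v) z u - \<sigma> p w (G u v) = fder (\<lambda>z. \<sigma>c c z u v) z w - \<sigma> p u (G w v)"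
proof -
  obtain \<Gamma> where \<Gamma>: "connection A \<Gamma>" "torsion_free A \<Gamma>" "parallel_endo A \<Gamma> J"
    "\<And>c z u w v. c \<in> A \<Longrightarrow> z \<in> cimg c \<Longrightarrow> cov_ext_deriv A \<Gamma> \<sigma> c z u w v = 0"
    using covector unfolding teichmueller_covector_def by blast
  have c: "c \<in> A" and z: "z \<in> cimg c" using S.chart_at by (auto simp: c_def z_def)
  note at_z = S.in_chart_at[of p, folded c_def z_def]
  show thesis
  proof
    show "bilinear (\<Gamma> c z)" "\<Gamma> c z a b = \<Gamma> c z b a" for a b
      using \<Gamma>(1,2) c z by (auto simp: connection_def torsion_free_def)
    show "fder (\<lambda>z. Jc c z b) z a = J p (\<Gamma> c z a b) - \<Gamma> c z a (J p b)" for a b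
      using \<Gamma>(3)[unfolded parallel_endo_def, rule_format, OF c z, of b a] by (simp add: at_z algebra_simps)
    show "fder (\<lambda>z. \<sigma>c c z w v) z u - \<sigma> p w (\<Gamma> c z u v) = fder (\<lambda>z. \<sigma>c c z u v) z w - \<sigma> p u (\<Gamma> c z w v)" for u w v
      using \<Gamma>(4)[OF c z, of u w v] by (simp add: cov_ext_deriv_def at_z)
  qed
qed

lemma lie_endo_wedge:
  assumes V: "V \<in> secs"
  shows "\<sigma> p u (lie_endo A (tanp V) J p w) - \<sigma> p w (lie_endo A (tanp V) J p u) = ext_deriv A (\<beta> V) p u w"
proof -
  interpret rotation_plane "I p" "J p" by (rule rotation_I)
  define c z where "c = chart_at A p" and "z = cmap c p"
  have c: "c \<in> A" "p \<in> cdom c" by (auto simp: c_def S.chart_at)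
  have z: "z \<in> cimg c" "cinv c z = p" using c by (auto simp: z_def S.cinv_cmap[OF c(1)])
  have o: "open (cimg c)" by (rule S.open_cimg[OF c(1)])
  define Y T where "Y = tanp V p" and "T = fder (vec_in A c (tanp V)) z"
  note at_z = S.in_chart_at[of p, folded c_def z_def]
  have Yz: "vec_in A c (tanp V) z = Y" by (simp add: at_z Y_def)
  obtain G where G: "bilinear G" "\<And>a b. G a b = G b a"
    and dJ: "\<And>a b. fder (\<lambda>z. Jc c z b) z a = J p (G a b) - G a (J p b)"
    and cov: "\<And>u w v. fder (\<lambda>z. \<sigma>c c z w v) z u - \<sigma> p w (G u v) = fder (\<lambda>z. \<sigma>c c z u v) z w - \<sigma> p u (G w v)"
    using parallel_connection_at[of p] unfolding c_def z_def by blast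
  have vec: "(vec_in A c (tanp V) has_derivative T) (at z)"
    unfolding T_def by (rule smooth_on_has_derivative[OF tan_in_smooth[OF V c(1)] z(1)])
  have T: "linear T" using vec has_derivative_linear by blast
  \<comment> \<open>\<open>T'\<close> is the covariant derivative of the tangential field at
    \<open>p\<close>.\<close>
  define T' where "T' a = T a + G a Y" for a
  have T': "linear T'"
    by (rule linearI) (simp_all add: T'_def linear_rules[OF T] bilinear_rules[OF G(1)] algebra_simps)
  \<comment> \<open>The coordinate derivative of \<open>J\<close> along \<open>Y\<close> is a
    commutator with \<open>G Y\<close>. By symmetry of \<open>G\<close> it turns the derivatives
    \<open>T\<close> of the field into \<open>T'\<close>.\<close>
  have lie: "lie_endo A (tanp V) J p a = J p (T' a) - T' (J p a)" for a
    unfolding lie_endo_def Let_def c_def[symmetric] z_def[symmetric] dJ T_def[symmetric] Y_def[symmetric]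
    by (simp add: T'_def Jl G(2)[of Y])
  have JY: "((\<lambda>y. Jc c y (vec_in A c (tanp V) y)) has_derivative
      (\<lambda>a. fder (\<lambda>y. Jc c y Y) z a + J p (T a))) (at z)"
    using has_derivative_linear_family[where L = "Jc c", OF o z(1) J_in_linear[OF c(1)] _ vec]
      smooth_on_differentiable[OF J_in_smooth[OF c(1)] z(1)] unfolding at_z(2) Yz by blast
  \<comment> \<open>The factor \<open>J\<close> is parallel, so the derivative splits into the
    covariant derivative of \<open>\<sigma>\<close>, contracted with \<open>J p Y\<close>, and
    \<open>\<sigma>\<close> applied to the covariant derivative of the field.\<close>
  have d\<beta>: "fder (\<lambda>y. form_in A c (\<beta> V) y b) z a
    = - 2 * (fder (\<lambda>y. \<sigma>c c y b (J p Y)) z a - \<sigma> p b (G a (J p Y)) + \<sigma> p b (J p (T' a)))" for a b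
  proof -
    have "((\<lambda>y. \<sigma>c c y b (Jc c y (vec_in A c (tanp V) y))) has_derivative
      (\<lambda>a. fder (\<lambda>y. \<sigma>c c y b (Jc c z (vec_in A c (tanp V) z))) z a + \<sigma>c c z 0 (Jc c z (vec_in A c (tanp V) z))
        + \<sigma>c c z b (fder (\<lambda>y. Jc c y Y) z a + J p (T a)))) (at z)"
      by (rule has_derivative_bilinear_family[where B = "\<sigma>c c" and a = "\<lambda>y. b" and a' = "\<lambda>v. 0", OF o z(1) \<sigma>_in_bilinear[OF c(1)] _ has_derivative_const JY])
        (auto intro: smooth_on_differentiable[OF \<sigma>_smooth[OF c(1)] z(1)])
    then have "((\<lambda>y. - 2 * \<sigma>c c y b (Jc c y (vec_in A c (tanp V) y))) has_derivative
      (\<lambda>a. - 2 * (fder (\<lambda>y. \<sigma>c c y b (J p Y)) z a - \<sigma> p b (G a (J p Y)) + \<sigma> p b (J p (T' a))))) (at z)"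
      unfolding at_z(1,2) Yz dJ
      by (intro has_derivative_eq_rhs[OF has_derivative_mult_right[of _ _ _ "- 2"]])
        (auto simp: T'_def Jl bilinear_rules[OF \<sigma>_bilinear] fun_eq_iff)
    then have "fder (\<lambda>y. - 2 * \<sigma>c c y b (Jc c y (vec_in A c (tanp V) y))) z a
      = - 2 * (fder (\<lambda>y. \<sigma>c c y b (J p Y)) z a - \<sigma> p b (G a (J p Y)) + \<sigma> p b (J p (T' a)))"
      by (simp only: fder_eqI)
    moreover have "fder (\<lambda>y. form_in A c (\<beta> V) y b) z
        = fder (\<lambda>y. - 2 * \<sigma>c c y b (Jc c y (vec_in A c (tanp V) y))) z"
      by (rule fder_cong_open[OF o z(1)]) (use \<beta>_in_eq[OF c(1)] Q_in_eq[OF c(1)] in auto)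
    ultimately show ?thesis by simp
  qed
  \<comment> \<open>Antisymmetrising the covariant derivatives of \<open>\<sigma>\<close> gives
    \<open>d\<^sup>\<nabla>\<sigma>\<close> contracted with \<open>J p Y\<close>, which is
    zero.\<close>
  have "ext_deriv A (\<beta> V) p u w = 2 * (\<sigma> p u (J p (T' w)) - \<sigma> p w (J p (T' u)))"
    unfolding ext_deriv_def Let_def c_def[symmetric] z_def[symmetric] d\<beta>
    using cov[of w "J p Y" u] by (simp add: algebra_simps)
  also have "\<dots> = \<sigma> p u (lie_endo A (tanp V) J p w) - \<sigma> p w (lie_endo A (tanp V) J p u)"
    unfolding lie using wedge_endo_identity[OF \<sigma>_bilinear \<sigma>_J T', of w u]
    by (simp add: bilinear_rules[OF \<sigma>_bilinear])
  finally show ?thesis by simp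
qed

lemma shape_wedge:
  assumes "normal p \<nu>"
  shows "\<sigma> p u (shape_operator0 A B g x p \<nu> (J p w)) = - Q p u (shape_operator0 A B g x p \<nu> w)"
proof -
  interpret rotation_plane "I p" "J p" by (rule rotation_I)
  have "shape_operator0 A B g x p \<nu> (J p w) = - J p (shape_operator0 A B g x p \<nu> w)"
    using traceless_anticommute[OF shape_linear[OF assms] shape_sym[OF assms]]
    unfolding shape_operator0_def[abs_def] .
  then show ?thesis by (simp add: Q_eq bilinear_rules[OF \<sigma>_bilinear])
qed

lemma D_decomposition:
  assumes "V \<in> secs"
  shows "D V p u w = ext_deriv A (\<beta> V) p u w + E V p u w"
  using lie_endo_wedge[OF assms, of p u w]
  by (simp add: D_op_def Let_def wedge_pairing_def E_op_def bilinear_rules[OF \<sigma>_bilinear]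
      shape_wedge[OF nor_part_normal])

section \<open>Linearity over functions, and the order of the operator\<close>

lemma shape_combine:
  assumes "normal p \<nu>" "normal p \<nu>'"
  shows "shape p (a *\<^sub>R \<nu> + b *\<^sub>R \<nu>') u = a *\<^sub>R shape p \<nu> u + b *\<^sub>R shape p \<nu>' u"
proof -
  have n: "normal p (a *\<^sub>R \<nu> + b *\<^sub>R \<nu>')" using assms by (simp add: normal_vector_def gl)
  have "linear (sff_at p u w)" for w
    unfolding sff_at_def by (rule sff_linear) (auto intro: S.chart_at M.chart_at)
  note l = linear_rules[OF this] bilinear_rules[OF inner_formD(1)[OF I_inner[of p]]]
  show ?thesis
    by (rule inner_form_eqI[OF I_inner[of p]]) (simp add: l shape_eq n assms)
qed

lemma \<beta>_combine: "\<beta> (\<lambda>p. f p *\<^sub>R V p + h p *\<^sub>R V' p) p u = f p * \<beta> V p u + h p * \<beta> V' p u"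
  by (simp add: \<beta>_eq tan_part_combine bilinear_rules[OF Q_bilinear])

lemma E_combine: "E (\<lambda>p. f p *\<^sub>R V p + h p *\<^sub>R V' p) p u w = f p * E V p u w + h p * E V' p u w"
  by (simp add: E_eq nor_part_combine shape_combine[OF nor_part_normal nor_part_normal]
      bilinear_rules[OF Q_bilinear] algebra_simps)

lemma sections_combine:
  assumes "smooth_fun A f" "smooth_fun A h" "V \<in> secs" "V' \<in> secs"
  shows "(\<lambda>p. f p *\<^sub>R V p + h p *\<^sub>R V' p) \<in> secs"
proof -
  let ?V = "\<lambda>p. f p *\<^sub>R V p + h p *\<^sub>R V' p"
  have "smooth_on (W c d) (sec_in c d ?V)" if c: "c \<in> A" and d: "d \<in> B" for c d
  proof -
    have fh: "smooth_on (W c d) (\<lambda>z. f (cinv c z))" "smooth_on (W c d) (\<lambda>z. h (cinv c z))"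
      using assms(1,2) c smooth_on_subset[OF _ W_subset] unfolding smooth_fun_def o_def by blast+
    have "smooth_on (W c d) (\<lambda>z. f (cinv c z) *\<^sub>R sec_in c d V z + h (cinv c z) *\<^sub>R sec_in c d V' z)"
      by (intro smooth_on_add smooth_on_scaleR fh sec_in_smooth open_W assms c d)
    moreover have "f (cinv c z) *\<^sub>R sec_in c d V z + h (cinv c z) *\<^sub>R sec_in c d V' z = sec_in c d ?V z"
      if "z \<in> W c d" for z
      by (rule W_E[OF that c]) (simp add: sec_in_def linear_rules[OF M.linear_to_chart[OF d]])
    ultimately show ?thesis using smooth_on_cong[OF open_W[OF c d]] by (metis (mono_tags, lifting))
  qed
  then show ?thesis by (simp add: sections_def sec_in_def[abs_def])
qed

text \<open>The commutator of \<open>D\<close> with multiplication by \<open>f\<close> is the wedge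
  product of df with \<open>\<beta> V\<close>: the symbol of \<open>D\<close> comes from
  \<open>\<beta>\<close> alone, since \<open>E\<close> commutes with functions.\<close>

lemma D_scale:
  assumes "V \<in> secs" "smooth_fun A f"
  shows "D (\<lambda>p. f p *\<^sub>R V p) p u w
    = f p * D V p u w + S.chart_fder f p u * \<beta> V p w - S.chart_fder f p w * \<beta> V p u"
proof -
  have "(\<lambda>p. f p *\<^sub>R V p) \<in> secs"
    using sections_combine[OF assms(2) S.smooth_fun_const assms(1,1), of 0] by simp
  moreover have "\<beta> (\<lambda>p. f p *\<^sub>R V p) = (\<lambda>p u. f p * \<beta> V p u)"
    using \<beta>_combine[of f V "\<lambda>_. 0" V] by (simp add: fun_eq_iff)
  moreover have "E (\<lambda>p. f p *\<^sub>R V p) p u w = f p * E V p u w"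
    using E_combine[of f V "\<lambda>_. 0" V] by simp
  ultimately show ?thesis
    using D_decomposition[of "\<lambda>p. f p *\<^sub>R V p" p u w] D_decomposition[OF assms(1), of p u w]
      S.ext_deriv_scale[OF assms(2) \<beta>_one_form[OF assms(1)], of p u w]
    by (simp add: algebra_simps)
qed

lemma D_first_order: "first_order_linear_operator A B x D"
  unfolding first_order_linear_operator_def
proof (intro conjI ballI allI impI)
  fix V assume V: "V \<in> secs"
  have "D V = (\<lambda>p u w. ext_deriv A (\<beta> V) p u w + E V p u w)"
    by (intro ext D_decomposition V)
  then show "D V \<in> two_forms A"
    using S.two_forms_add[OF S.ext_deriv_two_form[OF \<beta>_one_form[OF V]] E_two_form[OF V]] by simp
next
  fix V V' a b p u w assume V: "V \<in> secs" "V' \<in> secs"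
  let ?V = "\<lambda>p. a *\<^sub>R V p + b *\<^sub>R V' p"
  have "?V \<in> secs"
    by (rule sections_combine[OF S.smooth_fun_const S.smooth_fun_const V])
  moreover have "\<beta> ?V = (\<lambda>p u. a * \<beta> V p u + b * \<beta> V' p u)"
    using \<beta>_combine[of "\<lambda>_. a" V "\<lambda>_. b" V'] by (simp add: fun_eq_iff)
  ultimately show "D ?V p u w = a * D V p u w + b * D V' p u w"
    using V E_combine[of "\<lambda>_. a" V "\<lambda>_. b" V' p u w]
    by (simp add: D_decomposition S.ext_deriv_linear \<beta>_one_form algebra_simps)
next
  fix V f h p u w assume V: "V \<in> secs" and f: "smooth_fun A f" "smooth_fun A h"
  show "D (\<lambda>p. (f p * h p) *\<^sub>R V p) p u w - f p * D (\<lambda>p. h p *\<^sub>R V p) p u w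
        - h p * D (\<lambda>p. f p *\<^sub>R V p) p u w + f p * h p * D V p u w = 0"
    \<comment> \<open>What remains is d(f h) - f dh - h df, wedged with \<open>\<beta> V\<close>,
      and this vanishes by the Leibniz rule.\<close>
    using f by (simp add: D_scale[OF V] S.smooth_fun_mult S.chart_fder_mult algebra_simps)
qed

end

section \<open>Conformal vector fields\<close>

text \<open>Allows a conformal vector field, whose defining equation is given for some metric of the
  class, to be tested on the fixed metric instead.\<close>

lemma (in smooth_atlas) lie_metric_scale:
  assumes f: "smooth_fun A f" and g: "g \<in> two_tensors A" and h: "\<And>y u w. h y u w = f y * g y u w"
  shows "lie_metric A Y h y u w = f y * lie_metric A Y g y u w + chart_fder f y (Y y) * g y u w"
proof -
  let ?d = "chart_at A y"
  have z: "cmap ?d y \<in> cimg ?d" "cinv ?d (cmap ?d y) = y"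
    using chart_at cinv_cmap by auto
  have d: "((\<lambda>z. bil_in A ?d g z u w) has_derivative fder (\<lambda>z. bil_in A ?d g z u w) (cmap ?d y)) (at (cmap ?d y))"
    by (rule smooth_on_has_derivative[OF _ z(1)]) (use g chart_at in \<open>auto simp: two_tensors_def\<close>)
  have "((\<lambda>z. (f \<circ> cinv ?d) z * bil_in A ?d g z u w) has_derivative
    (\<lambda>v. f y * fder (\<lambda>z. bil_in A ?d g z u w) (cmap ?d y) v + chart_fder f y v * g y u w)) (at (cmap ?d y))"
    by (rule has_derivative_eq_rhs[OF has_derivative_mult[OF chart_fder_has_derivative[OF f] d]])
      (simp add: bil_in_def z(2))
  then have "fder (\<lambda>z. bil_in A ?d h z u w) (cmap ?d y)
     = (\<lambda>v. f y * fder (\<lambda>z. bil_in A ?d g z u w) (cmap ?d y) v + chart_fder f y v * g y u w)"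
    by (simp add: fder_eqI bil_in_def h o_def)
  then show ?thesis by (simp add: lie_metric_def Let_def h algebra_simps)
qed

context teichmueller_immersion
begin

lemma vec_in_smooth:
  assumes "Y \<in> vector_fields B" "d \<in> B"
  shows "smooth_on (cimg d) (vec_in B d Y)"
proof -
  have "smooth_on (cmap d ` (cdom d \<inter> (\<lambda>p. p) -` cdom d)) (\<lambda>z. to_chart B d (cinv d z) (Y (cinv d z)))"
    using assms unfolding sections_def by blast
  then show ?thesis by (simp add: vec_in_def[abs_def])
qed

lemma sec_in_compose:
  assumes "c \<in> A" "d \<in> B" "z \<in> W c d"
  shows "sec_in c d (Y \<circ> x) z = vec_in B d Y (X c d z)"
proof -
  obtain p where p: "p \<in> cdom c" "x p \<in> cdom d" "z = cmap c p" "cinv c z = p" using W_E[OF assms(3,1)] .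
  then show ?thesis by (simp add: sec_in_def vec_in_def M.cinv_cmap[OF assms(2)])
qed

lemma compose_sections:
  assumes "Y \<in> vector_fields B"
  shows "Y \<circ> x \<in> secs"
proof -
  have "smooth_on (W c d) (sec_in c d (Y \<circ> x))" if "c \<in> A" "d \<in> B" for c d
  proof -
    have "smooth_on (W c d) (\<lambda>z. vec_in B d Y (X c d z))"
      by (rule smooth_on_compose[OF open_W[OF that] M.open_cimg[OF that(2)]
            vec_in_smooth[OF assms that(2)] smooth_X[OF that] X_in_cimg[OF that(1)]])
    then show ?thesis by (subst smooth_on_cong[OF open_W[OF that]]) (auto simp: sec_in_compose[OF that])
  qed
  then show ?thesis by (simp add: sections_def sec_in_def[abs_def])
qed

text \<open>The left-hand side is \<open>L\<^bsub>T\<^esub> I\<close> for \<open>T = (Y \<circ> x)\<^sup>\<top>\<close>: the Lie derivative of the metric along \<open>Y\<close>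
  pulls back to \<open>L\<^bsub>T\<^esub> I - 2 (II, Y\<^sup>\<bottom>)\<close>. The derivative of the identity \<open>(Y\<^sup>\<bottom>, dx w) = 0\<close>
  provides the second fundamental form.\<close>

lemma lie_induced_metric:
  fixes p :: 's
  assumes Y: "Y \<in> vector_fields B" and lie: "\<And>y u w. lie_metric B Y g y u w = k y * g y u w"
  defines "c \<equiv> chart_at A p" and "T \<equiv> vec_in A (chart_at A p) (tanp (Y \<circ> x))"
  defines "z \<equiv> cmap c p"
  shows "fder (\<lambda>z. Ic c z u w) z (T z) + I p (fder T z u) w + I p u (fder T z w)
    = k (x p) * I p u w + 2 * I p (shape p (norp (Y \<circ> x) p) u) w"
proof -
  define d where "d = chart_at B (x p)"
  have c: "c \<in> A" "p \<in> cdom c" and d: "d \<in> B" "x p \<in> cdom d"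
    by (auto simp: c_def d_def S.chart_at M.chart_at)
  have z: "z \<in> W c d" unfolding z_def by (rule W_I[OF c(2) d(2)])
  have zc: "z \<in> cimg c" "cinv c z = p" using c by (auto simp: z_def S.cinv_cmap[OF c(1)])
  have oW: "open (W c d)" by (rule open_W[OF c(1) d(1)])
  define F where "F = X c d"
  define y where "y = cmap d (x p)"
  have Fz: "F z = y" unfolding F_def z_def y_def by (rule X_apply[OF c])
  have yd: "y \<in> cimg d" "cinv d y = x p" using d by (auto simp: y_def M.cinv_cmap[OF d(1)])
  have F: "smooth_on (W c d) F" unfolding F_def by (rule smooth_X[OF c(1) d(1)])
  have FS: "F y \<in> cimg d" if "y \<in> W c d" for y unfolding F_def by (rule X_in_cimg[OF c(1) that])
  have Vs: "Y \<circ> x \<in> secs" by (rule compose_sections[OF Y])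
  define N where "N = sec_in c d (norp (Y \<circ> x))"
  define Yd where "Yd = vec_in B d Y"
  note gb = gd_bilinear[OF d(1)] and gs = gd_smooth[OF d(1)]
  have gy: "gd d y a b = g (x p) a b" for a b
    unfolding y_def d_def by (rule M.in_chart_at)
  have dT: "(T has_derivative fder T z) (at z)"
    unfolding T_def c_def[symmetric] by (rule smooth_on_has_derivative[OF tan_in_smooth[OF Vs c(1)] zc(1)])
  have dYd: "(Yd has_derivative fder Yd y) (at y)"
    unfolding Yd_def by (rule smooth_on_has_derivative[OF vec_in_smooth[OF Y d(1)] yd(1)])
  have dF: "(F has_derivative fder F z) (at z)" by (rule smooth_on_has_derivative[OF F z])
  have dF2: "((\<lambda>z. fder F z w) has_derivative (\<lambda>u. sder F z u w)) (at z)" for w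
    by (rule smooth_on_has_derivative[OF smooth_on_fder[OF F] z])
  have N_eq: "N z' = Yd (F z') - fder F z' (T z')" if "z' \<in> W c d" for z'
    unfolding N_def Yd_def F_def T_def c_def[symmetric] nor_in_eq[OF c(1) d(1) that] sec_in_compose[OF c(1) d(1) that] ..
  define DN where "DN u = fder Yd y (fder F z u) - (sder F z u (T z) + fder F z (fder T z u))" for u
  have dN: "(N has_derivative DN) (at z)"
  proof -
    have "((\<lambda>z'. fder F z' (T z')) has_derivative (\<lambda>u. sder F z u (T z) + fder F z (fder T z u))) (at z)"
      by (rule has_derivative_linear_family[where L = "fder F", OF oW z smooth_on_linear_fder[OF F] _ dT])
        (auto intro: smooth_on_differentiable[OF smooth_on_fder[OF F] z])
    moreover have "((\<lambda>z'. Yd (F z')) has_derivative (\<lambda>u. fder Yd y (fder F z u))) (at z)"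
      by (rule has_derivative_compose[OF dF]) (use dYd Fz in simp)
    ultimately have "((\<lambda>z'. Yd (F z') - fder F z' (T z')) has_derivative DN) (at z)"
      unfolding DN_def[abs_def] by (intro has_derivative_diff)
    then show ?thesis by (subst has_derivative_cong_open[OF oW z N_eq])
  qed
  define dg where "dg a b v = fder (\<lambda>y. gd d y a b) y v" for a b v
  have dg_sym: "dg a b v = dg b a v" for a b v by (simp add: dg_def gd_sym[of d _ a b])
  have dg_add: "dg a b (v + v') = dg a b v + dg a b v'" for a b v v'
    unfolding dg_def by (rule linear_add[OF smooth_on_linear_fder[OF gs yd(1)]])
  have perp: "dg (N z) (fder F z w) (fder F z u) + g (x p) (DN u) (fder F z w) + g (x p) (N z) (sder F z u w) = 0" for u w
  proof -
    have "((\<lambda>z'. gd d (F z') (N z') (fder F z' w)) has_derivative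
      (\<lambda>u. dg (N z) (fder F z w) (fder F z u) + g (x p) (DN u) (fder F z w) + g (x p) (N z) (sder F z u w))) (at z)"
      using has_derivative_bilinear_family_comp[where B = "gd d" and T = "cimg d", OF oW z FS dF gb _ dN dF2[of w]]
        smooth_on_differentiable[OF gs yd(1)]
      unfolding Fz dg_def gy by blast
    moreover have "((\<lambda>z'. gd d (F z') (N z') (fder F z' w)) has_derivative (\<lambda>u. 0)) (at z)"
      by (subst has_derivative_cong_open[OF oW z, where g = "\<lambda>_. 0"])
        (use nor_in_normal[OF c(1) d(1)] in \<open>auto simp: F_def N_def\<close>)
    ultimately show ?thesis using has_derivative_unique by (metis (no_types, lifting))
  qed
  \<comment> \<open>Splitting \<open>Y\<close> at the point splits the derivative of the metric
    along \<open>Y\<close> into a part along the surface, which belongs to the induced metric, and a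
    part along the normal vector, which belongs to the second fundamental form.\<close>
  have Y0: "Yd y = fder F z (T z) + N z" using N_eq[OF z] by (simp add: Fz)
  have "Yd y = Y (x p)" unfolding Yd_def y_def d_def by (rule M.in_chart_at)
  then have lieY: "dg a b (fder F z (T z) + N z) + g (x p) (fder Yd y a) b + g (x p) a (fder Yd y b)
      = k (x p) * g (x p) a b" for a b
    using lie[of "x p" a b] unfolding lie_metric_def Let_def d_def[symmetric] y_def[symmetric] Yd_def[symmetric]
    by (simp add: Y0 dg_def)
  have pull: "fder (\<lambda>z. Ic c z u w) z (T z) = dg (fder F z u) (fder F z w) (fder F z (T z))
      + g (x p) (sder F z (T z) u) (fder F z w) + g (x p) (fder F z u) (sder F z (T z) w)"
    using fder_pullback_bilinear[where g' = "gd d" and g = "Ic c" and T = "cimg d", OF oW z F FS gb gs]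
      I_in_eq[OF c(1) d(1)] unfolding F_def[symmetric] Fz gy dg_def by blast
  have Ip: "I p a b = g (x p) (fder F z a) (fder F z b)" for a b
    by (simp add: induced_metric_def differential_def F_def z_def c_def d_def)
  have Nz: "N z = norp (Y \<circ> x) p"
    by (simp add: N_def sec_in_def zc(2)) (simp add: d_def)
  have nN: "normal p (N z)" unfolding Nz by (rule nor_part_normal)
  have II: "I p (shape p (norp (Y \<circ> x) p) u) w = g (x p) (sder F z u w) (N z)
      + (dg (fder F z w) (N z) (fder F z u) + dg (fder F z u) (N z) (fder F z w)
         - dg (fder F z u) (fder F z w) (N z)) / 2"
    unfolding Nz[symmetric] shape_eq[OF nN] sff_at_def sff_def c_def[symmetric] d_def[symmetric]
      z_def[symmetric] F_def[symmetric] Fz gy koszul_def dg_def ..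
  have sF: "sder F z a b = sder F z b a" for a b
    by (rule symmetric_second_derivative[OF oW z F])
  \<comment> \<open>This is \<open>perp\<close> with \<open>DN\<close> expanded. It expresses the
    derivative of \<open>Y\<close> along the surface, paired with a tangent vector, by the
    tangential field and the second fundamental form.\<close>
  have eq1: "dg (fder F z w) (N z) (fder F z u) + g (x p) (sder F z u w) (N z)
      + g (x p) (fder Yd y (fder F z u)) (fder F z w)
    = g (x p) (sder F z (T z) u) (fder F z w) + g (x p) (fder F z (fder T z u)) (fder F z w)" for u w
    using perp[of w u] by (simp add: DN_def gl sF[of u "T z"] dg_sym[of "N z"] g_sym[of _ "N z"])
  have eq2: "dg (fder F z u) (fder F z w) (fder F z (T z)) + dg (fder F z u) (fder F z w) (N z)
      + g (x p) (fder Yd y (fder F z u)) (fder F z w) + g (x p) (fder Yd y (fder F z w)) (fder F z u)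
    = k (x p) * g (x p) (fder F z u) (fder F z w)"
    using lieY[of "fder F z u" "fder F z w"] g_sym[of _ "fder F z u" "fder Yd y (fder F z w)"]
    by (simp add: dg_add)
  \<comment> \<open>The two equations \<open>eq1\<close>, for (u,w) and (w,u), eliminate the
    derivatives \<open>y1\<close> and \<open>y2\<close> of \<open>Y\<close> from the conformal
    Killing equation \<open>eq2\<close>.\<close>
  have arith: "P + s1 + s2 + t1 + t2 = K + 2 * (S + (d1 + d2 - n) / 2)"
    if "d1 + S + y1 = s1 + t1" "d2 + S + y2 = s2 + t2" "P + n + y1 + y2 = K"
    for P s1 s2 t1 t2 K S d1 d2 n y1 y2 :: real
    using that by (simp add: field_simps)
  show ?thesis
    unfolding pull II unfolding Ip sF[of u w] g_sym[of "x p" "fder F z u" "sder F z (T z) w"]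
      g_sym[of "x p" "fder F z u" "fder F z (fder T z w)"]
    by (rule arith[OF eq1[of w u, unfolded sF[of u w]] eq1[of u w, unfolded sF[of u w]] eq2])
qed

lemma conformal_D_zero:
  assumes Y: "Y \<in> vector_fields B" and lie: "\<And>y u w. lie_metric B Y g y u w = k y * g y u w"
  shows "D (Y \<circ> x) p u w = 0"
proof -
  interpret rotation_plane "I p" "J p" by (rule rotation_I)
  define c where "c = chart_at A p"
  define z where "z = cmap c p"
  define T where "T = vec_in A c (tanp (Y \<circ> x))"
  define \<nu> where "\<nu> = norp (Y \<circ> x) p"
  have \<nu>: "normal p \<nu>" unfolding \<nu>_def by (rule nor_part_normal)
  have c: "c \<in> A" "p \<in> cdom c" by (auto simp: c_def S.chart_at)
  have z: "z \<in> cimg c" "cinv c z = p" using c by (auto simp: z_def S.cinv_cmap[OF c(1)])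
  have o: "open (cimg c)" by (rule S.open_cimg[OF c(1)])
  have at_z: "Jc c z a = J p a" "Ic c z a b = I p a b" "T z = tanp (Y \<circ> x) p" for a b
    by (simp_all add: T_def z_def c_def S.in_chart_at)
  have T: "linear (fder T z)"
    unfolding T_def by (rule smooth_on_linear_fder[OF tan_in_smooth[OF compose_sections[OF Y] c(1)] z(1)])
  define R where "R = lie_endo A (tanp (Y \<circ> x)) J p"
  define dJ where "dJ a = fder (\<lambda>z. Jc c z a) z (T z)" for a
  have R: "R a = dJ a - fder T z (J p a) + J p (fder T z a)" for a
    by (simp add: R_def lie_endo_def Let_def dJ_def c_def[symmetric] z_def[symmetric] T_def[symmetric] at_z(3))
  have ddJ: "((\<lambda>z. Jc c z a) has_derivative fder (\<lambda>z. Jc c z a) z) (at z)" for a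
    by (rule smooth_on_has_derivative[OF J_in_smooth[OF c(1)] z(1)])
  have dJl: "linear dJ"
    unfolding dJ_def[abs_def]
    by (rule linear_fder_family[where L = "Jc c", OF o z(1) J_in_linear[OF c(1)]])
      (auto intro: smooth_on_differentiable[OF J_in_smooth[OF c(1)] z(1)])
  have Rl: "linear R"
    by (rule linearI) (simp_all add: R linear_rules[OF dJl] linear_rules[OF T] Jl algebra_simps)
  define dI where "dI a b = fder (\<lambda>z. Ic c z a b) z (T z)" for a b
  have Ib: "bilinear (Ic c z')" if "z' \<in> cimg c" for z'
    by (rule inner_formD(1)[OF I_in_inner[OF c(1) that]])
  have Id: "(\<lambda>z. Ic c z a b) differentiable at z" for a b
    by (rule smooth_on_differentiable[OF I_in_smooth[OF c(1)] z(1)])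
  \<comment> \<open>\<open>K\<close> is the Lie derivative of the induced metric along the
    tangential part, just as \<open>dJ\<close> and \<open>dI\<close> are coordinate derivatives
    along it.\<close>
  define K where "K a b = dI a b + I p (fder T z a) b + I p a (fder T z b)" for a b
  have K: "K a b = k (x p) * I p a b + 2 * I p (shape p \<nu> a) b" for a b
    using lie_induced_metric[OF Y lie, of p a b]
    by (simp add: K_def dI_def c_def[symmetric] z_def[symmetric] T_def[symmetric] \<nu>_def)
  have perp: "dI a (J p a) + I p a (dJ a) = 0" for a
  proof -
    have 1: "((\<lambda>z. Ic c z a (Jc c z a)) has_derivative
      (\<lambda>v. fder (\<lambda>z. Ic c z a (J p a)) z v + I p 0 (J p a) + I p a (fder (\<lambda>z. Jc c z a) z v))) (at z)"
      using has_derivative_bilinear_family[where B = "Ic c" and a = "\<lambda>_. a" and a' = "\<lambda>_. 0",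
          OF o z(1) Ib Id has_derivative_const ddJ[of a]] unfolding at_z by blast
    have 2: "((\<lambda>z. Ic c z a (Jc c z a)) has_derivative (\<lambda>_. 0)) (at z)"
      by (subst has_derivative_cong_open[OF o z(1), where g = "\<lambda>_. 0"])
        (auto simp: rotation_plane.J_perp[OF rotation_in[OF c(1)]])
    from fun_cong[OF has_derivative_unique[OF 1 2], of "T z"] show ?thesis by (simp add: dI_def dJ_def bl)
  qed
  have isom: "dI (J p a) (J p a) + 2 * I p (dJ a) (J p a) = dI a a" for a
  proof -
    have 1: "((\<lambda>z. Ic c z (Jc c z a) (Jc c z a)) has_derivative
      (\<lambda>v. fder (\<lambda>z. Ic c z (J p a) (J p a)) z v + I p (fder (\<lambda>z. Jc c z a) z v) (J p a)
        + I p (J p a) (fder (\<lambda>z. Jc c z a) z v))) (at z)"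
      using has_derivative_bilinear_family[where B = "Ic c",
          OF o z(1) Ib Id ddJ[of a] ddJ[of a]] unfolding at_z by blast
    have 2: "((\<lambda>z. Ic c z (Jc c z a) (Jc c z a)) has_derivative
        fder (\<lambda>z. Ic c z a a) z) (at z)"
      by (subst has_derivative_cong_open[OF o z(1), where g = "\<lambda>z. Ic c z a a"])
        (use Id in \<open>auto simp: rotation_plane.J_isometry[OF rotation_in[OF c(1)]] frechet_derivative_works[symmetric]\<close>)
    from fun_cong[OF has_derivative_unique[OF 1 2], of "T z"] show ?thesis
      using sym[of "J p a" "dJ a"] by (simp add: dI_def dJ_def)
  qed
  have "K a (J p a) + I p a (R a) = 0" for a
    using perp[of a] J_skew[of a "fder T z a"] sym[of "J p a" "fder T z a"] by (simp add: K_def R bl)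
  moreover have "2 * I p (R a) (J p a) + K (J p a) (J p a) = K a a" for a
    using isom[of a] sym[of "J p a" "fder T z (J p a)"] sym[of a "fder T z a"] b_J_J[of "fder T z a" a]
    by (simp add: K_def R bl)
  ultimately have "R a + 2 *\<^sub>R (shape p \<nu> (J p a) - (trace (matrix (shape p \<nu>)) / 2) *\<^sub>R J p a) = 0" for a
    by (rule rotation_variation[OF shape_linear[OF \<nu>] shape_sym[OF \<nu>] Rl K])
  then show ?thesis
    by (simp add: D_op_def Let_def wedge_pairing_def shape_operator0_def R_def \<nu>_def bilinear_rules[OF \<sigma>_bilinear])
qed

end

section \<open>Isothermic surfaces\<close>

context immersed_surface
begin

text \<open>A vector with constant components in one chart of the target is cut off by a bump
  function and extended by zero. The cut-off lives on the compact, hence closed, set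
  \<open>K\<close> inside \<open>U\<close>, so \<open>U\<close> and the complement of
  \<open>K\<close> form an open cover, and \<open>V\<close> is smooth on the first and zero on the
  second.\<close>

lemma section_through:
  obtains V where "V \<in> secs" "V p = \<nu>"
proof -
  define c d where "c = chart_at A p" and "d = chart_at B (x p)"
  have c: "c \<in> A" "p \<in> cdom c" and d: "d \<in> B" "x p \<in> cdom d"
    by (auto simp: c_def d_def S.chart_at M.chart_at)
  have "open (W c d)" "cmap c p \<in> W c d" using open_W[OF c(1) d(1)] c d by auto
  then obtain r where r: "r > 0" "cball (cmap c p) r \<subseteq> W c d" using open_contains_cball by blast
  obtain \<phi> :: "real^2 \<Rightarrow> real" where \<phi>: "smooth_on UNIV \<phi>" "\<phi> (cmap c p) = 1"
    "\<And>z. z \<notin> ball (cmap c p) r \<Longrightarrow> \<phi> z = 0"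
    using bump_function[OF r(1), of "cmap c p"] by blast
  define U where "U = cdom c \<inter> x -` cdom d"
  \<comment> \<open>The chart \<open>d\<close> is the preferred one at \<open>x p\<close>, so
    \<open>from_chart\<close> is the identity there and \<open>V p\<close> is \<open>\<nu>\<close>
    itself.\<close>
  define V where "V p' = (if p' \<in> U then \<phi> (cmap c p') *\<^sub>R from_chart B d (x p') \<nu> else 0)" for p'
  define K where "K = cinv c ` cball (cmap c p) r"
  have "K \<subseteq> U"
  proof
    fix p' assume "p' \<in> K"
    then obtain z where z: "z \<in> W c d" "p' = cinv c z" using r(2) unfolding K_def by blast
    show "p' \<in> U" by (rule W_E[OF z(1) c(1)]) (simp add: U_def z(2))
  qed
  have "compact K"
    unfolding K_def using r(2) W_subset
    by (intro compact_continuous_image continuous_on_subset[OF chartD(7)[OF S.is_chart[OF c(1)]]]) auto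
  then have "open (- K)" using compact_imp_closed open_Compl by blast
  have V0: "V p' = 0" if "p' \<notin> K" for p'
  proof (cases "p' \<in> U")
    case True
    then have "cmap c p' \<notin> cball (cmap c p) r"
      using that S.cinv_cmap[OF c(1)] by (force simp: K_def U_def)
    then show ?thesis using \<phi>(3)[of "cmap c p'"] by (simp add: V_def)
  qed (simp add: V_def)
  have "V \<in> secs"
    unfolding sections_def
  proof (intro CollectI ballI)
    fix c' d' assume c': "c' \<in> A" and d': "d' \<in> B"
    let ?f = "\<lambda>z. to_chart B d' (x (cinv c' z)) (V (cinv c' z))"
    let ?S1 = "cmap c' ` (cdom c' \<inter> (U \<inter> x -` cdom d'))" and ?S2 = "cmap c' ` (cdom c' \<inter> (- K \<inter> x -` cdom d'))"
    have "open U" unfolding U_def by (intro open_Int chartD(1) S.is_chart open_preimage c d)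
    then have o: "open ?S1" "open ?S2"
      using \<open>open (- K)\<close> by (intro chart_open_image S.is_chart open_Int open_preimage c' d'; simp)+
    have 1: "smooth_on ?S1 ?f"
    proof -
      let ?t = "cmap c \<circ> cinv c'" and ?s = "cmap d' \<circ> cinv d" and ?T = "cmap d ` (cdom d \<inter> cdom d')"
      have t: "smooth_on ?S1 ?t"
        by (rule smooth_on_subset[OF S.smooth_transition[OF c' c(1)]]) (auto simp: U_def)
      have "smooth_on ?S1 (\<lambda>z. \<phi> (?t z))"
        by (rule smooth_on_compose[OF o(1) open_UNIV \<phi>(1) t]) simp
      moreover have "smooth_on ?S1 (\<lambda>z. fder ?s (X c' d z) \<nu>)"
      proof (rule smooth_on_compose[where g = "X c' d" and f = "\<lambda>y. fder ?s y \<nu>" and T = ?T, OF o(1)])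
        show "open ?T" by (rule M.open_overlap[OF d(1) d'])
        show "smooth_on ?T (\<lambda>y. fder ?s y \<nu>)" by (rule smooth_on_fder[OF M.smooth_transition[OF d(1) d']])
        show "smooth_on ?S1 (X c' d)" by (rule smooth_on_subset[OF smooth_X[OF c' d(1)]]) (auto simp: U_def)
        show "X c' d z \<in> ?T" if "z \<in> ?S1" for z
          using that by (auto simp: U_def S.cinv_cmap[OF c'])
      qed
      ultimately have "smooth_on ?S1 (\<lambda>z. \<phi> (?t z) *\<^sub>R fder ?s (X c' d z) \<nu>)"
        by (rule smooth_on_scaleR[OF o(1)])
      moreover have "\<phi> (?t z) *\<^sub>R fder ?s (X c' d z) \<nu> = ?f z" if z: "z \<in> ?S1" for z
      proof -
        obtain p' where p': "p' \<in> cdom c'" "p' \<in> U" "x p' \<in> cdom d'" "z = cmap c' p'" "cinv c' z = p'"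
          using z by (auto simp: S.cinv_cmap[OF c'])
        then have "x p' \<in> cdom d" by (simp add: U_def)
        then have "fder ?s (X c' d z) \<nu> = to_chart B d' (x p') (from_chart B d (x p') \<nu>)"
          using M.transition_eq[OF d(1) d' _ p'(3)] p'(5) by simp
        then show ?thesis
          using p' by (simp add: V_def linear_rules[OF M.linear_to_chart[OF d' p'(3)]])
      qed
      ultimately show ?thesis using smooth_on_cong[OF o(1)] by (metis (mono_tags, lifting))
    qed
    have "?f z = 0" if "z \<in> ?S2" for z
    proof -
      have "cinv c' z \<notin> K" "x (cinv c' z) \<in> cdom d'"
        using that by (auto simp: S.cinv_cmap[OF c'])
      then show ?thesis by (simp add: V0 linear_rules[OF M.linear_to_chart[OF d']])
    qed
    then have 2: "smooth_on ?S2 ?f"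
      using smooth_on_cong[OF o(2), of ?f "\<lambda>z. 0"] smooth_on_const by blast
    show "smooth_on (W c' d') ?f"
    proof (rule smooth_on_local)
      fix z assume "z \<in> W c' d'"
      then have "z \<in> ?S1 \<or> z \<in> ?S2" using \<open>K \<subseteq> U\<close> by blast
      then show "\<exists>U. open U \<and> z \<in> U \<and> smooth_on U ?f" using 1 2 o by blast
    qed
  qed
  moreover have "V p = \<nu>" using c d \<phi>(2) by (simp add: V_def U_def) (simp add: d_def)
  ultimately show thesis by (rule that)
qed

text \<open>Under \<open>g' = f g\<close> the scalar second fundamental forms with respect to a normal vector \<open>n\<close>
  satisfy \<open>II' = f II - (df(n) / 2) I\<close>, so shape operators change by multiples of the identity.\<close>

lemma conformal_change:
  assumes g': "riemannian_metric B g'" and f: "smooth_fun B f" "\<And>y. 0 < f y"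
    and gf: "\<And>y u w. g' y u w = f y * g y u w"
  shows "complex_structure A B g' x = J" "normal_vector A B g' x p \<nu> \<longleftrightarrow> normal p \<nu>"
    "normal p \<nu> \<Longrightarrow> \<exists>\<mu>. \<forall>u. shape_operator A B g' x p \<nu> u = shape p \<nu> u + \<mu> *\<^sub>R u"
proof -
  interpret G: immersed_surface A B g' x
    by unfold_locales (fact oriented, fact g', fact immersion)
  have I': "induced_metric A B g' x p u w = f (x p) * I p u w" for p u w
    by (simp add: induced_metric_def gf)
  have fp: "f y \<noteq> 0" for y using f(2)[of y] by simp
  show "complex_structure A B g' x = J"
  proof
    fix p
    interpret R: rotation_plane "induced_metric A B g' x p" "complex_structure A B g' x p" by (rule G.rotation_I)
    interpret rotation_plane "I p" "J p" by (rule rotation_I)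
    have "is_rotation (induced_metric A B g' x p) (J p)"
      using J by (simp add: is_rotation_def I')
    then show "complex_structure A B g' x p = J p" using R.rotation_unique by simp
  qed
  show n: "normal_vector A B g' x p \<nu> \<longleftrightarrow> normal p \<nu>"
    by (simp add: normal_vector_def gf fp)
  assume \<nu>: "normal p \<nu>"
  define c d where "c = chart_at A p" and "d = chart_at B (x p)"
  define F where "F = X c d"
  define z where "z = cmap c p"
  define y where "y = cmap d (x p)"
  have c: "c \<in> A" "p \<in> cdom c" and d: "d \<in> B" "x p \<in> cdom d"
    by (auto simp: c_def d_def S.chart_at M.chart_at)
  have y: "y \<in> cimg d" "cinv d y = x p" using d by (auto simp: y_def M.cinv_cmap[OF d(1)])
  have Fz: "F z = y" unfolding F_def z_def y_def by (rule X_apply[OF c])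
  have gy: "gd d y a b = g (x p) a b" "bil_in B d g' y a b = f (x p) * g (x p) a b" for a b
    by (simp_all add: y_def d_def M.in_chart_at gf)
  define \<phi> where "\<phi> = M.chart_fder f (x p)"
  have D: "fder (\<lambda>y. bil_in B d g' y a b) y v = f (x p) * fder (\<lambda>y. gd d y a b) y v + \<phi> v * g (x p) a b" for a b v
  proof -
    have "((f \<circ> cinv d) has_derivative \<phi>) (at y)"
      unfolding \<phi>_def y_def d_def by (rule M.chart_fder_has_derivative[OF f(1)])
    from has_derivative_mult[OF this smooth_on_has_derivative[OF gd_smooth[OF d(1)] y(1)], of a b]
    have "((\<lambda>y. (f \<circ> cinv d) y * gd d y a b) has_derivative
        (\<lambda>v. f (x p) * fder (\<lambda>y. gd d y a b) y v + \<phi> v * g (x p) a b)) (at y)"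
      by (simp add: gy y(2))
    moreover have "(\<lambda>y. bil_in B d g' y a b) = (\<lambda>y. (f \<circ> cinv d) y * gd d y a b)"
      by (simp add: bil_in_def gf fun_eq_iff)
    ultimately show ?thesis by (simp add: fder_eqI)
  qed
  have perp: "g (x p) (fder F z v) \<nu> = 0" for v
    using \<nu> g_sym[of "x p" \<nu>] by (simp add: normal_vector_def differential_def F_def z_def c_def d_def)
  have Ip: "I p a b = g (x p) (fder F z a) (fder F z b)" for a b
    by (simp add: induced_metric_def differential_def F_def z_def c_def d_def)
  have sff: "G.sff_at p u w \<nu> = f (x p) * sff_at p u w \<nu> - \<phi> \<nu> / 2 * I p u w" for u w
    unfolding G.sff_at_def G.sff_def sff_at_def sff_def c_def[symmetric] d_def[symmetric]
      z_def[symmetric] F_def[symmetric] Fz gy koszul_def D perp Ip by (simp add: field_simps)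
  \<comment> \<open>The second fundamental form changes by -\<open>\<phi> \<nu> / 2\<close> times
    \<open>I\<close>. The division by \<open>f\<close> comes from raising the index with the new
    induced metric \<open>f I\<close>.\<close>
  have "shape_operator A B g' x p \<nu> u = shape p \<nu> u + (- \<phi> \<nu> / (2 * f (x p))) *\<^sub>R u" for u
  proof (rule inner_form_eqI[OF I_inner[of p]])
    fix w
    have "f (x p) * I p (shape_operator A B g' x p \<nu> u) w = f (x p) * sff_at p u w \<nu> - \<phi> \<nu> / 2 * I p u w"
      using G.shape_eq[of p \<nu> u w] n \<nu> by (simp add: I' sff)
    then show "I p (shape_operator A B g' x p \<nu> u) w = I p (shape p \<nu> u + (- \<phi> \<nu> / (2 * f (x p))) *\<^sub>R u) w"
      using fp[of "x p"] by (simp add: bilinear_rules[OF inner_formD(1)[OF I_inner]] shape_eq[OF \<nu>] field_simps)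
  qed
  then show "\<exists>\<mu>. \<forall>u. shape_operator A B g' x p \<nu> u = shape p \<nu> u + \<mu> *\<^sub>R u" by blast
qed

end

lemma conformal_structure_ratio:
  assumes B: "atlas B" and C: "conformal_structure B C" "g \<in> C" "h \<in> C"
  obtains f where "smooth_fun B f" "\<And>y. 0 < f y" "\<And>y u w. h y u w = f y * g y u w"
proof -
  interpret M: smooth_atlas B by unfold_locales (fact B)
  obtain g0 f1 f2 where f: "smooth_fun B f1" "\<And>y. 0 < f1 y" "\<And>y u w. g y u w = f1 y * g0 y u w"
    "smooth_fun B f2" "\<And>y. 0 < f2 y" "\<And>y u w. h y u w = f2 y * g0 y u w"
    using C unfolding conformal_structure_def by blast
  show thesis
  proof
    show "smooth_fun B (\<lambda>y. f2 y / f1 y)"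
      unfolding smooth_fun_def o_def
    proof
      fix d assume d: "d \<in> B"
      show "smooth_on (cimg d) (\<lambda>z. f2 (cinv d z) / f1 (cinv d z))"
        by (rule smooth_on_divide[OF M.open_cimg[OF d]])
          (use f(1,2,4) d in \<open>auto simp: smooth_fun_def o_def less_imp_neq[symmetric]\<close>)
    qed
    show "0 < f2 y / f1 y" for y using f by simp
    show "h y u w = f2 y / f1 y * g y u w" for y u w using f(2)[of y] by (simp add: f(3,6))
  qed
qed

context teichmueller_immersion
begin

abbreviation q where "q \<equiv> part_2_0 J Q"

text \<open>J-symmetry of \<open>\<sigma>\<close> collapses the four terms of the (2,0)-part. The
  imaginary part of 2q is \<open>\<sigma>\<close> itself, which is how closedness of
  \<open>\<sigma>\<close> can become holomorphy of \<open>q\<close>.\<close>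

lemma q_eq: "q p u w = (of_real (Q p u w) + \<i> * of_real (\<sigma> p u w)) / 2"
proof -
  interpret rotation_plane "I p" "J p" by (rule rotation_I)
  have "Q p (J p u) (J p w) = - Q p u w" "Q p (J p u) w = - \<sigma> p u w" "Q p u (J p w) = - \<sigma> p u w"
    by (simp_all add: Q_eq \<sigma>_J[symmetric] J_J Jl bilinear_rules[OF \<sigma>_bilinear])
  then show ?thesis by (simp add: part_2_0_def)
qed

lemma two_Re_q: "2 * Re (q p u w) = Q p u w"
  by (simp add: q_eq)

lemma E_eq_0_iff:
  "(\<forall>V\<in>secs. \<forall>p u w. E V p u w = 0) \<longleftrightarrow>
   (\<forall>p \<nu>. normal p \<nu> \<longrightarrow> (\<forall>u w. Q p (shape p \<nu> u) w = Q p u (shape p \<nu> w)))"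
proof (intro iffI allI impI ballI)
  fix p \<nu> u w
  assume E: "\<forall>V\<in>secs. \<forall>p u w. E V p u w = 0" and \<nu>: "normal p \<nu>"
  obtain V where V: "V \<in> secs" "V p = \<nu>" by (rule section_through)
  then have "norp V p = \<nu>" using nor_part_of_normal[of p V] \<nu> by simp
  then show "Q p (shape p \<nu> u) w = Q p u (shape p \<nu> w)"
    using E[rule_format, OF V(1), of p u w] Q_sym[of p w "shape p \<nu> u"] by (simp add: E_eq)
next
  fix V p u w
  assume "\<forall>p \<nu>. normal p \<nu> \<longrightarrow> (\<forall>u w. Q p (shape p \<nu> u) w = Q p u (shape p \<nu> w))"
  then show "E V p u w = 0"
    using nor_part_normal[of p V] Q_sym[of p w "shape p (norp V p) u"] by (simp add: E_eq)
qed

section \<open>Holomorphic quadratic differentials\<close>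


lemma q_bilinear: "bilinear (q p)"
  unfolding bilinear_def q_eq
  by (intro conjI allI linearI)
    (simp_all add: bilinear_rules[OF Q_bilinear] bilinear_rules[OF \<sigma>_bilinear] scaleR_conv_of_real[where 'a = complex] field_simps)

lemma \<sigma>_sym: "\<sigma> p u w = \<sigma> p w u"
  by (rule rotation_plane.quadratic_symmetric[OF rotation_I, of "\<sigma> p"]) (rule \<sigma>_bilinear, rule \<sigma>_J)

lemma q_sym: "q p u w = q p w u"
  using Q_sym[of p u w] \<sigma>_sym[of p u w] by (simp add: q_eq)

lemma q_J: "q p (J p u) w = \<i> * q p u w"
proof -
  interpret rotation_plane "I p" "J p" by (rule rotation_I)
  have "Q p (J p u) w = - \<sigma> p u w" "\<sigma> p (J p u) w = Q p u w"
    by (simp_all add: Q_eq \<sigma>_J[symmetric] J_J bilinear_rules[OF \<sigma>_bilinear])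
  then show ?thesis by (simp add: q_eq complex_eq_iff)
qed

section \<open>Quadratic differentials in holomorphic coordinates\<close>

lemma holomorphic_chart_derivative:
  assumes k: "holomorphic_chart A J k" and c: "c \<in> A" "p \<in> cdom c" "p \<in> cdom k"
  shows "to_chart A k p u = fder (cmap k \<circ> cinv c) (cmap c p) (to_chart A c p u)"
proof -
  have "(cmap k \<circ> cinv c) differentiable at (cmap c p)"
    by (rule smooth_on_differentiable[of "cmap c ` (cdom c \<inter> cdom k)"])
      (use k c in \<open>auto simp: holomorphic_chart_def\<close>)
  from fder_eqI[OF chart_change_has_derivative[OF S.is_chart[OF c(1)] S.is_chart[OF S.chart_at(1)] c(2)
        S.chart_at(2) this S.transition_differentiable[OF S.chart_at(1) c(1) S.chart_at(2) c(2)]]]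
  show ?thesis by (simp add: to_chart_def)
qed

lemma holomorphic_chart_linear:
  assumes k: "holomorphic_chart A J k" and p: "p \<in> cdom k"
  shows "linear (to_chart A k p)"
  unfolding to_chart_def
  by (rule smooth_on_linear_fder[of "cmap (chart_at A p) ` (cdom (chart_at A p) \<inter> cdom k)"])
    (use k p S.chart_at[of p] in \<open>auto simp: holomorphic_chart_def\<close>)

text \<open>With \<open>J\<close> as multiplication by the imaginary unit the tangent plane is a
  complex line. There \<open>q\<close> and the square of the coordinate differential are complex
  bilinear, hence proportional, and any \<open>e\<close> that the differential does not annihilate
  computes the ratio.\<close>

lemma q_in_holomorphic_chart:
  assumes k: "holomorphic_chart A J k" and p: "p \<in> cdom k" and e: "to_chart A k p e \<noteq> 0"
  shows "q p u w = q p e e / (to_chart A k p e)\<^sup>2 * to_chart A k p u * to_chart A k p w"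
proof -
  interpret rotation_plane "I p" "J p" by (rule rotation_I)
  let ?\<theta> = "to_chart A k p"
  note l = linear_rules[OF holomorphic_chart_linear[OF k p]]
  have J\<theta>: "?\<theta> (J p u) = \<i> * ?\<theta> u" for u using k p unfolding holomorphic_chart_def by blast
  have "e \<noteq> 0" using e l(5) by auto
  then obtain a b a' b' where u: "u = a *\<^sub>R e + b *\<^sub>R J p e" and w: "w = a' *\<^sub>R e + b' *\<^sub>R J p e"
    using frame by metis
  have 1: "q p u w = (of_real a + \<i> * of_real b) * (of_real a' + \<i> * of_real b') * q p e e"
    using q_sym[of p e "J p e"]
    by (simp add: u w bilinear_rules[OF q_bilinear] q_J scaleR_conv_of_real[where 'a = complex] algebra_simps)
  have 2: "?\<theta> u = (of_real a + \<i> * of_real b) * ?\<theta> e" "?\<theta> w = (of_real a' + \<i> * of_real b') * ?\<theta> e"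
    by (simp_all add: u w l J\<theta> scaleR_conv_of_real[where 'a = complex] algebra_simps)
  show ?thesis unfolding 1 2 using e by (simp add: power2_eq_square)
qed

text \<open>The Cauchy-Riemann equation for the coefficient of \<open>q\<close> in the coordinate \<open>\<tau>\<close>. In terms of the
  connection \<open>\<nabla>\<close>, both \<open>\<nabla>d\<tau>\<close> and \<open>\<nabla>q\<close> are complex linear in all arguments but the direction of
  differentiation, and symmetry of \<open>\<nabla>d\<tau>\<close> and \<open>d\<^sup>\<nabla>\<sigma> = 0\<close> allow to exchange this direction with
  another argument.\<close>

lemma q_coefficient_derivative:
  assumes k: "holomorphic_chart A J k" and p: "p \<in> cdom k" and e: "to_chart A k p e \<noteq> 0"
  defines "c \<equiv> chart_at A p"
  defines "\<tau> \<equiv> cmap k \<circ> cinv c"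
  shows "\<exists>L. ((\<lambda>y. q (cinv c y) (from_chart A c (cinv c y) e) (from_chart A c (cinv c y) e) / (fder \<tau> y e)\<^sup>2)
    has_derivative (\<lambda>v. L * to_chart A k p v)) (at (cmap c p))"
proof -
  interpret rotation_plane "I p" "J p" by (rule rotation_I)
  define z where "z = cmap c p"
  define \<theta> where "\<theta> = to_chart A k p"
  have c: "c \<in> A" "p \<in> cdom c" by (auto simp: c_def S.chart_at)
  have z: "z \<in> cimg c" "cinv c z = p" using c by (auto simp: z_def S.cinv_cmap[OF c(1)])
  have o: "open (cimg c)" by (rule S.open_cimg[OF c(1)])
  let ?S = "cmap c ` (cdom c \<inter> cdom k)"
  have k': "is_chart k" using k by (simp add: holomorphic_chart_def)
  have S: "open ?S" "z \<in> ?S"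
    using c p by (auto simp: z_def intro!: chart_open_image S.is_chart chartD(1)[OF k'])
  have \<tau>: "smooth_on ?S \<tau>" using k c unfolding holomorphic_chart_def \<tau>_def by blast
  have \<theta>: "fder \<tau> z v = \<theta> v" for v
    using holomorphic_chart_derivative[OF k c p, of v] by (simp add: \<theta>_def \<tau>_def z_def) (simp add: c_def)
  note \<theta>l = linear_rules[OF holomorphic_chart_linear[OF k p], folded \<theta>_def]
  have J\<theta>: "\<theta> (J p u) = \<i> * \<theta> u" for u using k p unfolding holomorphic_chart_def \<theta>_def by blast
  note at_z = S.in_chart_at[of p, folded c_def, folded z_def]
  obtain G where G: "bilinear G" "\<And>a b. G a b = G b a"
    and DJ: "\<And>a b. fder (\<lambda>z. Jc c z b) z a = J p (G a b) - G a (J p b)"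
    and D\<sigma>: "\<And>u w v. fder (\<lambda>z. \<sigma>c c z w v) z u - \<sigma> p w (G u v) = fder (\<lambda>z. \<sigma>c c z u v) z w - \<sigma> p u (G w v)"
    using parallel_connection_at[of p] unfolding c_def z_def by blast
  define dJ where "dJ v a = fder (\<lambda>z. Jc c z a) z v" for v a
  have dJ: "dJ v a = J p (G v a) - G v (J p a)" for v a
    by (simp add: dJ_def DJ)
  have J': "((\<lambda>y. Jc c y a) has_derivative (\<lambda>v. dJ v a)) (at z)" for a
    unfolding dJ_def by (rule smooth_on_has_derivative[OF J_in_smooth[OF c(1)] z(1)])
  define s where "s v a b = fder (\<lambda>y. \<sigma>c c y a b) z v" for v a b
  have s_sym: "s v a b = s v b a" for v a b
    unfolding s_def bil_in_def \<sigma>_sym[of _ "from_chart A c _ a"] ..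
  have sd: "((\<lambda>y. \<sigma>c c y a b) has_derivative (\<lambda>v. s v a b)) (at z)" for a b
    unfolding s_def by (rule smooth_on_has_derivative[OF \<sigma>_smooth[OF c(1)] z(1)])
  have s_bilinear: "bilinear (s v)" for v
    unfolding s_def[abs_def]
    by (rule bilinear_fder_family[OF o z(1) \<sigma>_in_bilinear[OF c(1)] differentiableI[OF sd]])
  note \<sigma>l = bilinear_rules[OF \<sigma>_bilinear]
  have sJ: "((\<lambda>y. \<sigma>c c y a (Jc c y b)) has_derivative (\<lambda>v. s v a (J p b) + \<sigma> p a (dJ v b))) (at z)" for a b
  proof -
    have "((\<lambda>y. \<sigma>c c y a (Jc c y b)) has_derivative
      (\<lambda>v. fder (\<lambda>y. \<sigma>c c y a (J p b)) z v + \<sigma> p 0 (J p b) + \<sigma> p a (dJ v b))) (at z)"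
      using has_derivative_bilinear_family[where B = "\<sigma>c c" and a = "\<lambda>_. a" and a' = "\<lambda>_. 0",
          OF o z(1) \<sigma>_in_bilinear[OF c(1)] differentiableI[OF sd] has_derivative_const J'[of b]]
      unfolding at_z by blast
    then show ?thesis by (simp add: s_def \<sigma>l)
  qed
  \<comment> \<open>The derivative of the J-symmetry of \<open>\<sigma>\<close>. The fields
    \<open>J a\<close> and \<open>J b\<close> vary with the point and contribute the terms with
    \<open>dJ\<close>.\<close>
  have Js: "s v a (J p b) + \<sigma> p a (dJ v b) = s v (J p a) b + \<sigma> p (dJ v a) b" for v a b
  proof -
    have swap: "\<sigma>c c y b (Jc c y a) = \<sigma>c c y a (Jc c y b)" if "y \<in> cimg c" for y
      using \<sigma>_sym[of "cinv c y"] \<sigma>_J[of "cinv c y"] c(1) S.cinv_in[OF c(1) that]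
      by (simp add: bil_in_def endo_in_def)
    have "((\<lambda>y. \<sigma>c c y b (Jc c y a)) has_derivative (\<lambda>v. s v a (J p b) + \<sigma> p a (dJ v b))) (at z)"
      by (subst has_derivative_cong_open[OF o z(1) swap]) (auto intro: sJ)
    from has_derivative_unique[OF this sJ[of b a]]
    show ?thesis using s_sym[of v b "J p a"] \<sigma>_sym[of p b "dJ v a"] by (simp add: fun_eq_iff)
  qed
  \<comment> \<open>These are the only connection terms that survive in the Cauchy-Riemann equations
    for numerator and denominator.\<close>
  define m n where "m = G e (J p e)" and "n = G e e"
  have cov: "(s u w v - \<sigma> p w (G u v)) - (s w u v - \<sigma> p u (G w v)) = 0" for u w v
    using D\<sigma>[of w v u] by (simp add: s_def)
  have J\<sigma>: "\<sigma> p (J p a) b = \<sigma> p a (J p b)" for a b by (simp add: \<sigma>_J)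
  \<comment> \<open>\<open>im\<close> and \<open>re\<close> are the imaginary and the real part of
    twice the equation \<open>star2\<close> below.\<close>
  have im: "s (J p e) e e - (s e e (J p e) + \<sigma> p e (J p n) - \<sigma> p e m) = 2 * (\<sigma> p e m - \<sigma> p e (J p n))"
    using cov[of "J p e" e e] G(2)[of "J p e" e] s_sym[of e "J p e" e]
    by (simp add: m_def n_def J\<sigma>)
  have re: "s (J p e) e (J p e) + \<sigma> p e (J p m) - \<sigma> p e (G (J p e) (J p e)) + s e e e
      = 2 * \<sigma> p e (J p m) + 2 * \<sigma> p e n"
    using cov[of "J p e" e "J p e"] Js[of e e "J p e"]
      \<sigma>_sym[of p "J p (G e e)" "J p e"] \<sigma>_sym[of p "G e (J p e)" "J p e"]
    by (simp add: m_def n_def J\<sigma> dJ J_J \<sigma>l bilinear_rules[OF G(1)] bilinear_rules[OF s_bilinear])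
  define a where "a y = q (cinv c y) (from_chart A c (cinv c y) e) (from_chart A c (cinv c y) e)" for y
  define Da where "Da v = (of_real (s v e (J p e) + \<sigma> p e (dJ v e)) + \<i> * of_real (s v e e)) / 2" for v
  have a: "(a has_derivative Da) (at z)"
  proof -
    have "((\<lambda>y. (of_real (\<sigma>c c y e (Jc c y e)) + \<i> * of_real (\<sigma>c c y e e)) / 2)
      has_derivative Da) (at z)"
      unfolding Da_def[abs_def] by (auto intro!: derivative_eq_intros sJ sd)
    then show ?thesis
      by (subst has_derivative_cong_open[OF o z(1)])
        (use c(1) S.cinv_in[OF c(1)] in \<open>auto simp: a_def q_eq Q_eq bil_in_def endo_in_def\<close>)
  qed
  have az: "a z = q p e e" by (simp add: a_def z(2)) (simp add: c_def)
  define b where "b y = fder \<tau> y e" for y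
  define Db where "Db v = sder \<tau> z v e" for v
  have b: "(b has_derivative Db) (at z)"
    unfolding b_def[abs_def] Db_def[abs_def] by (rule smooth_on_has_derivative[OF smooth_on_fder[OF \<tau>] S(2)])
  have bz: "b z = \<theta> e" by (simp add: b_def \<theta>)
  have ne: "\<theta> e \<noteq> 0" using e by (simp add: \<theta>_def)
  \<comment> \<open>Cauchy-Riemann for the denominator, up to connection terms: differentiate the
    complex linearity of the differential of \<open>\<tau>\<close> in direction \<open>e\<close>,
    then use symmetry of the second derivative to move \<open>J p e\<close> into the direction
    slot.\<close>
  have star1: "Db (J p e) = \<i> * Db e + \<theta> m - \<i> * \<theta> n"
  proof -
    have 1: "((\<lambda>y. fder \<tau> y (Jc c y e)) has_derivative (\<lambda>v. sder \<tau> z v (J p e) + \<theta> (dJ v e))) (at z)"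
      using has_derivative_linear_family[where L = "fder \<tau>", OF S smooth_on_linear_fder[OF \<tau>] _ J'[of e]]
        smooth_on_differentiable[OF smooth_on_fder[OF \<tau>] S(2)] unfolding at_z \<theta> by blast
    have 2: "((\<lambda>y. fder \<tau> y (Jc c y e)) has_derivative (\<lambda>v. \<i> * Db v)) (at z)"
    proof (subst has_derivative_cong_open[OF S, where g = "\<lambda>y. \<i> * b y"])
      fix y assume "y \<in> ?S"
      then obtain p' where p': "p' \<in> cdom c" "p' \<in> cdom k" "y = cmap c p'" "cinv c y = p'"
        using S.cinv_cmap[OF c(1)] by auto
      have "fder \<tau> y u = to_chart A k p' (from_chart A c p' u)" for u
        using holomorphic_chart_derivative[OF k c(1) p'(1,2)] p' c(1) by (simp add: \<tau>_def)
      then show "fder \<tau> y (Jc c y e) = \<i> * b y"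
        using k p' c(1) by (simp add: b_def endo_in_def holomorphic_chart_def)
    qed (intro has_derivative_mult_right b)
    from fun_cong[OF has_derivative_unique[OF 1 2], of e] symmetric_second_derivative[OF S \<tau>, of "J p e" e]
    show ?thesis by (simp add: Db_def dJ \<theta>l J\<theta> m_def n_def algebra_simps)
  qed
  have star2: "Da (J p e) = \<i> * Da e + 2 * q p e m - 2 * \<i> * q p e n"
    using im re G(2)[of "J p e" e]
    by (simp add: Da_def q_eq Q_eq dJ \<sigma>l complex_eq_iff m_def n_def field_simps)
  \<comment> \<open>Proportionality of \<open>q\<close> and the squared differential makes the
    errors in \<open>star1\<close> and \<open>star2\<close> cancel in the derivative of the
    quotient.\<close>
  have qm: "q p e v * \<theta> e = a z * \<theta> v" for v
    using q_in_holomorphic_chart[OF k p e, of e v] ne by (simp add: \<theta>_def[symmetric] az power2_eq_square)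
  define DF where "DF v = (Da v * (b z * b z) - a z * (b z * Db v + Db v * b z)) / ((b z * b z) * (b z * b z))" for v
  have F: "((\<lambda>y. a y / (b y)\<^sup>2) has_derivative DF) (at z)"
    unfolding power2_eq_square DF_def[abs_def]
    by (rule has_derivative_divide'[OF a has_derivative_mult[OF b b]]) (use ne bz in simp)
  have DFJ: "DF (J p e) = \<i> * DF e"
  proof -
    have "Da (J p e) * (b z * b z) - a z * (b z * Db (J p e) + Db (J p e) * b z)
      = \<i> * (Da e * (b z * b z) - a z * (b z * Db e + Db e * b z))
        + 2 * \<theta> e * (q p e m * \<theta> e - a z * \<theta> m) - 2 * \<i> * \<theta> e * (q p e n * \<theta> e - a z * \<theta> n)"
      unfolding star1 star2 bz by (simp add: algebra_simps)
    then show ?thesis by (simp add: DF_def qm)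
  qed
  have DFl: "linear DF" using has_derivative_linear[OF F] .
  \<comment> \<open>\<open>DF\<close> is real linear and commutes with the complex structures at
    \<open>e\<close>, which generates the plane together with \<open>J p e\<close>; hence it is a
    complex multiple of \<open>\<theta>\<close>.\<close>
  have "DF v = (DF e / \<theta> e) * \<theta> v" for v
  proof -
    have "e \<noteq> 0" using ne \<theta>l(5) by auto
    then obtain r t where v: "v = r *\<^sub>R e + t *\<^sub>R J p e" using frame by metis
    show ?thesis using ne
      by (simp add: v linear_rules[OF DFl] \<theta>l J\<theta> DFJ scaleR_conv_of_real[where 'a = complex] field_simps)
  qed
  then have "DF = (\<lambda>v. (DF e / \<theta> e) * \<theta> v)" by blast
  from has_derivative_eq_rhs[OF F this]
  show ?thesis unfolding a_def b_def \<theta>_def z_def by (rule exI)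
qed

text \<open>The coefficient \<open>h\<close> is defined with an arbitrary test vector at each point,
  without any regularity. Near a given point it agrees with the quotient for a vector
  \<open>e\<close> of constant components in a chart of \<open>A\<close>, whose derivative is known.
  It remains to pull this back along the inverse of the holomorphic coordinate.\<close>

lemma q_holomorphic: "holomorphic_quadratic_differential A J q"
  unfolding holomorphic_quadratic_differential_def
proof (intro conjI allI impI)
  show "bilinear (q p)" "q p u w = q p w u" "q p (J p u) w = \<i> * q p u w" for p u w
    by (rule q_bilinear, rule q_sym, rule q_J)
  fix k assume k: "holomorphic_chart A J k"
  then have k': "is_chart k" by (simp add: holomorphic_chart_def)
  define v where "v p = (SOME u. to_chart A k p u \<noteq> 0)" for p
  have v: "to_chart A k p (v p) \<noteq> 0" if "p \<in> cdom k" for p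
    using k that unfolding holomorphic_chart_def v_def by (metis (mono_tags, lifting) someI_ex)
  define h where "h \<zeta> = q (cinv k \<zeta>) (v (cinv k \<zeta>)) (v (cinv k \<zeta>)) / (to_chart A k (cinv k \<zeta>) (v (cinv k \<zeta>)))\<^sup>2" for \<zeta>
  have qh: "q p u w = h (cmap k p) * to_chart A k p u * to_chart A k p w" if p: "p \<in> cdom k" for p u w
    unfolding h_def chartD(3)[OF k' p] by (rule q_in_holomorphic_chart[OF k p v[OF p]])
  have "h holomorphic_on cimg k"
    unfolding holomorphic_on_def
  proof
    fix \<zeta> assume "\<zeta> \<in> cimg k"
    then obtain p where p: "p \<in> cdom k" "\<zeta> = cmap k p" by auto
    interpret rotation_plane "I p" "J p" by (rule rotation_I)
    define c where "c = chart_at A p"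
    have c: "c \<in> A" "p \<in> cdom c" by (auto simp: c_def S.chart_at)
    define \<tau> where "\<tau> = cmap k \<circ> cinv c"
    define e where "e = v p"
    define \<theta> where "\<theta> = to_chart A k p"
    have \<theta>e: "\<theta> e \<noteq> 0" unfolding \<theta>_def e_def by (rule v[OF p(1)])
    note \<theta>l = linear_rules[OF holomorphic_chart_linear[OF k p(1)], folded \<theta>_def]
    have J\<theta>: "\<theta> (J p u) = \<i> * \<theta> u" for u using k p unfolding holomorphic_chart_def \<theta>_def by blast
    define F where "F y = q (cinv c y) (from_chart A c (cinv c y) e) (from_chart A c (cinv c y) e) / (fder \<tau> y e)\<^sup>2" for y
    obtain L where L: "(F has_derivative (\<lambda>v. L * \<theta> v)) (at (cmap c p))"
      using q_coefficient_derivative[OF k p(1) \<theta>e[unfolded \<theta>_def]]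
      unfolding F_def[abs_def] \<tau>_def c_def \<theta>_def by blast
    let ?S = "cmap c ` (cdom c \<inter> cdom k)"
    have S: "open ?S" "cmap c p \<in> ?S"
      using c p by (auto intro!: chart_open_image S.is_chart chartD(1)[OF k'])
    have \<tau>: "smooth_on ?S \<tau>" using k c unfolding holomorphic_chart_def \<tau>_def by blast
    have \<tau>\<theta>: "fder \<tau> (cmap c p') (to_chart A c p' u) = to_chart A k p' u" if "p' \<in> cdom c" "p' \<in> cdom k" for p' u
      using holomorphic_chart_derivative[OF k c(1) that] by (simp add: \<tau>_def)
    have d\<tau>: "(\<tau> has_derivative \<theta>) (at (cmap c p))"
    proof -
      have "fder \<tau> (cmap c p) = \<theta>"
        using \<tau>\<theta>[OF c(2) p(1)] by (simp add: \<theta>_def fun_eq_iff) (simp add: c_def)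
      then show ?thesis using smooth_on_has_derivative[OF \<tau> S(2)] by simp
    qed
    define \<rho> where "\<rho> = cmap c \<circ> cinv k"
    \<comment> \<open>The inverse of \<open>\<theta>\<close>: the real and imaginary parts of
      \<open>w / \<theta> e\<close> are the coefficients in the frame \<open>e\<close>,
      \<open>J p e\<close>. Smoothness is given for \<open>\<tau>\<close> only, so the derivative of
      its inverse \<open>\<rho>\<close> is obtained from continuity of \<open>\<rho>\<close> and
      this left inverse.\<close>
    define \<rho>' where "\<rho>' w = Re (w / \<theta> e) *\<^sub>R e + Im (w / \<theta> e) *\<^sub>R J p e" for w
    let ?T = "cmap k ` (cdom k \<inter> cdom c)"
    have T: "open ?T" "\<zeta> \<in> ?T"
      using c p by (auto intro!: chart_open_image chartD(1)[OF S.is_chart[OF c(1)]] k')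
    have \<tau>z: "\<tau> (cmap c p) = \<zeta>" using p by (simp add: \<tau>_def S.cinv_cmap[OF c(1) c(2)])
    have "(\<rho> has_derivative \<rho>') (at (\<tau> (cmap c p)))"
    proof (rule has_derivative_inverse_basic_x[OF d\<tau>])
      show "bounded_linear \<rho>'"
        unfolding \<rho>'_def[abs_def] divide_inverse
        by (intro bounded_linear_add bounded_linear_scaleR_const[OF bounded_linear_compose[OF bounded_linear_Re bounded_linear_mult_left]]
            bounded_linear_scaleR_const[OF bounded_linear_compose[OF bounded_linear_Im bounded_linear_mult_left]])
      show "\<rho>' \<circ> \<theta> = id"
      proof
        fix u
        have "e \<noteq> 0" using \<theta>e \<theta>l(5) by auto
        then obtain r t where u: "u = r *\<^sub>R e + t *\<^sub>R J p e" using frame by metis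
        have "\<theta> u / \<theta> e = of_real r + \<i> * of_real t"
          using \<theta>e by (simp add: u \<theta>l J\<theta> scaleR_conv_of_real[where 'a = complex] field_simps)
        then show "(\<rho>' \<circ> \<theta>) u = id u" by (simp add: \<rho>'_def u)
      qed
      have "continuous_on ?T \<rho>"
        unfolding \<rho>_def
        by (intro continuous_on_compose continuous_on_subset[OF chartD(7)[OF k']]
            continuous_on_subset[OF chartD(6)[OF S.is_chart[OF c(1)]]]) (auto simp: chartD(3)[OF k'])
      then show "continuous (at (\<tau> (cmap c p))) \<rho>"
        unfolding \<tau>z using continuous_on_eq_continuous_at[OF T(1)] T(2) by blast
      show "\<rho> (\<tau> (cmap c p)) = cmap c p" using p by (simp add: \<tau>z \<rho>_def chartD(3)[OF k'])
      show "open ?T" by (rule T(1))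
      show "\<tau> (cmap c p) \<in> ?T" using T(2) \<tau>z by simp
      show "\<tau> (\<rho> y) = y" if "y \<in> ?T" for y
        using that by (auto simp: \<tau>_def \<rho>_def chartD(3)[OF k'] S.cinv_cmap[OF c(1)])
    qed
    then have "(\<rho> has_derivative \<rho>') (at \<zeta>)" by (simp add: \<tau>z)
    moreover have "\<rho> \<zeta> = cmap c p" using p by (simp add: \<rho>_def chartD(3)[OF k'])
    ultimately have "((\<lambda>y. F (\<rho> y)) has_derivative (\<lambda>w. L * \<theta> (\<rho>' w))) (at \<zeta>)"
      using has_derivative_compose[of \<rho> \<rho>' \<zeta> UNIV F "\<lambda>v. L * \<theta> v"] L by simp
    moreover have "\<theta> (\<rho>' w) = w" for w
    proof -
      have "\<theta> (\<rho>' w) = (of_real (Re (w / \<theta> e)) + \<i> * of_real (Im (w / \<theta> e))) * \<theta> e"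
        by (simp add: \<rho>'_def \<theta>l J\<theta> scaleR_conv_of_real[where 'a = complex] algebra_simps)
      also have "\<dots> = w" using \<theta>e by (simp add: complex_eq[symmetric])
      finally show ?thesis .
    qed
    ultimately have F\<rho>: "((\<lambda>y. F (\<rho> y)) has_derivative (\<lambda>w. L * w)) (at \<zeta>)" by simp
    define S' where "S' = ?S \<inter> (\<lambda>y. fder \<tau> y e) -` (- {0})"
    have "open S'"
      unfolding S'_def
      using continuous_on_open_vimage[OF S(1), of "\<lambda>y. fder \<tau> y e"]
        smooth_on_continuous[OF smooth_on_fder[OF \<tau>]] by (simp add: Int_commute open_Compl)
    define U where "U = cdom c \<inter> cmap c -` S'"
    have "open U"
      unfolding U_def using continuous_on_open_vimage[OF chartD(1)[OF S.is_chart[OF c(1)]], of "cmap c"]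
        chartD(6)[OF S.is_chart[OF c(1)]] \<open>open S'\<close> by (simp add: Int_commute)
    then have T': "open (cmap k ` (cdom k \<inter> U))" by (rule chart_open_image[OF k'])
    have "cmap c p \<in> S'"
      using S(2) \<theta>e fder_eqI[OF d\<tau>] by (simp add: S'_def)
    then have pT': "\<zeta> \<in> cmap k ` (cdom k \<inter> U)" using p c by (auto simp: U_def)
    have "h y = F (\<rho> y)" if y: "y \<in> cmap k ` (cdom k \<inter> U)" for y
    proof -
      obtain p' where p': "p' \<in> cdom k" "p' \<in> cdom c" "cmap c p' \<in> S'" "y = cmap k p'" using y by (auto simp: U_def)
      have inv: "cinv c (cmap c p') = p'" "\<rho> y = cmap c p'"
        using p' by (auto simp: S.cinv_cmap[OF c(1)] \<rho>_def chartD(3)[OF k'])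
      have "fder \<tau> (cmap c p') e = to_chart A k p' (from_chart A c p' e)"
        using \<tau>\<theta>[OF p'(2,1), of "from_chart A c p' e"] c(1) p'(2) by simp
      moreover have "fder \<tau> (cmap c p') e \<noteq> 0" using p'(3) by (simp add: S'_def)
      ultimately show ?thesis
        unfolding F_def inv using qh[OF p'(1), of "from_chart A c p' e" "from_chart A c p' e"] p'(4)
        by (simp add: power2_eq_square)
    qed
    then have "(h has_derivative (\<lambda>w. L * w)) (at \<zeta>)"
      using has_derivative_cong_open[OF T' pT', of h "\<lambda>y. F (\<rho> y)"] F\<rho> by blast
    then show "h field_differentiable (at \<zeta> within cimg k)"
      using has_field_derivative_at_within unfolding field_differentiable_def has_field_derivative_def by blast
  qed
  then show "\<exists>h. h holomorphic_on cimg k \<and>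
      (\<forall>p\<in>cdom k. \<forall>u w. q p u w = h (cmap k p) * to_chart A k p u * to_chart A k p w)"
    using qh by blast
qed

end

theorem mainTheorem5:
  fixes A :: "('s::{t2_space,second_countable_topology}, real^2) chart set"
    and B :: "('m::{t2_space,second_countable_topology}, 'f::euclidean_space) chart set"
    and C :: "('m \<Rightarrow> 'f \<Rightarrow> 'f \<Rightarrow> real) set"
    and g :: "'m \<Rightarrow> 'f \<Rightarrow> 'f \<Rightarrow> real"
    and x :: "'s \<Rightarrow> 'm"
    and \<sigma> :: "'s \<Rightarrow> real^2 \<Rightarrow> real^2 \<Rightarrow> real"
  defines "J \<equiv> complex_structure A B g x"
  defines "Q \<equiv> transpose_compose J \<sigma>"
  defines "q \<equiv> part_2_0 J Q"
  defines "D \<equiv> D_op A B g x \<sigma>"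
    and "\<beta> \<equiv> beta_op A B g x Q"
    and "E \<equiv> E_op A B g x Q"
  assumes surface: "oriented_atlas A" "compact (UNIV :: 's set)"
    and conformal_manifold: "atlas B" "conformal_structure B C"
    and metric: "g \<in> C"
    and immersion: "immersion A B x"
    and covector: "teichmueller_covector A J \<sigma>"
    and nonzero: "\<exists>p u w. \<sigma> p u w \<noteq> 0"
  shows "(first_order_linear_operator A B x D)
    \<and> (\<forall>V \<in> sections A B x. \<beta> V \<in> one_forms A \<and> E V \<in> two_forms A \<and>
           (\<forall>p u w. D V p u w = ext_deriv A (\<beta> V) p u w + E V p u w))
    \<and> (\<forall>V \<in> sections A B x. \<forall>W \<in> sections A B x. \<forall>f h. smooth_fun A f \<longrightarrow> smooth_fun A h \<longrightarrow>
           (\<forall>p u w.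
              \<beta> (\<lambda>p. f p *\<^sub>R V p + h p *\<^sub>R W p) p u = f p * \<beta> V p u + h p * \<beta> W p u \<and>
              E (\<lambda>p. f p *\<^sub>R V p + h p *\<^sub>R W p) p u w = f p * E V p u w + h p * E W p u w))
    \<and> ((\<forall>V \<in> sections A B x. \<forall>p u w. E V p u w = 0) \<longleftrightarrow> globally_isothermic A B C x q)
    \<and> (\<forall>Y. conformal_vector_field B C Y \<longrightarrow>
           (\<forall>p u w. D (Y \<circ> x) p u w = 0) \<and>
           (\<forall>p u. \<beta> (Y \<circ> x) p u = - 2 * Q p u (tan_part A B g x (Y \<circ> x) p) \<and>
                  \<beta> (Y \<circ> x) p u = - 2 * retraction_form A B g x q Y p u) \<and>
           ((\<forall>V \<in> sections A B x. \<forall>p u w. E V p u w = 0) \<longrightarrow>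
              (\<forall>p u w. ext_deriv A (\<beta> (Y \<circ> x)) p u w = 0)))"
proof -
  have "riemannian_metric B g" using conformal_manifold(2) metric unfolding conformal_structure_def by blast
  then interpret T: teichmueller_immersion A B g x \<sigma>
    using surface(1) conformal_manifold(1) immersion covector unfolding J_def
    by unfold_locales (auto simp: oriented_atlas_def)
  note fold = J_def Q_def q_def D_def \<beta>_def E_def
  have iso: "(\<forall>V\<in>sections A B x. \<forall>p u w. E V p u w = 0) \<longleftrightarrow> globally_isothermic A B C x q"
  proof
    assume "\<forall>V\<in>sections A B x. \<forall>p u w. E V p u w = 0"
    then have *: "T.Q p (T.shape p \<nu> u) w = T.Q p u (T.shape p \<nu> w)" if "T.normal p \<nu>" for p \<nu> u w
      using that T.E_eq_0_iff unfolding fold by blast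
    show "globally_isothermic A B C x q"
      unfolding globally_isothermic_def
    proof (intro ballI conjI allI impI)
      fix g' assume g': "g' \<in> C"
      have m: "riemannian_metric B g'" using conformal_manifold(2) g' unfolding conformal_structure_def by blast
      \<comment> \<open>\<open>globally_isothermic\<close> quantifies over all metrics of the class.
        The multiple of the identity by which the shape operator changes is Q-symmetric, so the
        condition for \<open>g\<close> implies that for \<open>g'\<close>.\<close>
      obtain f where f: "smooth_fun B f" "\<And>y. 0 < f y" "\<And>y u w. g' y u w = f y * g y u w"
        using conformal_structure_ratio[OF conformal_manifold metric g'] by blast
      note change = T.conformal_change[OF m f]
      show "holomorphic_quadratic_differential A (complex_structure A B g' x) q"
        unfolding change(1) using T.q_holomorphic unfolding fold .
      fix p \<nu> u w assume "normal_vector A B g' x p \<nu>"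
      then have \<nu>: "T.normal p \<nu>" by (simp only: change(2))
      obtain \<mu> where "\<forall>u. shape_operator A B g' x p \<nu> u = T.shape p \<nu> u + \<mu> *\<^sub>R u"
        using change(3)[OF \<nu>] by blast
      then show "2 * Re (q p (shape_operator A B g' x p \<nu> u) w) = 2 * Re (q p u (shape_operator A B g' x p \<nu> w))"
        unfolding fold T.two_Re_q by (simp add: bilinear_rules[OF T.Q_bilinear] *[OF \<nu>])
    qed
  next
    assume "globally_isothermic A B C x q"
    then have "T.Q p (T.shape p \<nu> u) w = T.Q p u (T.shape p \<nu> w)" if "T.normal p \<nu>" for p \<nu> u w
      using metric that unfolding globally_isothermic_def fold T.two_Re_q by blast
    then show "\<forall>V\<in>sections A B x. \<forall>p u w. E V p u w = 0"
      using T.E_eq_0_iff unfolding fold by blast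
  qed
  have conformal: "D (Y \<circ> x) p u w = 0" "Y \<circ> x \<in> sections A B x"
    if Y: "conformal_vector_field B C Y" for Y p u w
  proof -
    obtain g' k where Y': "Y \<in> vector_fields B" and g': "g' \<in> C" "\<And>y u w. lie_metric B Y g' y u w = k y * g' y u w"
      using Y unfolding conformal_vector_field_def by blast
    have m: "g' \<in> two_tensors B"
      using conformal_manifold(2) g'(1) unfolding conformal_structure_def riemannian_metric_def by blast
    obtain f where f: "smooth_fun B f" "\<And>y. 0 < f y" "\<And>y u w. g y u w = f y * g' y u w"
      using conformal_structure_ratio[OF conformal_manifold g'(1) metric] by blast
    \<comment> \<open>Replacing \<open>g'\<close> by \<open>f\<close> times \<open>g'\<close> adds
      the logarithmic derivative of \<open>f\<close> along \<open>Y\<close> to the conformal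
      factor.\<close>
    have "lie_metric B Y g y u w = (k y + T.M.chart_fder f y (Y y) / f y) * g y u w" for y u w
      using f(2)[of y] T.M.lie_metric_scale[OF f(1) m f(3), of Y y u w] by (simp add: g'(2) f(3)[of y u w] field_simps)
    then show "D (Y \<circ> x) p u w = 0"
      unfolding fold by (rule T.conformal_D_zero[OF Y'])
    show "Y \<circ> x \<in> sections A B x" by (rule T.compose_sections[OF Y'])
  qed
  have noether: "\<beta> (Y \<circ> x) p u = - 2 * retraction_form A B g x q Y p u" for Y p u
    unfolding fold retraction_form_def T.two_Re_q T.\<beta>_eq using T.Q_sym by simp
  have closed: "ext_deriv A (\<beta> (Y \<circ> x)) p u w = 0"
    if "conformal_vector_field B C Y" "\<forall>V\<in>sections A B x. \<forall>p u w. E V p u w = 0" for Y p u w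
    using T.D_decomposition[OF conformal(2)[OF that(1)], of p u w] conformal(1)[OF that(1), of p u w]
      that(2)[rule_format, OF conformal(2)[OF that(1)], of p u w]
    unfolding fold by simp
  have D1: "first_order_linear_operator A B x D" unfolding fold by (rule T.D_first_order)
  have decomposition: "\<beta> V \<in> one_forms A" "E V \<in> two_forms A" "D V p u w = ext_deriv A (\<beta> V) p u w + E V p u w"
    if "V \<in> sections A B x" for V p u w
    unfolding fold by (rule T.\<beta>_one_form[OF that] T.E_two_form[OF that] T.D_decomposition[OF that])+
  have linear: "\<beta> (\<lambda>p. f p *\<^sub>R V p + h p *\<^sub>R W p) p u = f p * \<beta> V p u + h p * \<beta> W p u"
    "E (\<lambda>p. f p *\<^sub>R V p + h p *\<^sub>R W p) p u w = f p * E V p u w + h p * E W p u w" for f h V W p u w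
    unfolding fold by (rule T.\<beta>_combine T.E_combine)+
  have "\<beta> V p u = - 2 * Q p u (tan_part A B g x V p)" for V p u
    unfolding \<beta>_def beta_op_def ..
  then show ?thesis
    using D1 decomposition linear iso conformal(1) noether closed by (intro conjI ballI allI impI) simp_all
qed

end
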